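(* Let $F$ be a finite abelian group, $r\in\mathbb N$, and let $q_1,\dots,q_r\ge 2$ be integers. Let $G=F\oplus(\Sigma_{q_1}\oplus\cdots\oplus\Sigma_{q_r})$, so that $H:=\{0\}\oplus\Sigma_{q_1}\oplus\cdots\oplus\Sigma_{q_r}$ is a finite index subgroup of $G$. If $S\subseteq G$ is such that for all $h\in H$, $S+h$ is a set of recurrence, then there is a sequence $(s_n)_{n\in\mathbb N}$ of elements of $S$ such that for all $h\in H$, $(s_n+h)_{n\in\mathbb N}$ is a rigidity sequence for some free weak mixing $G$-system, and $\{s_n+h:n\in\mathbb N\}$ is a set of recurrence.
   Context: For an integer $q\ge 2$, $\Sigma_q:=\bigoplus_{n=1}^\infty \mathbb Z/q\mathbb Z$. Let $G$ be a countable abelian group (discrete, written additively). A $G$-system is a triple $(X,\mu,T)$ where $(X,\mu)$ is a probability measure space and $T$ is an action of $G$ on $X$ by measure preserving transformations: $\mu(T^gD)=\mu(D)$ for every measurable $D\subseteq X$ and all $g\in G$. $S\subseteq G$ is a set of recurrence if for every $G$-system $(X,\mu,T)$ and every measurable $D\subseteq X$ with $\mu(D)>0$ there is $g\in S$ with $\mu(D\cap T^gD)>0$. A sequence $(s_n)_{n\in\mathbb N}$ in $G$ is a rigidity sequence for $(X,\mu,T)$ if $\lim_{n\to\infty}\mu(D\triangle T^{s_n}D)=0$ for every measurable $D\subseteq X$. $(X,\mu,T)$ is ergodic if every measurable $D\subseteq X$ with $\mu(D\triangle T^gD)=0$ for all $g\in G$ has $\mu(D)\in\{0,1\}$; it is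 weak mixing if $(X\times X,\mu\times\mu,T\times T)$ is ergodic; it is free if $\mu(\{x:T^hx=x\})=0$ for every $h\ne 0$ in $G$. *)

theory Defs
  imports "HOL-Probability.Probability_Measure" "HOL-Algebra.Algebra"
begin

section \<open>Measure preserving actions\<close>

text \<open>
  Groups are written multiplicatively, as everywhere in HOL-Algebra. The predicate
  \<^locale>\<open>group_action\<close> normalises each map \<open>T g\<close> to be \<^const>\<open>undefined\<close> outside \<open>space M\<close>.
\<close>

locale G_system = prob_space M + group_action G "space M" T
  for G :: "('g, 'm) monoid_scheme" and M :: "'x measure" and T :: "'g \<Rightarrow> 'x \<Rightarrow> 'x" +
  assumes measurable_T: "g \<in> carrier G \<Longrightarrow> T g \<in> M \<rightarrow>\<^sub>M M"
    and preserves_T: "\<lbrakk>g \<in> carrier G; D \<in> sets M\<rbrakk> \<Longrightarrow> measure M (T g ` D) = measure M D"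

definition ergodic_action ::
    "('g, 'm) monoid_scheme \<Rightarrow> 'x measure \<Rightarrow> ('g \<Rightarrow> 'x \<Rightarrow> 'x) \<Rightarrow> bool" where
  "ergodic_action G M T \<longleftrightarrow>
     (\<forall>D \<in> sets M. (\<forall>g \<in> carrier G. measure M (sym_diff D (T g ` D)) = 0)
        \<longrightarrow> measure M D \<in> {0, 1})"

definition weak_mixing_action ::
    "('g, 'm) monoid_scheme \<Rightarrow> 'x measure \<Rightarrow> ('g \<Rightarrow> 'x \<Rightarrow> 'x) \<Rightarrow> bool" where
  "weak_mixing_action G M T \<longleftrightarrow>
     ergodic_action G (M \<Otimes>\<^sub>M M) (\<lambda>g. map_prod (T g) (T g))"

text \<open>
  \<^const>\<open>measure\<close> is \<open>0\<close> on non-measurable sets, so the fixed point sets are explicitly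
  required to be measurable.
\<close>

definition free_action ::
    "('g, 'm) monoid_scheme \<Rightarrow> 'x measure \<Rightarrow> ('g \<Rightarrow> 'x \<Rightarrow> 'x) \<Rightarrow> bool" where
  "free_action G M T \<longleftrightarrow>
     (\<forall>h \<in> carrier G - {\<one>\<^bsub>G\<^esub>}.
        {x \<in> space M. T h x = x} \<in> sets M \<and> measure M {x \<in> space M. T h x = x} = 0)"

definition rigidity_sequence ::
    "'x measure \<Rightarrow> ('g \<Rightarrow> 'x \<Rightarrow> 'x) \<Rightarrow> (nat \<Rightarrow> 'g) \<Rightarrow> bool" where
  "rigidity_sequence M T s \<longleftrightarrow>
     (\<forall>D \<in> sets M. (\<lambda>n. measure M (sym_diff D (T (s n) ` D))) \<longlonglongrightarrow> 0)"

text \<open>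
  HOL cannot quantify over all types inside a formula, so the probability spaces below live on
  subsets of \<^typ>\<open>nat \<Rightarrow> real\<close>, with an arbitrary sigma-algebra. For a countable group this is no
  restriction: see \<open>set_of_recurrence_any_type\<close> below.
\<close>

definition set_of_recurrence :: "('g, 'm) monoid_scheme \<Rightarrow> 'g set \<Rightarrow> bool" where
  "set_of_recurrence G S \<longleftrightarrow>
     (\<forall>(M :: (nat \<Rightarrow> real) measure) T D.
        G_system G M T \<longrightarrow> D \<in> sets M \<longrightarrow> measure M D > 0
          \<longrightarrow> (\<exists>g \<in> S. measure M (D \<inter> T g ` D) > 0))"

text \<open>
  Over probability spaces with arbitrary sigma-algebras, the existence of a free weak mixing system
  with a given rigidity sequence would be vacuous: translations of \<open>G\<close> on itself, with the
  sigma-algebra consisting of \<open>{}\<close> and the whole space, are free, weak mixing, and rigid along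
  every sequence. The system is therefore required to live on a standard Borel space. Taking
  \<open>\<real>\<^sup>\<nat>\<close> with its Borel sets loses nothing: every standard Borel space is isomorphic to
  a Borel subset of \<open>\<real>\<^sup>\<nat>\<close>, and an action on this subset extends by the identity, all added
  points having measure zero.
\<close>

definition rigid_for_free_weak_mixing :: "('g, 'm) monoid_scheme \<Rightarrow> (nat \<Rightarrow> 'g) \<Rightarrow> bool" where
  "rigid_for_free_weak_mixing G s \<longleftrightarrow>
     (\<exists>(M :: (nat \<Rightarrow> real) measure) T.
        sets M = sets borel \<and> G_system G M T \<and> free_action G M T \<and> weak_mixing_action G M T
          \<and> rigidity_sequence M T s)"


section \<open>The groups\<close>

definition Sigma_group :: "nat \<Rightarrow> (nat \<Rightarrow> int) monoid" where
  "Sigma_group q = sum_group UNIV (\<lambda>_. integer_mod_group q)"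

definition Sigma_sum :: "nat \<Rightarrow> (nat \<Rightarrow> nat) \<Rightarrow> (nat \<Rightarrow> nat \<Rightarrow> int) monoid" where
  "Sigma_sum r q = sum_group {1..r} (\<lambda>i. Sigma_group (q i))"

definition ambient_group ::
    "('f, 'm) monoid_scheme \<Rightarrow> nat \<Rightarrow> (nat \<Rightarrow> nat) \<Rightarrow> ('f \<times> (nat \<Rightarrow> nat \<Rightarrow> int)) monoid" where
  "ambient_group F r q = F \<times>\<times> Sigma_sum r q"

definition Sigma_part ::
    "('f, 'm) monoid_scheme \<Rightarrow> nat \<Rightarrow> (nat \<Rightarrow> nat) \<Rightarrow> ('f \<times> (nat \<Rightarrow> nat \<Rightarrow> int)) set" where
  "Sigma_part F r q = {\<one>\<^bsub>F\<^esub>} \<times> carrier (Sigma_sum r q)"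

lemma countable_carrier_sum_group:
  assumes gr: "\<And>i. i \<in> I \<Longrightarrow> group (G i)"
    and I: "countable I" and C: "\<And>i. i \<in> I \<Longrightarrow> countable (carrier (G i))"
  shows "countable (carrier (sum_group I G))"
proof -
  let ?ext = "\<lambda>A x. \<lambda>i\<in>I. if i \<in> A then x i else \<one>\<^bsub>G i\<^esub>"
  let ?U = "\<Union>A \<in> {A. finite A \<and> A \<subseteq> I}. ?ext A ` (\<Pi>\<^sub>E i\<in>A. carrier (G i))"
  have "carrier (sum_group I G) \<subseteq> ?U"
  proof
    fix x assume "x \<in> carrier (sum_group I G)"
    then have x: "x \<in> (\<Pi>\<^sub>E i\<in>I. carrier (G i))" and fin: "finite {i \<in> I. x i \<noteq> \<one>\<^bsub>G i\<^esub>}"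
      using gr by (auto simp: carrier_sum_group)
    let ?A = "{i \<in> I. x i \<noteq> \<one>\<^bsub>G i\<^esub>}"
    have "x = ?ext ?A (restrict x ?A)"
      using x by (auto simp: fun_eq_iff PiE_iff extensional_def)
    moreover have "restrict x ?A \<in> (\<Pi>\<^sub>E i\<in>?A. carrier (G i))"
      using x by (auto simp: PiE_iff)
    ultimately have "x \<in> ?ext ?A ` (\<Pi>\<^sub>E i\<in>?A. carrier (G i))" by blast
    with fin show "x \<in> ?U" by blast
  qed
  moreover have "countable ?U"
  proof (intro countable_UN countable_image countable_PiE)
    show "countable {A. finite A \<and> A \<subseteq> I}"
      using countable_Collect_finite_subset[OF I] .
  qed (use C in auto)
  ultimately show ?thesis by (rule countable_subset)
qed

lemma comm_group_sum_group:
  assumes "\<And>i. i \<in> I \<Longrightarrow> comm_group (G i)"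
  shows "comm_group (sum_group I G)"
proof -
  have gr: "\<And>i. i \<in> I \<Longrightarrow> group (G i)" using assms by (simp add: comm_group.axioms)
  then interpret group "sum_group I G" by simp
  show ?thesis
  proof (rule group_comm_groupI)
    fix x y assume "x \<in> carrier (sum_group I G)" "y \<in> carrier (sum_group I G)"
    then show "x \<otimes>\<^bsub>sum_group I G\<^esub> y = y \<otimes>\<^bsub>sum_group I G\<^esub> x"
      using assms gr
      by (auto simp: carrier_sum_group PiE_iff fun_eq_iff comm_group_def comm_monoid.m_comm)
  qed
qed

lemma Sigma_group_props: "comm_group (Sigma_group q)" "countable (carrier (Sigma_group q))"
  unfolding Sigma_group_def
  by (auto intro!: comm_group_sum_group countable_carrier_sum_group)

lemma ambient_group_props:
  assumes "comm_group F" "finite (carrier F)"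
  shows "comm_group (ambient_group F r q)" "countable (carrier (ambient_group F r q))"
proof -
  have 1: "comm_group (Sigma_sum r q)" unfolding Sigma_sum_def
    by (intro comm_group_sum_group Sigma_group_props)
  have 2: "countable (carrier (Sigma_sum r q))" unfolding Sigma_sum_def
    by (intro countable_carrier_sum_group Sigma_group_props comm_group.axioms(2)) auto
  interpret F: comm_group F by fact
  interpret S: comm_group "Sigma_sum r q" by fact
  interpret P: group "F \<times>\<times> Sigma_sum r q"
    by (rule DirProd_group) unfold_locales
  show "comm_group (ambient_group F r q)" unfolding ambient_group_def
    by (rule P.group_comm_groupI) (auto simp: F.m_comm S.m_comm)
  show "countable (carrier (ambient_group F r q))" unfolding ambient_group_def
    using 2 assms(2) by (simp add: countable_finite)
qed


section \<open>Independence of the type of the probability spaces\<close>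

lemma set_of_recurrence_any_type:
  fixes G :: "('g, 'm) monoid_scheme" and M :: "'x measure"
  assumes cnt: "countable (carrier G)" and SG: "S \<subseteq> carrier G"
    and S: "set_of_recurrence G S" and sys: "G_system G M T"
    and D: "D \<in> sets M" "measure M D > 0"
  shows "\<exists>g \<in> S. measure M (D \<inter> T g ` D) > 0"
proof -
  interpret G_system G M T by fact
  interpret G: group G using group_hom by (rule group_hom.axioms)
  have bij: "bij_betw (T g) (space M) (space M)" if "g \<in> carrier G" for g
    using bij_prop0[OF that] by (simp add: Bij_def)
  have Tin: "T g x \<in> space M" if "g \<in> carrier G" "x \<in> space M" for g x
    using bij[OF that(1)] that(2) by (auto simp: bij_betw_def)
  have Tmult: "T (g \<otimes>\<^bsub>G\<^esub> h) x = T g (T h x)"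
    if "g \<in> carrier G" "h \<in> carrier G" "x \<in> space M" for g h x
    using composition_rule[OF that(3,1,2)] by simp
  have Tone: "T \<one>\<^bsub>G\<^esub> x = x" if "x \<in> space M" for x
    using that id_eq_one by (metis restrict_apply')
  have Tinv: "T (inv\<^bsub>G\<^esub> g) (T g x) = x" "T g (T (inv\<^bsub>G\<^esub> g) x) = x"
    if "g \<in> carrier G" "x \<in> space M" for g x
    using that Tmult[of "inv\<^bsub>G\<^esub> g" g x] Tmult[of g "inv\<^bsub>G\<^esub> g" x] Tone by auto
  have Dsp: "D \<subseteq> space M" using D(1) sets.sets_into_space by blast
  have Dimg: "T g ` D = {x \<in> space M. T (inv\<^bsub>G\<^esub> g) x \<in> D}" if "g \<in> carrier G" for g
    using Dsp Tinv[OF that] Tin[OF that] by (force simp: image_iff)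

  define \<phi> :: "'x \<Rightarrow> nat \<Rightarrow> real" where
    "\<phi> x = (\<lambda>n. if T (from_nat_into (carrier G) n) x \<in> D then 1 else 0)" for x
  have ne: "carrier G \<noteq> {}" by auto
  have phi_eq: "\<phi> x = \<phi> y \<longleftrightarrow> (\<forall>g \<in> carrier G. T g x \<in> D \<longleftrightarrow> T g y \<in> D)" for x y
  proof
    assume e: "\<phi> x = \<phi> y"
    show "\<forall>g \<in> carrier G. T g x \<in> D \<longleftrightarrow> T g y \<in> D"
    proof
      fix g assume "g \<in> carrier G"
      then obtain n where "g = from_nat_into (carrier G) n"
        using from_nat_into_surj[OF cnt] by metis
      then show "T g x \<in> D \<longleftrightarrow> T g y \<in> D"
        using fun_cong[OF e, of n] by (auto simp: \<phi>_def split: if_splits)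
    qed
  next
    assume "\<forall>g \<in> carrier G. T g x \<in> D \<longleftrightarrow> T g y \<in> D"
    then show "\<phi> x = \<phi> y"
      using from_nat_into[OF ne] by (auto simp: \<phi>_def fun_eq_iff)
  qed
  have phi_T: "\<phi> (T g x) = \<phi> (T g y)"
    if "\<phi> x = \<phi> y" "g \<in> carrier G" "x \<in> space M" "y \<in> space M" for g x y
    unfolding phi_eq
  proof
    fix k assume "k \<in> carrier G"
    then show "T k (T g x) \<in> D \<longleftrightarrow> T k (T g y) \<in> D"
      using that Tmult[of k g] by (metis G.m_closed phi_eq)
  qed
  have phi_D: "x \<in> D \<longleftrightarrow> y \<in> D" if "\<phi> x = \<phi> y" "x \<in> space M" "y \<in> space M" for x y
    using that Tone by (metis phi_eq G.one_closed)

  define Y where "Y = \<phi> ` space M"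
  define \<A> where "\<A> = {A. A \<subseteq> Y \<and> \<phi> -` A \<inter> space M \<in> sets M}"
  interpret A: sigma_algebra Y \<A>
    unfolding sigma_algebra_iff2
  proof (intro conjI ballI allI impI)
    show "\<A> \<subseteq> Pow Y" "{} \<in> \<A>" by (auto simp: \<A>_def)
    fix A assume "A \<in> \<A>"
    moreover have "\<phi> -` (Y - A) \<inter> space M = space M - (\<phi> -` A \<inter> space M)"
      by (auto simp: Y_def)
    ultimately show "Y - A \<in> \<A>" by (auto simp: \<A>_def)
  next
    fix A :: "nat \<Rightarrow> _" assume "range A \<subseteq> \<A>"
    then have A: "A i \<subseteq> Y" "\<phi> -` A i \<inter> space M \<in> sets M" for i by (auto simp: \<A>_def)
    have "\<phi> -` (\<Union>i. A i) \<inter> space M = (\<Union>i. \<phi> -` A i \<inter> space M)" by auto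
    also have "\<dots> \<in> sets M" using A by (intro sets.countable_UN) auto
    finally show "(\<Union>i. A i) \<in> \<A>" using A by (auto simp: \<A>_def)
  qed
  define N where "N = distr M (sigma Y \<A>) \<phi>"
  have spN: "space N = Y" and seN: "sets N = \<A>"
    using A.space_closed by (simp_all add: N_def A.sigma_sets_eq)
  have phi_meas: "\<phi> \<in> M \<rightarrow>\<^sub>M sigma Y \<A>"
    using A.space_closed by (intro measurable_measure_of) (auto simp: Y_def \<A>_def)
  have mN: "measure N A = measure M (\<phi> -` A \<inter> space M)" if "A \<in> \<A>" for A
    unfolding N_def using that A.space_closed
    by (intro measure_distr phi_meas) (simp add: A.sigma_sets_eq)

  define p where "p y = (SOME x. x \<in> space M \<and> \<phi> x = y)" for y
  have p: "p y \<in> space M" "\<phi> (p y) = y" if "y \<in> Y" for y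
    using that someI_ex[of "\<lambda>x. x \<in> space M \<and> \<phi> x = y"] by (auto simp: p_def Y_def)
  define R where "R g = (\<lambda>y\<in>Y. \<phi> (T g (p y)))" for g
  have R_phi: "R g (\<phi> x) = \<phi> (T g x)" if "g \<in> carrier G" "x \<in> space M" for g x
  proof -
    have "\<phi> x \<in> Y" using that by (auto simp: Y_def)
    then show ?thesis using p[of "\<phi> x"] phi_T[of "p (\<phi> x)" x g] that by (simp add: R_def)
  qed
  have Rin: "R g y \<in> Y" if "g \<in> carrier G" "y \<in> Y" for g y
    using that p[of y] Tin by (auto simp: R_def Y_def)
  have Rmult: "R (g \<otimes>\<^bsub>G\<^esub> h) y = R g (R h y)"
    if gh: "g \<in> carrier G" "h \<in> carrier G" and y: "y \<in> Y" for g h y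
  proof -
    obtain x where "x \<in> space M" "y = \<phi> x" using y by (auto simp: Y_def)
    then show ?thesis using gh by (simp add: R_phi Tmult Tin)
  qed
  have Rone: "R \<one>\<^bsub>G\<^esub> y = y" if "y \<in> Y" for y
    using that by (auto simp: Y_def R_phi Tone)
  have Rinv: "R (inv\<^bsub>G\<^esub> g) (R g y) = y" "R g (R (inv\<^bsub>G\<^esub> g) y) = y"
    if "g \<in> carrier G" "y \<in> Y" for g y
    using that Rmult[of "inv\<^bsub>G\<^esub> g" g y] Rmult[of g "inv\<^bsub>G\<^esub> g" y] Rone by auto
  have RBij: "R g \<in> Bij Y" if g: "g \<in> carrier G" for g
  proof -
    have "bij_betw (R g) Y Y"
      by (rule bij_betw_byWitness[where f' = "R (inv\<^bsub>G\<^esub> g)"])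
        (use g Rinv Rin in auto)
    then show ?thesis by (simp add: Bij_def R_def)
  qed
  have act: "group_action G Y R"
    unfolding group_action_def group_hom_def group_hom_axioms_def
  proof (intro conjI)
    show "group G" by (rule G.group_axioms)
    show "group (BijGroup Y)" by (rule group_BijGroup)
    show "R \<in> hom G (BijGroup Y)"
    proof (rule homI)
      fix g h assume gh: "g \<in> carrier G" "h \<in> carrier G"
      have "R (g \<otimes>\<^bsub>G\<^esub> h) y = compose Y (R g) (R h) y" for y
        using Rmult[OF gh, of y] by (cases "y \<in> Y") (auto simp: compose_def R_def)
      then show "R (g \<otimes>\<^bsub>G\<^esub> h) = R g \<otimes>\<^bsub>BijGroup Y\<^esub> R h"
        using RBij gh by (auto simp: BijGroup_def)
    qed (use RBij in \<open>simp add: BijGroup_def\<close>)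
  qed
  have vim: "\<phi> -` (R g -` A \<inter> Y) \<inter> space M = T g -` (\<phi> -` A \<inter> space M) \<inter> space M"
    if g: "g \<in> carrier G" for g A
  proof -
    have "R g (\<phi> x) \<in> A \<and> \<phi> x \<in> Y \<longleftrightarrow> \<phi> (T g x) \<in> A \<and> T g x \<in> space M"
      if "x \<in> space M" for x
      using that g R_phi[of g x] Tin[of g x] by (auto simp: Y_def)
    then show ?thesis by blast
  qed
  have Rvim: "R g -` A \<inter> Y \<in> \<A>" if "g \<in> carrier G" "A \<in> \<A>" for g A
    using that measurable_sets[OF measurable_T[OF that(1)]]
    by (simp add: \<A>_def vim del: vimage_Int)
  have Rimg: "R g ` A = R (inv\<^bsub>G\<^esub> g) -` A \<inter> Y" if "g \<in> carrier G" "A \<subseteq> Y" for g A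
    using that Rinv[OF that(1)] Rin by (force simp: image_iff)
  have Timg: "T g ` B = T (inv\<^bsub>G\<^esub> g) -` B \<inter> space M"
    if "g \<in> carrier G" "B \<subseteq> space M" for g B
    using that Tinv[OF that(1)] Tin by (force simp: image_iff)
  have sysN: "G_system G N R"
  proof (intro G_system.intro G_system_axioms.intro)
    show "prob_space N"
      unfolding N_def by (rule prob_space_distr[OF phi_meas])
    show "group_action G (space N) R" using act spN by simp
    show "R g \<in> N \<rightarrow>\<^sub>M N" if "g \<in> carrier G" for g
      using that Rin Rvim by (auto intro!: measurableI simp: spN seN)
    fix g A assume g: "g \<in> carrier G" and "A \<in> sets N"
    then have A: "A \<in> \<A>" "A \<subseteq> Y" "\<phi> -` A \<inter> space M \<in> sets M"
      by (auto simp: seN \<A>_def)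
    have "measure N (R g ` A) = measure M (\<phi> -` (R g ` A) \<inter> space M)"
      using A g by (intro mN) (simp add: Rimg Rvim)
    also have "\<phi> -` (R g ` A) \<inter> space M = T g ` (\<phi> -` A \<inter> space M)"
      using g A by (simp add: Rimg Timg vim del: vimage_Int)
    also have "measure M \<dots> = measure N A"
      using A g by (simp add: preserves_T mN)
    finally show "measure N (R g ` A) = measure N A" .
  qed
  have pre: "\<phi> -` (\<phi> ` D) \<inter> space M = D"
    using Dsp phi_D by blast
  have DA: "\<phi> ` D \<in> \<A>" using Dsp D(1) by (auto simp: \<A>_def Y_def pre)
  have "measure N (\<phi> ` D) > 0" using D(2) by (simp add: mN DA pre)
  then obtain g where g: "g \<in> S" "measure N (\<phi> ` D \<inter> R g ` (\<phi> ` D)) > 0"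
    using S sysN DA unfolding set_of_recurrence_def seN[symmetric] by blast
  have gG: "g \<in> carrier G" using g SG by blast
  have RA: "R g ` (\<phi> ` D) \<in> \<A>"
    using gG DA A.space_closed by (subst Rimg) (auto intro!: Rvim)
  have "\<phi> -` (\<phi> ` D \<inter> R g ` (\<phi> ` D)) \<inter> space M
      = D \<inter> (\<phi> -` (R g ` (\<phi> ` D)) \<inter> space M)"
    using pre by blast
  also have "\<phi> -` (R g ` (\<phi> ` D)) \<inter> space M = T g ` D"
  proof -
    have "\<phi> ` D \<subseteq> Y" using Dsp by (auto simp: Y_def)
    then show ?thesis using gG Dsp by (simp add: Rimg Timg vim pre del: vimage_Int)
  qed
  finally have "measure N (\<phi> ` D \<inter> R g ` (\<phi> ` D)) = measure M (D \<inter> T g ` D)"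
    using DA RA by (simp add: mN A.Int)
  then show ?thesis using g by auto
qed

end

theory Submission
  imports Defs "HOL-Probability.Probability"
begin

text \<open>
  Write \<open>G\<close> additively, as the union of the finite subgroups \<open>L m\<close> of elements whose coordinates
  from \<open>m\<close> on vanish, and let \<open>e k\<close> be the element of \<open>H\<close> that has the entry \<open>1\<close> at coordinate \<open>k\<close>
  in each of the \<open>r\<close> summands (\<open>basis k\<close> below). The two demands on the sequence pull in opposite
  directions: rigidity wants \<open>s n + t\<close> to act almost trivially, while recurrence of every translate by
  \<open>H\<close> prevents the elements \<open>s n + t\<close> from lying in a proper subgroup of \<open>H\<close> from some point on. They are
  reconciled by letting the elements act trivially with high probability only.

  From random homomorphisms to systems. For a random homomorphism \<open>\<phi>\<close> on \<open>G\<close> let \<open>m(A)\<close> be the mean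
  number of elements of \<open>\<phi> ` A\<close>. Scatter Poisson many independent copies of \<open>\<phi>\<close> over each value
  \<open>w\<close>, and let \<open>B\<close> be the random set of those \<open>u\<close> such that no copy over any \<open>w\<close> sends \<open>u\<close> to \<open>w\<close>.
  Then \<open>A \<subseteq> B\<close> has probability \<open>exp (- m(A))\<close> (\<open>realizable_exp_image_card\<close>), a quantity
  invariant under translation of \<open>A\<close>, so translation of \<open>B\<close> is a \<open>G\<close>-system. Its
  properties can be read off from \<open>m\<close> (\<open>rigid_for_free_weak_mixingI\<close>): it is rigid along \<open>g n\<close> if
  \<open>\<phi> (g n) = 0\<close> with probability tending to \<open>1\<close>, it is weak mixing if there is a sequence
  \<open>z\<close> such that for each \<open>u\<close> surely \<open>\<phi> (z n) \<noteq> \<phi> u\<close> for all large \<open>n\<close>, and it is then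
  free if \<open>\<phi> g \<noteq> 0\<close> has positive probability for each \<open>g \<noteq> 0\<close>.

  Choosing the elements. Enumerate \<open>H\<close> as \<open>h n\<close>, each element infinitely often. Stage \<open>n\<close> selects a
  finite part \<open>S n\<close> of \<open>S\<close> such that \<open>S n + h n\<close> is a set of recurrence for all sets of measure at
  least \<open>1 / (n + 1)\<close>, and each \<open>s + h n\<close> vanishes up to coordinate \<open>N n\<close> and has entries \<open>1\<close> at all
  but few of the \<open>d n\<close> coordinates that follow (\<open>exists_stage\<close>). By compactness (\<open>eventually_recurrent_in\<close>)
  and its converse (\<open>recurrent_in_imp_recurrence\<close>) recurrence for sets of measure at least \<open>\<epsilon>\<close> is a
  statement about subsets of density \<open>\<epsilon>\<close> in the finite groups \<open>L m\<close>. In such a subset, concentration of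
  measure for the Hamming distance (\<open>dense_sets_hamming_close\<close>) yields pairs whose difference on the
  block of \<open>d n\<close> coordinates is nearly all ones; by pigeonhole a dense set of such pairs has the same
  block entries and the same early coordinates, and the recurrence of one further translate of
  \<open>S\<close> then produces an element with the required shape.

  The random homomorphism for the translate by \<open>t\<close>. At stage \<open>n\<close> pick a random coordinate \<open>i\<close> of the
  block, let \<open>\<phi>\<close> send \<open>e i\<close> to \<open>\<phi> (h n - t)\<close> (and likewise in each summand), and let it kill
  every other coordinate after \<open>N n\<close> that belongs to the stage. For \<open>s\<close> in \<open>S n\<close> the entry of \<open>s + h n\<close>
  at \<open>i\<close> is probably \<open>1\<close>, so that \<open>\<phi> (s + h n) = \<phi> (h n - t)\<close>, that is \<open>\<phi> (s + t) = 0\<close>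
  (\<open>mean_card_rigid\<close>). The coordinate \<open>N n\<close> is never changed and supplies the elements \<open>z n\<close>
  (\<open>mean_card_disjoint\<close>), and with a small probability a stage changes nothing, which makes \<open>\<phi>\<close>
  injective on each \<open>L m\<close> with positive probability (\<open>mean_card_moved\<close>).
\<close>

section \<open>Joint laws of binary processes\<close>

abbreviation all_ones :: "nat set \<Rightarrow> (nat \<Rightarrow> real) set" where
  "all_ones U \<equiv> {x. \<forall>n\<in>U. x n = 1}"

text \<open>
A law on sequences of zeros and ones, recorded by the probabilities that all entries indexed by a
finite set are \<open>1\<close>; these determine it. Real entries make the space the one on which
systems are required to live.
\<close>

definition binary_law :: "(nat \<Rightarrow> real) measure \<Rightarrow> (nat set \<Rightarrow> real) \<Rightarrow> bool" where
  "binary_law M p \<longleftrightarrow> prob_space M \<and> sets M = sets borel \<and>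
     (AE x in M. \<forall>n. x n \<in> {0, 1}) \<and> (\<forall>U. finite U \<longrightarrow> measure M (all_ones U) = p U)"

definition realizable :: "(nat set \<Rightarrow> real) \<Rightarrow> bool" where
  "realizable p \<longleftrightarrow> (\<exists>M. binary_law M p)"

lemma binary_lawD:
  assumes "binary_law M p"
  shows "prob_space M" "sets M = sets borel" "AE x in M. \<forall>n. x n \<in> {0, 1}"
    "finite U \<Longrightarrow> measure M (all_ones U) = p U" "space M = UNIV"
  using assms sets_eq_imp_space_eq[of M borel] by (auto simp: binary_law_def)

lemma all_ones_borel [measurable]: "all_ones U \<in> sets borel"
  by measurable

text \<open>
The indicator process of the events has the wanted law, whatever space the events live on.
\<close>

lemma realizableI:
  fixes N :: "'y measure" and E :: "nat \<Rightarrow> 'y set"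
  assumes N: "prob_space N" and E: "\<And>n. E n \<in> sets N"
    and p: "\<And>U. finite U \<Longrightarrow> measure N {y \<in> space N. \<forall>n\<in>U. y \<in> E n} = p U"
  shows "realizable p"
proof -
  interpret N: prob_space N by fact
  note E[measurable]
  define Z where "Z y = (\<lambda>n. indicat_real (E n) y)" for y
  have Z[measurable]: "Z \<in> N \<rightarrow>\<^sub>M borel"
    by (intro measurable_coordinatewise_then_product) (simp add: Z_def)
  define M where "M = distr N borel Z"
  have "measure M (all_ones U) = p U" if "finite U" for U
  proof -
    have "measure M (all_ones U) = measure N (Z -` all_ones U \<inter> space N)"
      unfolding M_def by (intro measure_distr) auto
    also have "Z -` all_ones U \<inter> space N = {y \<in> space N. \<forall>n\<in>U. y \<in> E n}"
      by (auto simp: Z_def indicator_def)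
    finally show ?thesis using p that by simp
  qed
  moreover have 2: "AE x in M. \<forall>n. x n \<in> {0, 1}"
    unfolding M_def by (subst AE_distr_iff) (auto simp: Z_def indicator_def intro!: AE_I2)
  moreover have "prob_space M" "sets M = sets borel"
    by (simp_all add: M_def N.prob_space_distr)
  ultimately have "binary_law M p"
    unfolding binary_law_def by blast
  then show ?thesis by (auto simp: realizable_def)
qed

lemma (in sigma_finite_measure) measure_pair_measure_Times:
  assumes "A \<in> sets N" "B \<in> sets M"
  shows "measure (N \<Otimes>\<^sub>M M) (A \<times> B) = measure N A * measure M B"
  using assms by (simp add: measure_def emeasure_pair_measure_Times enn2real_mult)

text \<open>
Intersect corresponding events of two independent processes.
\<close>

lemma realizable_mult:
  assumes "realizable p" "realizable q"
  shows "realizable (\<lambda>U. p U * q U)"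
proof -
  obtain M N where M: "binary_law M p" and N: "binary_law N q"
    using assms by (auto simp: realizable_def)
  note * = binary_lawD[OF M] binary_lawD[OF N]
  interpret M: prob_space M by (rule *)
  interpret N: prob_space N by (rule *)
  interpret P: pair_prob_space M N ..
  have ms[measurable_cong]: "sets M = sets borel" "sets N = sets borel" by (rule *)+
  show ?thesis
  proof (rule realizableI[where E = "\<lambda>n. {x. x n = 1} \<times> {x. x n = 1}"])
    show "prob_space (M \<Otimes>\<^sub>M N)" by (rule P.prob_space_axioms)
    show "{x. x n = 1} \<times> {x. x n = 1} \<in> sets (M \<Otimes>\<^sub>M N)" for n :: nat
      using all_ones_borel[of "{n}"] by (intro pair_measureI) (auto simp: ms)
    fix U :: "nat set" assume U: "finite U"
    have "{y \<in> space (M \<Otimes>\<^sub>M N). \<forall>n\<in>U. y \<in> {x. x n = 1} \<times> {x. x n = 1}} = all_ones U \<times> all_ones U"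
      using * by (auto simp: space_pair_measure)
    then show "measure (M \<Otimes>\<^sub>M N) {y \<in> space (M \<Otimes>\<^sub>M N). \<forall>n\<in>U. y \<in> {x. x n = 1} \<times> {x. x n = 1}} = p U * q U"
      using U * by (simp add: N.measure_pair_measure_Times)
  qed
qed

lemma realizable_const_one: "realizable (\<lambda>U. 1)"
proof (rule realizableI[where E = "\<lambda>_. UNIV"])
  show "prob_space (return_pmf ())" by (rule prob_space_measure_pmf)
qed (auto simp: measure_pmf.prob_space[simplified])

lemma realizable_prod:
  assumes "\<And>i. i \<in> A \<Longrightarrow> realizable (p i)"
  shows "realizable (\<lambda>U. \<Prod>i\<in>A. p i U)"
  using assms
proof (induction A rule: infinite_finite_induct)
  case (insert i A)
  then show ?case by (simp add: realizable_mult)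
qed (simp_all add: realizable_const_one)

lemma realizable_power: "realizable p \<Longrightarrow> realizable (\<lambda>U. p U ^ n)"
  using realizable_prod[of "{..<n}" "\<lambda>_. p"] by simp

text \<open>
With probability \<open>1 - c\<close> every event is replaced by the sure one.
\<close>

lemma realizable_mix_one:
  assumes "realizable p" "0 \<le> c" "c \<le> 1"
  shows "realizable (\<lambda>U. (1 - c) + c * p U)"
proof -
  obtain M where M: "binary_law M p"
    using assms by (auto simp: realizable_def)
  note * = binary_lawD[OF M]
  let ?B = "bernoulli_pmf c"
  interpret M: prob_space M by (rule *)
  interpret P: pair_prob_space M "measure_pmf ?B" ..
  have ms[measurable_cong]: "sets M = sets borel" by (rule *)
  let ?E = "\<lambda>U. (UNIV \<times> {False}) \<union> (all_ones U \<times> {True})"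
  have m: "UNIV \<times> {False} \<in> sets (M \<Otimes>\<^sub>M ?B)" "all_ones U \<times> {True} \<in> sets (M \<Otimes>\<^sub>M ?B)" for U
    by (intro pair_measureI; simp add: ms)+
  show ?thesis
  proof (rule realizableI[where E = "\<lambda>n. ?E {n}"])
    show "prob_space (M \<Otimes>\<^sub>M ?B)" by (rule P.prob_space_axioms)
    show "?E {n} \<in> sets (M \<Otimes>\<^sub>M ?B)" for n using m by blast
    fix U :: "nat set" assume U: "finite U"
    have "{y \<in> space (M \<Otimes>\<^sub>M ?B). \<forall>n\<in>U. y \<in> ?E {n}} = ?E U"
      using * by (auto simp: space_pair_measure)
    moreover have "measure (M \<Otimes>\<^sub>M ?B) (?E U) = measure (M \<Otimes>\<^sub>M ?B) (UNIV \<times> {False}) + measure (M \<Otimes>\<^sub>M ?B) (all_ones U \<times> {True})"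
      by (rule P.finite_measure_Union[OF m]) auto
    moreover have "measure (M \<Otimes>\<^sub>M ?B) (UNIV \<times> {False}) = 1 - c"
      using assms * M.prob_space by (subst measure_pmf.measure_pair_measure_Times) (auto simp: measure_pmf_single)
    moreover have "measure (M \<Otimes>\<^sub>M ?B) (all_ones U \<times> {True}) = c * p U"
      using U assms * by (subst measure_pmf.measure_pair_measure_Times) (auto simp: measure_pmf_single)
    ultimately show "measure (M \<Otimes>\<^sub>M ?B) {y \<in> space (M \<Otimes>\<^sub>M ?B). \<forall>n\<in>U. y \<in> ?E {n}} = (1 - c) + c * p U"
      by presburger
  qed
qed

section \<open>Limits of binary laws\<close>

text \<open>
A consistent assignment of weights to finite binary words cuts the unit interval into nested cells of
those lengths, so that the digits of the cell containing a uniformly distributed point have the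
prescribed law. Words are stored with the latest digit first.
\<close>

context
  fixes r :: "bool list \<Rightarrow> real"
  assumes nonneg: "r bs \<ge> 0" and r_Nil: "r [] = 1"
    and split: "r bs = r (True # bs) + r (False # bs)"
begin

primrec left_end :: "bool list \<Rightarrow> real" where
  "left_end [] = 0"
| "left_end (b # bs) = left_end bs + (if b then r (False # bs) else 0)"

definition cell :: "bool list \<Rightarrow> real set" where
  "cell bs = {left_end bs ..< left_end bs + r bs}"

primrec address :: "real \<Rightarrow> nat \<Rightarrow> bool list" where
  "address w 0 = []"
| "address w (Suc n) = (left_end (address w n) + r (False # address w n) \<le> w) # address w n"

lemma length_address [simp]: "length (address w n) = n"
  by (induction n) auto

lemma address_eq_iff:
  assumes "w \<in> {0..<1}"
  shows "address w (length bs) = bs \<longleftrightarrow> w \<in> cell bs"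
proof (induction bs)
  case Nil
  then show ?case using assms by (simp add: cell_def r_Nil)
next
  case (Cons b bs)
  have "w \<in> cell (b # bs) \<longleftrightarrow> w \<in> cell bs \<and> (left_end bs + r (False # bs) \<le> w \<longleftrightarrow> b)"
    using split[of bs] nonneg[of "True # bs"] nonneg[of "False # bs"] by (cases b) (auto simp: cell_def)
  with Cons show ?case by auto
qed

lemma cell_subset: "cell bs \<subseteq> {0..<1}"
proof (induction bs)
  case Nil
  then show ?case by (simp add: cell_def r_Nil)
next
  case (Cons b bs)
  have "cell (b # bs) \<subseteq> cell bs"
    using split[of bs] nonneg[of "True # bs"] nonneg[of "False # bs"] by (cases b) (auto simp: cell_def)
  with Cons show ?case by auto
qed

lemma realizable_of_prefixes:
  assumes p: "\<And>U n. U \<subseteq> {..<n} \<Longrightarrow>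
    p U = (\<Sum>bs | length bs = n \<and> (\<forall>j\<in>U. rev bs ! j). r bs)"
  shows "realizable p"
proof -
  define N where "N = restrict_space lborel {0..<1::real}"
  have spN: "space N = {0..<1}" and seN: "A \<in> sets N \<longleftrightarrow> A \<in> sets borel \<and> A \<subseteq> {0..<1}" for A
    by (auto simp: N_def space_restrict_space sets_restrict_space_iff)
  have cellN: "cell bs \<in> sets N" for bs
    using cell_subset by (simp add: seN) (simp add: cell_def)
  have mcell: "measure N (cell bs) = r bs" for bs
    using cell_subset nonneg unfolding N_def
    by (subst measure_restrict_space) (auto simp: cell_def)
  have "prob_space N"
    by (rule prob_spaceI) (simp add: spN, simp add: N_def emeasure_restrict_space)
  then interpret N: prob_space N .
  define E where "E n = {w \<in> {0..<1}. hd (address w (Suc n))}" for n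
  have rev_nth: "rev (address w n) ! j = hd (address w (Suc j))" if "j < n" for j n w
    using that by (induction n) (auto simp: nth_append less_Suc_eq)
  have cyl: "{w \<in> space N. \<forall>j\<in>U. w \<in> E j}
      = (\<Union>bs\<in>{bs. length bs = n \<and> (\<forall>j\<in>U. rev bs ! j)}. cell bs)" if U: "U \<subseteq> {..<n}" for U n
  proof (intro equalityI subsetI)
    fix w assume w: "w \<in> {w \<in> space N. \<forall>j\<in>U. w \<in> E j}"
    then have "w \<in> cell (address w n)"
      using address_eq_iff[of w "address w n"] by (simp add: spN)
    moreover have "rev (address w n) ! j" if "j \<in> U" for j
      using that w U by (subst rev_nth) (auto simp: E_def)
    ultimately show "w \<in> (\<Union>bs\<in>{bs. length bs = n \<and> (\<forall>j\<in>U. rev bs ! j)}. cell bs)" by force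
  next
    fix w assume "w \<in> (\<Union>bs\<in>{bs. length bs = n \<and> (\<forall>j\<in>U. rev bs ! j)}. cell bs)"
    then obtain bs where bs: "w \<in> cell bs" "length bs = n" "\<forall>j\<in>U. rev bs ! j" by blast
    have w: "w \<in> {0..<1}" using bs(1) cell_subset by blast
    have "address w n = bs" using address_eq_iff[OF w, of bs] bs by simp
    then show "w \<in> {w \<in> space N. \<forall>j\<in>U. w \<in> E j}"
      using bs w U rev_nth[of _ n w] by (auto simp: spN E_def simp del: address.simps)
  qed
  have fin: "finite {bs :: bool list. length bs = n \<and> Q bs}" for n Q
    by (rule finite_subset[OF _ finite_lists_length_eq[of UNIV n]]) auto
  show ?thesis
  proof (rule realizableI[where N = N and E = E])
    fix n
    have "E n = {w \<in> space N. \<forall>j\<in>{n}. w \<in> E j}" by (auto simp: E_def spN)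
    also have "\<dots> = (\<Union>bs\<in>{bs. length bs = Suc n \<and> (\<forall>j\<in>{n}. rev bs ! j)}. cell bs)"
      by (rule cyl) auto
    also have "\<dots> \<in> sets N" using fin cellN by (intro sets.finite_UN) auto
    finally show "E n \<in> sets N" .
  next
    fix U :: "nat set" assume "finite U"
    then obtain n where U: "U \<subseteq> {..<n}" by (meson finite_nat_bounded)
    have disj: "disjoint_family_on cell {bs. length bs = n \<and> (\<forall>j\<in>U. rev bs ! j)}"
    unfolding disjoint_family_on_def
  proof (intro ballI impI)
      fix bs cs assume *: "bs \<in> {bs. length bs = n \<and> (\<forall>j\<in>U. rev bs ! j)}"
        "cs \<in> {bs. length bs = n \<and> (\<forall>j\<in>U. rev bs ! j)}" "bs \<noteq> cs"
      have False if "w \<in> cell bs" "w \<in> cell cs" for w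
      proof -
        have "w \<in> {0..<1}" using that cell_subset by blast
        then show False using that * address_eq_iff[of w bs] address_eq_iff[of w cs] by auto
      qed
      then show "cell bs \<inter> cell cs = {}" by blast
    qed
    have "measure N {w \<in> space N. \<forall>j\<in>U. w \<in> E j}
        = (\<Sum>bs | length bs = n \<and> (\<forall>j\<in>U. rev bs ! j). measure N (cell bs))"
      unfolding cyl[OF U] using fin cellN disj by (intro N.finite_measure_finite_Union) auto
    then show "measure N {w \<in> space N. \<forall>j\<in>U. w \<in> E j} = p U"
      by (simp add: p[OF U] mcell)
  qed fact
qed

end

definition prefix_event :: "bool list \<Rightarrow> (nat \<Rightarrow> real) set" where
  "prefix_event bs = {x. \<forall>j<length bs. rev bs ! j \<longleftrightarrow> x j = 1}"

lemma prefix_event_Nil [simp]: "prefix_event [] = UNIV"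
  by (simp add: prefix_event_def)

lemma prefix_event_Cons:
  "prefix_event (b # bs) = prefix_event bs \<inter> {x. b \<longleftrightarrow> x (length bs) = 1}"
  by (auto simp: prefix_event_def nth_append less_Suc_eq)

lemma prefix_event_borel [measurable]: "prefix_event bs \<in> sets borel"
  unfolding prefix_event_def by measurable

lemma binary_law_prefixes:
  assumes "binary_law M p" and U: "U \<subseteq> {..<n}"
  shows "p U = (\<Sum>bs | length bs = n \<and> (\<forall>j\<in>U. rev bs ! j). measure M (prefix_event bs))"
proof -
  note * = binary_lawD[OF assms(1)]
  interpret M: prob_space M by (rule *)
  let ?L = "{bs :: bool list. length bs = n \<and> (\<forall>j\<in>U. rev bs ! j)}"
  have fin: "finite ?L"
    by (rule finite_subset[OF _ finite_lists_length_eq[of UNIV n]]) auto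
  have "all_ones U = (\<Union>bs\<in>?L. prefix_event bs)"
  proof (intro equalityI subsetI)
    fix x :: "nat \<Rightarrow> real" assume x: "x \<in> all_ones U"
    let ?bs = "rev (map (\<lambda>j. x j = 1) [0..<n])"
    have "x \<in> prefix_event ?bs" by (simp add: prefix_event_def)
    moreover have "?bs \<in> ?L" using x U by auto
    ultimately show "x \<in> (\<Union>bs\<in>?L. prefix_event bs)" by blast
  qed (use U in \<open>auto simp: prefix_event_def\<close>)
  moreover have "disjoint_family_on prefix_event ?L"
  unfolding disjoint_family_on_def
  proof (intro ballI impI)
    fix bs cs assume "bs \<in> ?L" "cs \<in> ?L" "bs \<noteq> cs"
    then have "length bs = n" "length cs = n" "rev bs \<noteq> rev cs" by auto
    then obtain j where j: "j < n" "rev bs ! j \<noteq> rev cs ! j"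
      using list_eq_iff_nth_eq[of "rev bs" "rev cs"] by auto
    have "False" if "x \<in> prefix_event bs" "x \<in> prefix_event cs" for x
    proof -
      have "rev bs ! j \<longleftrightarrow> x j = 1" "rev cs ! j \<longleftrightarrow> x j = 1"
        using that j(1) \<open>length bs = n\<close> \<open>length cs = n\<close> by (simp_all add: prefix_event_def)
      with j(2) show False by simp
    qed
    then show "prefix_event bs \<inter> prefix_event cs = {}" by blast
  qed
  ultimately have "measure M (all_ones U) = (\<Sum>bs\<in>?L. measure M (prefix_event bs))"
    using fin by (simp add: M.finite_measure_finite_Union image_subset_iff *)
  then show ?thesis using *(4)[of U] finite_subset[OF U] by simp
qed

text \<open>
Besides the probabilities of \<open>all_ones\<close> the probabilities of all binary words converge, because a digit
\<open>0\<close> is the complement of a digit \<open>1\<close>; the limits are consistent weights on words.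
\<close>

lemma realizable_limit:
  assumes p: "\<And>k. realizable (p k)"
    and lim: "\<And>U. finite U \<Longrightarrow> (\<lambda>k. p k U) \<longlonglongrightarrow> q U"
  shows "realizable q"
proof -
  obtain M where M: "\<And>k. binary_law (M k) (p k)" using p unfolding realizable_def by metis
  note * = binary_lawD[OF M]
  have prob: "prob_space (M k)" for k by (rule *)
  have fm: "finite_measure (M k)" for k using prob[of k] by (simp add: prob_space_def)
  have mb[simp]: "A \<in> sets borel \<Longrightarrow> A \<in> sets (M k)" for A k by (simp add: *)
  define r where "r k bs = measure (M k) (prefix_event bs)" for k bs
  have conv: "convergent (\<lambda>k. measure (M k) (prefix_event bs \<inter> all_ones U))" if "finite U" for bs U
    using that
  proof (induction bs arbitrary: U)
    case Nil
    then show ?case using * lim[of U] by (auto simp: convergent_def)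
  next
    case (Cons b bs)
    have 1: "prefix_event (True # bs) \<inter> all_ones U = prefix_event bs \<inter> all_ones (insert (length bs) U)" for U
      by (auto simp: prefix_event_Cons)
    show ?case
    proof (cases b)
      case True
      then have b: "b = True" by simp
      show ?thesis unfolding b 1 by (rule Cons.IH) (use Cons.prems in simp)
    next
      case False
      have "prefix_event (False # bs) \<inter> all_ones U
          = (prefix_event bs \<inter> all_ones U) - (prefix_event bs \<inter> all_ones (insert (length bs) U))"
        by (auto simp: prefix_event_Cons)
      then have "measure (M k) (prefix_event (False # bs) \<inter> all_ones U)
          = measure (M k) (prefix_event bs \<inter> all_ones U)
            - measure (M k) (prefix_event bs \<inter> all_ones (insert (length bs) U))" for k
        by (simp only:, intro finite_measure.finite_measure_Diff fm) auto
      moreover have "finite (insert (length bs) U)" using Cons.prems by simp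
      moreover have "b = False" using False by simp
      ultimately show ?thesis
        using convergent_diff[OF Cons.IH[of U] Cons.IH[of "insert (length bs) U"]] Cons.prems
        by (simp only:)
    qed
  qed
  have "convergent (\<lambda>k. r k bs)" for bs
    using conv[of "{}" bs] by (simp add: r_def)
  then obtain R where R: "\<And>bs. (\<lambda>k. r k bs) \<longlonglongrightarrow> R bs"
    unfolding convergent_def by metis
  have rsplit: "r k bs = r k (True # bs) + r k (False # bs)" for k bs
  proof -
    have "prefix_event (True # bs) \<inter> prefix_event (False # bs) = {}"
      "prefix_event (True # bs) \<union> prefix_event (False # bs) = prefix_event bs"
      by (auto simp: prefix_event_Cons)
    then show ?thesis unfolding r_def
      using finite_measure.finite_measure_Union[OF fm mb mb, of "prefix_event (True # bs)" "prefix_event (False # bs)" k]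
      by simp
  qed
  have "(\<lambda>k. r k bs) \<longlonglongrightarrow> R (True # bs) + R (False # bs)" for bs
    unfolding rsplit[of _ bs] by (intro tendsto_add R)
  then have Rsplit: "R bs = R (True # bs) + R (False # bs)" for bs
    using R[of bs] LIMSEQ_unique by blast
  have R0: "R bs \<ge> 0" for bs
    using R[of bs] by (rule LIMSEQ_le_const) (auto simp: r_def)
  have "r k [] = 1" for k
    using prob_space.prob_space[OF prob, of k] * by (simp add: r_def)
  then have R1: "R [] = 1" using R[of "[]"] by (simp add: LIMSEQ_const_iff)
  show ?thesis
  proof (rule realizable_of_prefixes[of R, OF R0 R1 Rsplit])
    fix U :: "nat set" and n assume U: "U \<subseteq> {..<n}"
    have "(\<lambda>k. \<Sum>bs | length bs = n \<and> (\<forall>j\<in>U. rev bs ! j). r k bs)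
        \<longlonglongrightarrow> (\<Sum>bs | length bs = n \<and> (\<forall>j\<in>U. rev bs ! j). R bs)"
      by (intro tendsto_sum R)
    moreover have "(\<Sum>bs | length bs = n \<and> (\<forall>j\<in>U. rev bs ! j). r k bs) = p k U" for k
      unfolding r_def using binary_law_prefixes[OF M U] by simp
    ultimately show "q U = (\<Sum>bs | length bs = n \<and> (\<forall>j\<in>U. rev bs ! j). R bs)"
      using LIMSEQ_unique[OF lim[OF finite_subset[OF U]]] by simp
  qed
qed

text \<open>
Finite sets of numbers are coded by numbers, and a countable product of unit intervals is sequentially compact.
\<close>

lemma realizable_subsequence:
  assumes p: "\<And>k. realizable (p k)"
  obtains r q where "strict_mono (r :: nat \<Rightarrow> nat)" "realizable q"
    "\<And>U. finite U \<Longrightarrow> (\<lambda>k. p (r k) U) \<longlonglongrightarrow> q U"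
proof -
  have p01: "p k U \<in> {0..1}" if "finite U" for k U
  proof -
    obtain M where M: "binary_law M (p k)" using p unfolding realizable_def by metis
    note * = binary_lawD[OF M]
    show ?thesis
      using prob_space.prob_le_1[OF *(1), of "all_ones U"] measure_nonneg[of M "all_ones U"]
      by (simp add: *(4)[OF that])
  qed
  define f where "f k = (\<lambda>c. p k (set_decode c))" for k
  have "compact (\<Pi>\<^sub>E c\<in>(UNIV :: nat set). {0..1::real})"
    using compactin_PiE[of "\<lambda>_. euclideanreal" "UNIV :: nat set" "\<lambda>_. {0..1}"]
    by (simp add: euclidean_product_topology)
  then have "seq_compact (\<Pi>\<^sub>E c\<in>(UNIV :: nat set). {0..1::real})"
    by (rule compact_imp_seq_compact)
  moreover have "f k \<in> (\<Pi>\<^sub>E c\<in>UNIV. {0..1})" for k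
    using p01 by (auto simp: f_def)
  ultimately obtain l r where r: "strict_mono (r :: nat \<Rightarrow> nat)" "(f \<circ> r) \<longlonglongrightarrow> l"
    unfolding seq_compact_def by metis
  define q where "q U = l (set_encode U)" for U
  have lim: "(\<lambda>k. p (r k) U) \<longlonglongrightarrow> q U" if "finite U" for U
  proof -
    have "(\<lambda>k. f (r k) (set_encode U)) \<longlonglongrightarrow> l (set_encode U)"
      using continuous_on_tendsto_compose[OF continuous_on_product_coordinates, OF r(2)]
      by (simp add: o_def)
    then show ?thesis using that by (simp add: f_def q_def)
  qed
  show thesis
    by (rule that[OF r(1) realizable_limit[OF p lim] lim])
qed

lemma realizable_subsequence_on:
  fixes I :: "'i set" and p :: "nat \<Rightarrow> 'i set \<Rightarrow> real"
  assumes I: "countable I" "infinite I"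
    and p: "\<And>k. realizable (\<lambda>U. p k (from_nat_into I ` U))"
  obtains r q where "strict_mono (r :: nat \<Rightarrow> nat)" "realizable (\<lambda>U. q (from_nat_into I ` U))"
    "\<And>A. \<lbrakk>finite A; A \<subseteq> I\<rbrakk> \<Longrightarrow> (\<lambda>k. p (r k) A) \<longlonglongrightarrow> q A"
proof -
  obtain r Q where r: "strict_mono (r :: nat \<Rightarrow> nat)" and Q: "realizable Q"
    and lim: "\<And>U. finite U \<Longrightarrow> (\<lambda>k. p (r k) (from_nat_into I ` U)) \<longlonglongrightarrow> Q U"
    by (rule realizable_subsequence[of "\<lambda>k U. p k (from_nat_into I ` U)", OF p]) blast
  define q where "q A = Q (to_nat_on I ` A)" for A
  have "(\<lambda>k. p (r k) A) \<longlonglongrightarrow> q A" if "finite A" "A \<subseteq> I" for A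
  proof -
    have "from_nat_into I ` to_nat_on I ` A = A"
      using that I(1) by (force simp: image_image subset_iff)
    then show ?thesis using lim[of "to_nat_on I ` A"] that by (simp add: q_def)
  qed
  moreover have "q (from_nat_into I ` U) = Q U" for U
    using I by (simp add: q_def image_image)
  ultimately show thesis using r Q that[of r q] by simp
qed

section \<open>Laws given by mean image sizes\<close>

text \<open>
This is a Poisson limit: in each of \<open>k\<close> independent rounds the events of \<open>p\<close> are imposed with
probability \<open>1 / k\<close> only.
\<close>

lemma realizable_exp:
  assumes "realizable p"
  shows "realizable (\<lambda>U. exp (p U - 1))"
proof (rule realizable_limit)
  show "realizable (\<lambda>U. ((1 - 1 / real (Suc k)) + 1 / real (Suc k) * p U) ^ Suc k)" for k
    by (rule realizable_power, rule realizable_mix_one[OF assms]) (auto simp: divide_simps)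
  show "(\<lambda>k. ((1 - 1 / real (Suc k)) + 1 / real (Suc k) * p U) ^ Suc k) \<longlonglongrightarrow> exp (p U - 1)" for U
  proof -
    have eq: "(1 - 1 / real (Suc k)) + 1 / real (Suc k) * p U = 1 + (p U - 1) / real (Suc k)" for k
      by (simp add: diff_divide_distrib)
    show ?thesis
      unfolding eq by (rule LIMSEQ_Suc[OF tendsto_exp_limit_sequentially])
  qed
qed

text \<open>
For a fixed value \<open>w\<close> the events that \<open>\<phi>\<close> does not send \<open>n\<close> to \<open>w\<close> hold for all \<open>n \<in> U\<close>
with probability \<open>1 - h w U\<close>, where \<open>h w U\<close> is the probability that \<open>w \<in> \<phi> ` U\<close>. The Poisson limit
turns this into \<open>exp (- h w U)\<close>, and the product over all values \<open>w\<close> has the exponent \<open>\<Sum>w. h w U\<close>,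
the mean size of the image. The product is a limit of finite ones.
\<close>

theorem realizable_exp_image_card:
  fixes A :: "'a pmf" and \<phi> :: "'a \<Rightarrow> nat \<Rightarrow> 'w"
  assumes A: "finite (set_pmf A)"
  shows "realizable (\<lambda>U. exp (- measure_pmf.expectation A (\<lambda>a. real (card (\<phi> a ` U)))))"
proof -
  define W where "W = (\<Union>a\<in>set_pmf A. range (\<phi> a))"
  have W: "countable W" "W \<noteq> {}"
    using A set_pmf_not_empty[of A] by (auto simp: W_def intro: countable_finite)
  define h where "h w U = measure_pmf.prob A {a. w \<in> \<phi> a ` U}" for w U
  have 1: "realizable (\<lambda>U. exp (- h w U))" for w
  proof -
    have "realizable (\<lambda>U. measure_pmf.prob A {a. \<forall>n\<in>U. w \<noteq> \<phi> a n})"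
      by (rule realizableI[where N = "measure_pmf A" and E = "\<lambda>n. {a. w \<noteq> \<phi> a n}"])
        (simp_all add: measure_pmf.prob_space_axioms)
    then have "realizable (\<lambda>U. exp (measure_pmf.prob A {a. \<forall>n\<in>U. w \<noteq> \<phi> a n} - 1))"
      by (rule realizable_exp)
    moreover have "measure_pmf.prob A {a. \<forall>n\<in>U. w \<noteq> \<phi> a n} = 1 - h w U" for U
      using measure_pmf.prob_compl[of "{a. w \<in> \<phi> a ` U}" A]
      by (simp add: h_def image_iff Compl_eq_Diff_UNIV[symmetric] Collect_neg_eq[symmetric])
    ultimately show ?thesis by simp
  qed
  define F where "F k = from_nat_into W ` {..<k}" for k
  have "realizable (\<lambda>U. \<Prod>w\<in>F k. exp (- h w U))" for k
    by (intro realizable_prod 1)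
  moreover have "(\<lambda>k. \<Prod>w\<in>F k. exp (- h w U)) \<longlonglongrightarrow>
      exp (- measure_pmf.expectation A (\<lambda>a. real (card (\<phi> a ` U))))" if U: "finite U" for U
  proof -
    let ?R = "\<Union>a\<in>set_pmf A. \<phi> a ` U"
    have R: "finite ?R" "?R \<subseteq> W" using A U by (auto simp: W_def)
    have "finite (to_nat_on W ` ?R)" using R by simp
    then obtain m where m: "to_nat_on W ` ?R \<subseteq> {..<m}" by (meson finite_nat_bounded)
    have RF: "?R \<subseteq> F k" if "k \<ge> m" for k
    proof
      fix w assume w: "w \<in> ?R"
      then have "to_nat_on W w \<in> {..<m}" using m by blast
      moreover have "w = from_nat_into W (to_nat_on W w)"
        using w R W by (intro from_nat_into_to_nat_on[symmetric]) auto
      ultimately have "w = from_nat_into W (to_nat_on W w)" "to_nat_on W w \<in> {..<k}"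
        using that by auto
      then show "w \<in> F k" unfolding F_def by blast
    qed
    have exp_eq: "measure_pmf.expectation A (\<lambda>a. real (card (\<phi> a ` U))) = (\<Sum>w\<in>F k. h w U)"
      if k: "k \<ge> m" for k
    proof -
      have "measure_pmf.expectation A (\<lambda>a. real (card (\<phi> a ` U)))
          = measure_pmf.expectation A (\<lambda>a. \<Sum>w\<in>F k. indicator {a. w \<in> \<phi> a ` U} a)"
      proof (rule integral_cong_AE)
        show "AE a in measure_pmf A. real (card (\<phi> a ` U)) = (\<Sum>w\<in>F k. indicator {a. w \<in> \<phi> a ` U} a)"
        proof (rule AE_pmfI)
          fix a assume "a \<in> set_pmf A"
          then have "\<phi> a ` U \<subseteq> F k" using RF[OF k] by blast
          then have "real (card (\<phi> a ` U)) = (\<Sum>w\<in>F k. if w \<in> \<phi> a ` U then 1 else 0)"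
            by (subst sum.inter_restrict[symmetric]) (auto simp: F_def Int_absorb1)
          then show "real (card (\<phi> a ` U)) = (\<Sum>w\<in>F k. indicator {a. w \<in> \<phi> a ` U} a)"
            by (simp add: indicator_def of_bool_def)
        qed
      qed auto
      also have "\<dots> = (\<Sum>w\<in>F k. h w U)"
        using A by (subst Bochner_Integration.integral_sum) (auto simp: h_def integrable_measure_pmf_finite)
      finally show ?thesis .
    qed
    have "eventually (\<lambda>k. (\<Prod>w\<in>F k. exp (- h w U)) =
        exp (- measure_pmf.expectation A (\<lambda>a. real (card (\<phi> a ` U))))) sequentially"
      using eventually_ge_at_top[of m]
      by eventually_elim (simp add: exp_eq exp_sum F_def flip: sum_negf)
    then show ?thesis by (rule tendsto_eventually)
  qed
  ultimately show ?thesis by (rule realizable_limit)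
qed

section \<open>Mixing along a sequence\<close>

lemma tannery_sums:
  fixes a :: "nat \<Rightarrow> nat \<Rightarrow> real"
  assumes "\<And>i. (\<lambda>n. a n i) \<longlonglongrightarrow> b i" and "\<And>n i. \<bar>a n i\<bar> \<le> m i" and "summable m"
  shows "(\<lambda>n. suminf (a n)) \<longlonglongrightarrow> suminf b"
proof -
  have "eventually (\<lambda>(i, n). norm (a n i) \<le> m i) (at_top \<times>\<^sub>F sequentially)"
    using assms(2) by (intro always_eventually) auto
  from tannerys_theorem[OF assms(1) this assms(3)] show ?thesis by simp
qed

text \<open>
Borel sets need not belong to the sigma-algebra generated by the sets \<open>all_ones U\<close>, but each of them
agrees with one that does on all sequences of zeros and ones: pull it back along the map that
replaces each entry other than \<open>1\<close> by \<open>0\<close>. The hypothesis \<open>binary\<close> transfers the property between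
the two.
\<close>

lemma binary_law_induct [consumes 2, case_names all_ones compl union binary]:
  assumes M: "binary_law M p" and D: "D \<in> sets M"
    and all_ones: "\<And>U. finite U \<Longrightarrow> P (all_ones U)"
    and compl: "\<And>A. A \<in> sets M \<Longrightarrow> P A \<Longrightarrow> P (UNIV - A)"
    and union: "\<And>A. disjoint_family A \<Longrightarrow> range A \<subseteq> sets M \<Longrightarrow> (\<And>i. P (A i)) \<Longrightarrow> P (\<Union>i::nat. A i)"
    and binary: "\<And>A B. A \<in> sets M \<Longrightarrow> B \<in> sets M \<Longrightarrow> P A \<Longrightarrow>
       (\<And>x. (\<forall>n. x n \<in> {0, 1}) \<Longrightarrow> x \<in> A \<longleftrightarrow> x \<in> B) \<Longrightarrow> P B"
  shows "P D"
proof -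
  note * = binary_lawD[OF M]
  let ?G = "{all_ones U | U. finite U}"
  have "sigma_sets (space M) ?G \<subseteq> sets M"
    by (rule sets.sigma_sets_subset) (auto simp only: *(2) all_ones_borel)
  then have sub: "sigma_sets UNIV ?G \<subseteq> sets M"
    unfolding *(5) .
  have PA: "P A" if "A \<in> sigma_sets UNIV ?G" for A
  proof (rule sigma_sets_induct_disjoint[OF _ _ that])
    show "Int_stable ?G"
    proof (rule Int_stableI)
      fix A B assume "A \<in> ?G" "B \<in> ?G"
      then obtain U V where "A = all_ones U" "B = all_ones V" "finite U" "finite V" by blast
      then have "A \<inter> B = all_ones (U \<union> V)" "finite (U \<union> V)" by auto
      then show "A \<inter> B \<in> ?G" by blast
    qed
    show "P {}" using compl[of UNIV] all_ones[of "{}"] *(2) by simp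
  qed (use all_ones compl union sub in auto)
  define c :: "(nat \<Rightarrow> real) \<Rightarrow> nat \<Rightarrow> real" where "c x = (\<lambda>n. indicator (all_ones {n}) x)" for x
  have "c \<in> sigma UNIV ?G \<rightarrow>\<^sub>M borel"
  proof (rule measurable_coordinatewise_then_product)
    fix n
    have "all_ones {n} \<in> sets (sigma UNIV ?G)"
      by (simp add: sets_measure_of) (rule sigma_sets.Basic, blast)
    then show "(\<lambda>x. c x n) \<in> borel_measurable (sigma UNIV ?G)"
      unfolding c_def by (rule borel_measurable_indicator)
  qed
  then have "c -` D \<in> sigma_sets UNIV ?G"
    using D *(2) measurable_sets[of c "sigma UNIV ?G" borel D] by (simp add: space_measure_of_conv)
  moreover have "x \<in> c -` D \<longleftrightarrow> x \<in> D" if "\<forall>n. x n \<in> {0, 1}" for x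
  proof -
    have "c x = x" using that by (auto simp: c_def indicator_def fun_eq_iff)
    then show ?thesis by simp
  qed
  ultimately show "P D" using PA sub D binary[of "c -` D" D] by blast
qed

lemma (in prob_space) limit_on_disjoint_union:
  assumes A: "disjoint_family A" "range A \<subseteq> sets M"
    and \<nu>: "\<And>n. (\<lambda>i. \<nu> n (A i)) sums \<nu> n (\<Union>i. A i)"
    and bound: "\<And>n i. \<bar>\<nu> n (A i)\<bar> \<le> prob (A i)"
    and lim: "\<And>i. (\<lambda>n. \<nu> n (A i)) \<longlonglongrightarrow> c * prob (A i)"
  shows "(\<lambda>n. \<nu> n (\<Union>i. A i)) \<longlonglongrightarrow> c * prob (\<Union>i. A i)"
proof -
  have s: "(\<lambda>i. prob (A i)) sums prob (\<Union>i. A i)"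
    using A by (intro finite_measure_UNION) auto
  have "(\<lambda>n. suminf (\<lambda>i. \<nu> n (A i))) \<longlonglongrightarrow> suminf (\<lambda>i. c * prob (A i))"
    using bound lim s by (intro tannery_sums[where m = "\<lambda>i. prob (A i)"]) (auto simp: sums_iff)
  then show ?thesis
    using \<nu> s by (simp add: sums_iff suminf_mult)
qed

text \<open>
Correlations of all pairs of sets factorize asymptotically as soon as those of sets in a generating
pi-system do. This is what makes the step to the product of the system with itself, and hence to weak
mixing, immediate.
\<close>

locale mixing_sequence = prob_space M for M :: "'x measure" +
  fixes \<tau> :: "nat \<Rightarrow> 'x \<Rightarrow> 'x"
  assumes \<tau>_measurable: "\<tau> n \<in> M \<rightarrow>\<^sub>M M"
    and \<tau>_preserves: "D \<in> sets M \<Longrightarrow> prob (\<tau> n -` D \<inter> space M) = prob D"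
begin

lemma vimage_sets: "D \<in> sets M \<Longrightarrow> \<tau> n -` D \<inter> space M \<in> sets M"
  using \<tau>_measurable by (rule measurable_sets)

definition mixes :: "'x set \<Rightarrow> 'x set \<Rightarrow> bool" where
  "mixes A B \<longleftrightarrow> (\<lambda>n. prob (A \<inter> (\<tau> n -` B \<inter> space M))) \<longlonglongrightarrow> prob A * prob B"

lemma mixes_compl_left:
  assumes "mixes A B" "A \<in> sets M" "B \<in> sets M"
  shows "mixes (space M - A) B"
proof -
  have "prob ((space M - A) \<inter> (\<tau> n -` B \<inter> space M)) = prob B - prob (A \<inter> (\<tau> n -` B \<inter> space M))" for n
  proof -
    have "(space M - A) \<inter> (\<tau> n -` B \<inter> space M) = (\<tau> n -` B \<inter> space M) - A \<inter> (\<tau> n -` B \<inter> space M)" by blast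
    then show ?thesis
      using assms vimage_sets[of B n] \<tau>_preserves[of B n]
        finite_measure_Diff[of "\<tau> n -` B \<inter> space M" "A \<inter> (\<tau> n -` B \<inter> space M)"] by auto
  qed
  moreover have "(\<lambda>n. prob B - prob (A \<inter> (\<tau> n -` B \<inter> space M))) \<longlonglongrightarrow> prob B - prob A * prob B"
    using assms by (intro tendsto_intros) (simp add: mixes_def)
  ultimately show ?thesis using assms by (simp add: mixes_def prob_compl left_diff_distrib right_diff_distrib)
qed

lemma mixes_compl_right:
  assumes "mixes A B" "A \<in> sets M" "B \<in> sets M"
  shows "mixes A (space M - B)"
proof -
  have "prob (A \<inter> (\<tau> n -` (space M - B) \<inter> space M)) = prob A - prob (A \<inter> (\<tau> n -` B \<inter> space M))" for n
  proof -
    have "A \<inter> (\<tau> n -` (space M - B) \<inter> space M) = A - A \<inter> (\<tau> n -` B \<inter> space M)"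
      using assms(2)[THEN sets.sets_into_space] measurable_space[OF \<tau>_measurable[of n]] by blast
    then show ?thesis
      using assms vimage_sets[of B n]
        finite_measure_Diff[of A "A \<inter> (\<tau> n -` B \<inter> space M)"] by auto
  qed
  moreover have "(\<lambda>n. prob A - prob (A \<inter> (\<tau> n -` B \<inter> space M))) \<longlonglongrightarrow> prob A - prob A * prob B"
    using assms by (intro tendsto_intros) (simp add: mixes_def)
  ultimately show ?thesis using assms by (simp add: mixes_def prob_compl left_diff_distrib right_diff_distrib)
qed

lemma mixes_union_left:
  assumes A: "disjoint_family A" "range A \<subseteq> sets M" "\<And>i::nat. mixes (A i) B" and B: "B \<in> sets M"
  shows "mixes (\<Union>i. A i) B"
proof -
  have "(\<lambda>n. prob ((\<Union>i. A i) \<inter> (\<tau> n -` B \<inter> space M))) \<longlonglongrightarrow> prob B * prob (\<Union>i. A i)"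
  proof (rule limit_on_disjoint_union[where \<nu> = "\<lambda>n A. prob (A \<inter> (\<tau> n -` B \<inter> space M))"])
    fix n
    have "(\<lambda>i. prob (A i \<inter> (\<tau> n -` B \<inter> space M))) sums prob (\<Union>i. A i \<inter> (\<tau> n -` B \<inter> space M))"
      using A vimage_sets[OF B, of n]
      by (intro finite_measure_UNION) (auto simp: disjoint_family_on_def)
    then show "(\<lambda>i. prob (A i \<inter> (\<tau> n -` B \<inter> space M))) sums prob ((\<Union>i. A i) \<inter> (\<tau> n -` B \<inter> space M))"
      by (simp add: Int_UN_distrib2)
    show "\<bar>prob (A i \<inter> (\<tau> n -` B \<inter> space M))\<bar> \<le> prob (A i)" for i
      using A by (auto intro!: finite_measure_mono)
  qed (use A in \<open>auto simp: mixes_def mult.commute\<close>)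
  then show ?thesis by (simp add: mixes_def mult.commute)
qed

lemma mixes_union_right:
  assumes B: "disjoint_family B" "range B \<subseteq> sets M" "\<And>i::nat. mixes A (B i)" and A: "A \<in> sets M"
  shows "mixes A (\<Union>i. B i)"
  unfolding mixes_def
proof (rule limit_on_disjoint_union[where \<nu> = "\<lambda>n B. prob (A \<inter> (\<tau> n -` B \<inter> space M))"])
  fix n
  have Bi: "B i \<in> sets M" for i using B by blast
  have "(\<lambda>i. prob (A \<inter> (\<tau> n -` B i \<inter> space M))) sums prob (\<Union>i. A \<inter> (\<tau> n -` B i \<inter> space M))"
    using A B(1) vimage_sets[OF Bi, of n]
    by (intro finite_measure_UNION) (auto simp: disjoint_family_on_def)
  moreover have "(\<Union>i. A \<inter> (\<tau> n -` B i \<inter> space M)) = A \<inter> (\<tau> n -` (\<Union>i. B i) \<inter> space M)" by blast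
  ultimately show "(\<lambda>i. prob (A \<inter> (\<tau> n -` B i \<inter> space M))) sums prob (A \<inter> (\<tau> n -` (\<Union>i. B i) \<inter> space M))"
    by simp
  show "\<bar>prob (A \<inter> (\<tau> n -` B i \<inter> space M))\<bar> \<le> prob (B i)" for i
    using finite_measure_mono[of "A \<inter> (\<tau> n -` B i \<inter> space M)" "\<tau> n -` B i \<inter> space M"]
      A vimage_sets[OF Bi, of n] \<tau>_preserves[OF Bi, of n] by (simp only: Int_lower2) simp
qed (use B in \<open>auto simp: mixes_def mult.commute\<close>)

lemma mixes_pi_system:
  assumes G: "Int_stable G" "G \<subseteq> Pow (space M)" "sets M = sigma_sets (space M) G"
    and mix: "\<And>A B. A \<in> G \<Longrightarrow> B \<in> G \<Longrightarrow> mixes A B"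
    and AB: "A \<in> sets M" "B \<in> sets M"
  shows "mixes A B"
proof -
  have GM: "A \<in> sets M" if "A \<in> G" for A using that G(3) by auto
  have empty: "mixes A {}" "mixes {} A" for A by (simp_all add: mixes_def)
  have 1: "mixes A B" if A: "A \<in> G" and "B \<in> sets M" for A B
  proof (rule sigma_sets_induct_disjoint[OF G(1,2) that(2)[unfolded G(3)]])
    show "mixes A B" if "B \<in> G" for B using A that by (rule mix)
  next
    fix B :: "nat \<Rightarrow> 'x set" assume "disjoint_family B" "range B \<subseteq> sigma_sets (space M) G" "\<And>i. mixes A (B i)"
    then show "mixes A (\<Union>i. B i)" using GM[OF A] G(3) by (intro mixes_union_right) auto
  qed (use empty GM A G(3) in \<open>auto intro: mixes_compl_right\<close>)
  show ?thesis
  proof (rule sigma_sets_induct_disjoint[OF G(1,2) AB(1)[unfolded G(3)]])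
    show "mixes A B" if "A \<in> G" for A using that AB(2) by (rule 1)
  next
    fix A :: "nat \<Rightarrow> 'x set" assume "disjoint_family A" "range A \<subseteq> sigma_sets (space M) G" "\<And>i. mixes (A i) B"
    then show "mixes (\<Union>i. A i) B" using AB(2) G(3) by (intro mixes_union_left) auto
  qed (use empty GM AB G(3) in \<open>auto intro: mixes_compl_left\<close>)
qed

text \<open>
For an invariant set the correlation with its preimages is its own measure, so the measure equals its square.
\<close>

lemma invariant_trivial:
  assumes mix: "mixes D D" and D: "D \<in> sets M"
    and inv: "\<And>n. prob (sym_diff D (\<tau> n -` D \<inter> space M)) = 0"
  shows "prob D \<in> {0, 1}"
proof -
  have "prob (D \<inter> (\<tau> n -` D \<inter> space M)) = prob D" for n
  proof -
    have v: "\<tau> n -` D \<inter> space M \<in> sets M" using D by (rule vimage_sets)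
    have "prob (D - (\<tau> n -` D \<inter> space M)) \<le> prob (sym_diff D (\<tau> n -` D \<inter> space M))"
      using D v by (intro finite_measure_mono) auto
    then have "prob (D - (\<tau> n -` D \<inter> space M)) = 0" using inv[of n] measure_nonneg
      by (metis order_antisym)
    moreover have "prob (D - (\<tau> n -` D \<inter> space M)) = prob D - prob (D \<inter> (\<tau> n -` D \<inter> space M))"
      using D v by (rule finite_measure_Diff')
    ultimately show ?thesis by simp
  qed
  then have "prob D = prob D * prob D"
    using mix by (simp add: mixes_def LIMSEQ_const_iff)
  then show ?thesis by simp
qed

end

section \<open>Shift systems of stationary binary laws\<close>

lemma null_by_bound:
  fixes f g :: "nat \<Rightarrow> real"
  assumes "\<And>n. 0 \<le> f n" "\<And>n. f n \<le> g n" "g \<longlonglongrightarrow> 0"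
  shows "f \<longlonglongrightarrow> 0"
  by (rule tendsto_sandwich[of "\<lambda>_. 0" f sequentially g]) (use assms in auto)

text \<open>
The entries of a sequence are indexed by the group through an enumeration \<open>en\<close> with inverse \<open>idx\<close>;
\<open>stationary\<close> says that the law is invariant under translation of the index.
\<close>

locale stationary_law = comm_group G for G (structure) +
  fixes M :: "(nat \<Rightarrow> real) measure" and p :: "'a set \<Rightarrow> real"
  assumes countable: "countable (carrier G)" and infinite: "infinite (carrier G)"
    and law: "binary_law M (\<lambda>U. p (from_nat_into (carrier G) ` U))"
    and stationary: "\<lbrakk>g \<in> carrier G; finite A; A \<subseteq> carrier G\<rbrakk> \<Longrightarrow> p ((\<lambda>u. u \<otimes> g) ` A) = p A"
begin

abbreviation "en \<equiv> from_nat_into (carrier G)"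
abbreviation "idx \<equiv> to_nat_on (carrier G)"

definition shift :: "'a \<Rightarrow> (nat \<Rightarrow> real) \<Rightarrow> nat \<Rightarrow> real" where
  "shift g x = (\<lambda>n. x (idx (en n \<otimes> g)))"

definition ones_at :: "'a set \<Rightarrow> (nat \<Rightarrow> real) set" where
  "ones_at A = all_ones (idx ` A)"

lemma en_idx [simp]: "u \<in> carrier G \<Longrightarrow> en (idx u) = u"
  using countable by (rule from_nat_into_to_nat_on)

lemma idx_en [simp]: "idx (en n) = n"
  using countable infinite by (rule to_nat_on_from_nat_into_infinite)

lemma en_closed [simp]: "en n \<in> carrier G"
  by (intro from_nat_into) auto

sublocale M: prob_space M
  using law by (rule binary_lawD)

lemma sets_M: "sets M = sets borel" and space_M [simp]: "space M = UNIV"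
  and binary_AE: "AE x in M. \<forall>n. x n \<in> {0, 1}"
  using binary_lawD[OF law] by blast+

lemma in_sets_M [simp]: "A \<in> sets borel \<Longrightarrow> A \<in> sets M"
  by (simp add: sets_M)

lemma all_ones_eq: "all_ones U = ones_at (en ` U)"
  by (simp add: ones_at_def image_image)

lemma ones_at_sets [simp]: "ones_at A \<in> sets M"
  unfolding ones_at_def by (rule in_sets_M[OF all_ones_borel])

lemma ones_at_Un: "ones_at (A \<union> B) = ones_at A \<inter> ones_at B"
  by (auto simp: ones_at_def)

lemma prob_ones_at:
  assumes "finite A" "A \<subseteq> carrier G"
  shows "M.prob (ones_at A) = p A"
proof -
  have "en ` idx ` A = A" using assms by (force simp: image_image subset_iff)
  then show ?thesis
    using binary_lawD(4)[OF law, of "idx ` A"] assms by (simp add: ones_at_def)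
qed

lemma shift_vimage_ones_at:
  assumes "g \<in> carrier G" "A \<subseteq> carrier G"
  shows "shift g -` ones_at A = ones_at ((\<lambda>u. u \<otimes> g) ` A)"
  using assms by (auto simp: ones_at_def shift_def subset_iff)

lemma shift_measurable: "shift g \<in> M \<rightarrow>\<^sub>M M"
proof -
  have "shift g \<in> borel \<rightarrow>\<^sub>M borel"
    unfolding shift_def by (intro measurable_coordinatewise_then_product measurable_product_coordinates)
  then show ?thesis by (simp only: measurable_cong_sets[OF sets_M sets_M])
qed

lemma shift_vimage_sets [simp]: "D \<in> sets M \<Longrightarrow> shift g -` D \<in> sets M"
  using measurable_sets[OF shift_measurable] by simp

lemma sym_diff_shift_sets: "D \<in> sets M \<Longrightarrow> sym_diff D (shift g -` D) \<in> sets M"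
  by (intro sets.Un sets.Diff shift_vimage_sets)

lemma shift_binary: "\<forall>n. x n \<in> {0, 1} \<Longrightarrow> \<forall>n. shift g x n \<in> {0, 1}"
  by (simp add: shift_def)

lemma shift_one: "shift \<one> x = x"
  by (simp add: shift_def)

lemma shift_mult: "g \<in> carrier G \<Longrightarrow> h \<in> carrier G \<Longrightarrow> shift (g \<otimes> h) x = shift g (shift h x)"
  by (simp add: shift_def m_assoc)

lemma shift_inv:
  assumes "g \<in> carrier G"
  shows "shift (inv g) (shift g x) = x" "shift g (shift (inv g) x) = x"
  using assms shift_mult[of "inv g" g x] shift_mult[of g "inv g" x] by (simp_all add: shift_one)

lemma shift_image:
  assumes "g \<in> carrier G"
  shows "shift g ` D = shift (inv g) -` D"
proof (intro equalityI subsetI)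
  fix x assume "x \<in> shift (inv g) -` D"
  then have "shift g (shift (inv g) x) \<in> shift g ` D" by blast
  then show "x \<in> shift g ` D" by (simp add: shift_inv assms)
qed (auto simp: shift_inv assms)

lemma prob_cong_binary:
  assumes "A \<in> sets M" "B \<in> sets M" "\<And>x. \<forall>n. x n \<in> {0, 1} \<Longrightarrow> x \<in> A \<longleftrightarrow> x \<in> B"
  shows "M.prob A = M.prob B"
  using binary_AE assms by (intro M.finite_measure_eq_AE) (auto elim!: eventually_mono)

lemma shift_preserves:
  assumes g: "g \<in> carrier G" and D: "D \<in> sets M"
  shows "M.prob (shift g -` D) = M.prob D"
  using law D
proof (induction rule: binary_law_induct)
  case (all_ones U)
  have "en ` U \<subseteq> carrier G" by auto
  moreover have "(\<lambda>u. u \<otimes> g) ` en ` U \<subseteq> carrier G" using g by auto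
  ultimately show ?case
    using all_ones g by (simp add: all_ones_eq shift_vimage_ones_at prob_ones_at stationary)
next
  case (compl A)
  then show ?case
    using M.prob_compl[of A] M.prob_compl[of "shift g -` A"] by (simp add: vimage_Diff)
next
  case (union A)
  have "(\<lambda>i. M.prob (A i)) sums M.prob (\<Union>i. A i)"
    using union by (intro M.finite_measure_UNION) auto
  moreover have "(\<lambda>i. M.prob (shift g -` A i)) sums M.prob (\<Union>i. shift g -` A i)"
    using union by (intro M.finite_measure_UNION) (auto simp: disjoint_family_on_def)
  ultimately show ?case using union by (simp add: vimage_UN sums_iff)
next
  case (binary A B)
  then have "M.prob (shift g -` A) = M.prob (shift g -` B)"
    using shift_binary[of _ g] by (intro prob_cong_binary) auto
  moreover have "M.prob A = M.prob B" using binary by (intro prob_cong_binary) auto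
  ultimately show ?case using binary by simp
qed

lemma prob_sym_diff_shift:
  assumes "D \<in> sets M" "g \<in> carrier G"
  shows "M.prob (sym_diff D (shift g -` D)) \<le> 2 * M.prob D"
proof -
  have "M.prob (sym_diff D (shift g -` D)) \<le> M.prob (D \<union> shift g -` D)"
    using assms by (intro M.finite_measure_mono) auto
  also have "\<dots> \<le> M.prob D + M.prob (shift g -` D)"
    using assms by (intro measure_Un_le) auto
  finally show ?thesis using assms by (simp add: shift_preserves)
qed

lemma distr_shift: "g \<in> carrier G \<Longrightarrow> distr M M (shift g) = M"
  by (intro measure_eqI) (simp_all add: emeasure_distr shift_measurable M.emeasure_eq_measure shift_preserves)

lemma G_system_shift: "G_system G M shift"
proof (intro G_system.intro G_system_axioms.intro)
  show "prob_space M" by (rule M.prob_space_axioms)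
  have bij: "bij (shift g)" if "g \<in> carrier G" for g
    using shift_inv[OF that] by (intro o_bij[of "shift (inv g)"]) (auto simp: fun_eq_iff)
  show "group_action G (space M) shift"
    unfolding group_action_def group_hom_def group_hom_axioms_def
  proof (intro conjI)
    show "group G" by (rule is_group)
    show "group (BijGroup (space M))" by (rule group_BijGroup)
    show "shift \<in> hom G (BijGroup (space M))"
      using bij by (intro homI) (auto simp: BijGroup_def Bij_def shift_mult compose_def fun_eq_iff)
  qed
  show "shift g \<in> M \<rightarrow>\<^sub>M M" for g by (rule shift_measurable)
  show "M.prob (shift g ` D) = M.prob D" if "g \<in> carrier G" "D \<in> sets M" for g D
    using that by (simp add: shift_image shift_preserves)
qed

text \<open>
By stationarity, the event of a \<open>1\<close> at \<open>u\<close> and its image under \<open>s n\<close> have a symmetric difference of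
measure \<open>2 * (p {\<one>} - p {\<one>, s n})\<close>, whatever \<open>u\<close> is. The sets with symmetric differences tending
to null are closed under finite intersections, complements and, by dominated convergence, disjoint unions.
\<close>

lemma rigid_shift:
  assumes s: "\<And>n. s n \<in> carrier G" and lim: "(\<lambda>n. p {\<one>, s n}) \<longlonglongrightarrow> p {\<one>}"
  shows "rigidity_sequence M shift s"
proof -
  let ?d = "\<lambda>D n. M.prob (sym_diff D (shift (inv s n) -` D))"
  have single: "?d (ones_at {u}) \<longlonglongrightarrow> 0" if u: "u \<in> carrier G" for u
  proof -
    have "?d (ones_at {u}) n = 2 * (p {\<one>} - p {\<one>, s n})" for n
    proof -
      let ?v = "u \<otimes> inv s n"
      have v: "?v \<in> carrier G" using u s by simp
      have *: "p {u} = p {\<one>}" "p {?v} = p {\<one>}" "p {u, ?v} = p {\<one>, s n}"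
        using stationary[of u "{\<one>}"] stationary[of ?v "{\<one>}"] stationary[of ?v "{\<one>, s n}"] u s[of n] v
        by (auto simp: insert_commute m_assoc m_comm[of "s n"] m_lcomm[of "s n"])
      have "ones_at {u} - ones_at {?v} = ones_at {u} - ones_at {u, ?v}"
        "ones_at {?v} - ones_at {u} = ones_at {?v} - ones_at {u, ?v}"
        by (auto simp: ones_at_def)
      moreover have "ones_at {u, ?v} \<subseteq> ones_at {u}" "ones_at {u, ?v} \<subseteq> ones_at {?v}"
        by (auto simp: ones_at_def)
      ultimately have "M.prob (ones_at {u} - ones_at {?v}) = p {\<one>} - p {\<one>, s n}"
        "M.prob (ones_at {?v} - ones_at {u}) = p {\<one>} - p {\<one>, s n}"
        using u v * by (simp_all add: M.finite_measure_Diff prob_ones_at)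
      moreover have "shift (inv s n) -` ones_at {u} = ones_at {?v}"
        using u s by (simp add: shift_vimage_ones_at)
      moreover have "M.prob (sym_diff (ones_at {u}) (ones_at {?v}))
          = M.prob (ones_at {u} - ones_at {?v}) + M.prob (ones_at {?v} - ones_at {u})"
        by (intro M.finite_measure_Union) auto
      ultimately show ?thesis by simp
    qed
    moreover have "(\<lambda>n. 2 * (p {\<one>} - p {\<one>, s n})) \<longlonglongrightarrow> 2 * (p {\<one>} - p {\<one>})"
      by (intro tendsto_intros lim)
    ultimately show ?thesis by simp
  qed
  have "?d D \<longlonglongrightarrow> 0" if "D \<in> sets M" for D
    using law that
  proof (induction rule: binary_law_induct)
    case (all_ones U)
    have le: "?d (all_ones U) n \<le> (\<Sum>k\<in>U. ?d (ones_at {en k}) n)" for n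
    proof -
      have "sym_diff (all_ones U) (shift (inv s n) -` all_ones U)
          \<subseteq> (\<Union>k\<in>U. sym_diff (ones_at {en k}) (shift (inv s n) -` ones_at {en k}))"
        by (auto simp: ones_at_def)
      then have "?d (all_ones U) n
          \<le> M.prob (\<Union>k\<in>U. sym_diff (ones_at {en k}) (shift (inv s n) -` ones_at {en k}))"
        using all_ones by (intro M.finite_measure_mono sets.finite_UN sym_diff_shift_sets) auto
      also have "\<dots> \<le> (\<Sum>k\<in>U. ?d (ones_at {en k}) n)"
        using all_ones
        by (intro M.finite_measure_subadditive_finite) (auto intro: sym_diff_shift_sets simp del: Un_iff)
      finally show ?thesis .
    qed
    have "(\<lambda>n. \<Sum>k\<in>U. ?d (ones_at {en k}) n) \<longlonglongrightarrow> 0"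
      by (intro tendsto_null_sum single en_closed)
    then show ?case by (rule null_by_bound[OF measure_nonneg le])
  next
    case (compl A)
    have "sym_diff (UNIV - A) (shift g -` (UNIV - A)) = sym_diff A (shift g -` A)" for g by auto
    then show ?case using compl by simp
  next
    case (union A)
    have A: "A i \<in> sets M" for i using union by auto
    have s1: "summable (\<lambda>i. M.prob (A i))"
      using M.finite_measure_UNION[of A] union by (auto simp: sums_iff)
    have lim: "(\<lambda>n. suminf (\<lambda>i. ?d (A i) n)) \<longlonglongrightarrow> suminf (\<lambda>i::nat. 0)"
    proof (rule tannery_sums[where m = "\<lambda>i. 2 * M.prob (A i)"])
      show "summable (\<lambda>i. 2 * M.prob (A i))" using s1 by (rule summable_mult)
      fix n i :: nat
      show "\<bar>?d (A i) n\<bar> \<le> 2 * M.prob (A i)" using prob_sym_diff_shift[OF A, of "inv s n"] s by simp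
    qed (rule union)
    have le: "?d (\<Union>i. A i) n \<le> suminf (\<lambda>i. ?d (A i) n)" for n
    proof -
      have "sym_diff (\<Union>i. A i) (shift (inv s n) -` (\<Union>i. A i))
          \<subseteq> (\<Union>i. sym_diff (A i) (shift (inv s n) -` A i))" by auto
      then have "?d (\<Union>i. A i) n \<le> M.prob (\<Union>i. sym_diff (A i) (shift (inv s n) -` A i))"
        using A sym_diff_shift_sets by (intro M.finite_measure_mono sets.countable_UN) auto
      also have "\<dots> \<le> suminf (\<lambda>i. ?d (A i) n)"
      proof (rule M.finite_measure_subadditive_countably)
        show "summable (\<lambda>i. ?d (A i) n)"
        proof (rule summable_comparison_test')
          show "summable (\<lambda>i. 2 * M.prob (A i))" using s1 by (rule summable_mult)
          fix i :: nat assume "0 \<le> i"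
          show "norm (?d (A i) n) \<le> 2 * M.prob (A i)" using prob_sym_diff_shift[OF A, of "inv s n"] s by simp
        qed
      qed (intro image_subsetI sym_diff_shift_sets A)
      finally show ?thesis .
    qed
    show ?case
      by (rule null_by_bound[OF measure_nonneg le lim[unfolded suminf_zero]])
  next
    case (binary A B)
    have "?d B n = ?d A n" for n
    proof (intro prob_cong_binary sym_diff_shift_sets binary(1,2))
      fix x :: "nat \<Rightarrow> real" assume x: "\<forall>n. x n \<in> {0, 1}"
      from binary(3)[OF x] binary(3)[OF shift_binary[OF x, of "inv s n"]]
      show "x \<in> sym_diff B (shift (inv s n) -` B) \<longleftrightarrow> x \<in> sym_diff A (shift (inv s n) -` A)" by blast
    qed
    then show ?case using binary by simp
  qed
  then show ?thesis
    using s by (simp add: rigidity_sequence_def shift_image)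
qed

end

locale mixing_law = stationary_law +
  fixes z :: "nat \<Rightarrow> 'a"
  assumes z: "z n \<in> carrier G"
    and asymptotically_independent: "\<lbrakk>finite A; A \<subseteq> carrier G; finite B; B \<subseteq> carrier G\<rbrakk> \<Longrightarrow>
      (\<lambda>n. p (A \<union> (\<lambda>u. u \<otimes> z n) ` B)) \<longlonglongrightarrow> p A * p B"
begin

sublocale mixing_sequence M "\<lambda>n. shift (z n)"
  by unfold_locales (simp_all add: shift_measurable shift_preserves z)

lemma mixes_shift:
  assumes AB: "A \<in> sets M" "B \<in> sets M"
  shows "mixes A B"
proof -
  have cyl: "mixes (all_ones U) (all_ones V)" if "finite U" "finite V" for U V
  proof -
    have "all_ones U \<inter> shift (z n) -` all_ones V = ones_at (en ` U \<union> (\<lambda>u. u \<otimes> z n) ` en ` V)" for n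
      unfolding all_ones_eq ones_at_Un using z[of n] by (subst shift_vimage_ones_at) auto
    moreover have "M.prob (ones_at (en ` U \<union> (\<lambda>u. u \<otimes> z n) ` en ` V)) = p (en ` U \<union> (\<lambda>u. u \<otimes> z n) ` en ` V)" for n
      using that z by (intro prob_ones_at) auto
    moreover have "(\<lambda>n. p (en ` U \<union> (\<lambda>u. u \<otimes> z n) ` en ` V)) \<longlonglongrightarrow> p (en ` U) * p (en ` V)"
      using that by (intro asymptotically_independent) auto
    moreover have "M.prob (all_ones W) = p (en ` W)" if "finite W" for W
      using that by (simp only: all_ones_eq, intro prob_ones_at) auto
    ultimately show ?thesis using that by (simp add: mixes_def)
  qed
  have left: "mixes (all_ones U) B" if "finite U" "B \<in> sets M" for U B
    using law that(2)
  proof (induction rule: binary_law_induct)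
    case (compl A)
    then show ?case using mixes_compl_right[of "all_ones U" A] by simp
  next
    case (binary A B)
    have "M.prob (all_ones U \<inter> shift (z n) -` A) = M.prob (all_ones U \<inter> shift (z n) -` B)" for n
    proof (rule prob_cong_binary)
      fix x :: "nat \<Rightarrow> real" assume "\<forall>n. x n \<in> {0, 1}"
      then have "shift (z n) x \<in> A \<longleftrightarrow> shift (z n) x \<in> B" by (intro binary(3) shift_binary)
      then show "x \<in> all_ones U \<inter> shift (z n) -` A \<longleftrightarrow> x \<in> all_ones U \<inter> shift (z n) -` B" by blast
    qed (use binary(1,2) in \<open>auto intro: sets.Int\<close>)
    moreover have "M.prob A = M.prob B" using binary by (intro prob_cong_binary) auto
    ultimately show ?case using binary by (simp add: mixes_def)
  qed (use that cyl in \<open>auto intro: mixes_union_right\<close>)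
  from law AB(1) show "mixes A B"
  proof (induction rule: binary_law_induct)
    case (compl A)
    then show ?case using mixes_compl_left[of A B] AB(2) by simp
  next
    case (binary A A')
    then have "M.prob (A \<inter> shift (z n) -` B) = M.prob (A' \<inter> shift (z n) -` B)" for n
      using AB(2) by (intro prob_cong_binary) auto
    moreover have "M.prob A = M.prob A'" using binary by (intro prob_cong_binary) auto
    ultimately show ?case using binary by (simp add: mixes_def)
  qed (use AB(2) left in \<open>auto intro: mixes_union_left\<close>)
qed

lemma weak_mixing_shift: "weak_mixing_action G M shift"
  unfolding weak_mixing_action_def ergodic_action_def
proof (intro ballI impI)
  interpret P: pair_prob_space M M ..
  let ?sh = "\<lambda>g. map_prod (shift g) (shift g)"
  have msh: "?sh g \<in> M \<Otimes>\<^sub>M M \<rightarrow>\<^sub>M M \<Otimes>\<^sub>M M" for g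
    unfolding map_prod_def using shift_measurable[of g] by measurable
  have distr: "distr (M \<Otimes>\<^sub>M M) (M \<Otimes>\<^sub>M M) (?sh g) = M \<Otimes>\<^sub>M M" if "g \<in> carrier G" for g
    using pair_measure_distr[OF shift_measurable shift_measurable, of g g] that
    by (simp add: distr_shift M.sigma_finite_measure_axioms map_prod_def)
  interpret P2: mixing_sequence "M \<Otimes>\<^sub>M M" "\<lambda>n. ?sh (z n)"
  proof
    show "?sh (z n) \<in> M \<Otimes>\<^sub>M M \<rightarrow>\<^sub>M M \<Otimes>\<^sub>M M" for n by (rule msh)
    fix D n assume "D \<in> sets (M \<Otimes>\<^sub>M M)"
    then show "P.prob (?sh (z n) -` D \<inter> space (M \<Otimes>\<^sub>M M)) = P.prob D"
      using measure_distr[OF msh, of D "z n"] z by (simp add: distr)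
  qed
  fix D assume D: "D \<in> sets (M \<Otimes>\<^sub>M M)"
    and inv: "\<forall>g\<in>carrier G. P.prob (sym_diff D (?sh g ` D)) = 0"
  have "P2.mixes D D"
  proof (rule P2.mixes_pi_system[unfolded space_pair_measure, OF Int_stable_pair_measure_generator pair_measure_closed sets_pair_measure _ D D])
    fix R S assume "R \<in> {A \<times> B | A B. A \<in> sets M \<and> B \<in> sets M}" "S \<in> {A \<times> B | A B. A \<in> sets M \<and> B \<in> sets M}"
    then obtain A B A' B' where R: "R = A \<times> B" "A \<in> sets M" "B \<in> sets M"
      and S: "S = A' \<times> B'" "A' \<in> sets M" "B' \<in> sets M" by blast
    have "P.prob (R \<inter> (?sh (z n) -` S \<inter> space (M \<Otimes>\<^sub>M M)))
        = M.prob (A \<inter> shift (z n) -` A') * M.prob (B \<inter> shift (z n) -` B')" for n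
    proof -
      have "R \<inter> (?sh (z n) -` S \<inter> space (M \<Otimes>\<^sub>M M))
          = (A \<inter> shift (z n) -` A') \<times> (B \<inter> shift (z n) -` B')"
        by (auto simp: R S space_pair_measure)
      then show ?thesis using R S by (simp add: M.measure_pair_measure_Times sets.Int)
    qed
    moreover have "(\<lambda>n. M.prob (A \<inter> shift (z n) -` A') * M.prob (B \<inter> shift (z n) -` B'))
        \<longlonglongrightarrow> (M.prob A * M.prob A') * (M.prob B * M.prob B')"
      using mixes_shift[OF R(2) S(2)] mixes_shift[OF R(3) S(3)] by (intro tendsto_mult) (simp_all add: mixes_def)
    ultimately show "P2.mixes R S"
      using R S by (simp add: P2.mixes_def M.measure_pair_measure_Times mult_ac)
  qed
  moreover have "P.prob (sym_diff D (?sh (z n) -` D \<inter> space (M \<Otimes>\<^sub>M M))) = 0" for n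
  proof -
    have "?sh (inv z n) ` D = ?sh (z n) -` D"
    proof (intro equalityI subsetI)
      fix x assume "x \<in> ?sh (z n) -` D"
      then have "?sh (inv z n) (?sh (z n) x) \<in> ?sh (inv z n) ` D" by blast
      then show "x \<in> ?sh (inv z n) ` D"
        using z by (cases x) (simp add: shift_inv)
    qed (use z in \<open>auto simp: shift_inv\<close>)
    then show ?thesis using inv z by (metis inv_closed space_pair_measure space_M UNIV_Times_UNIV Int_UNIV_right)
  qed
  ultimately show "P.prob D \<in> {0, 1}"
    using D by (intro P2.invariant_trivial)
qed

text \<open>
The set of fixed points of \<open>h\<close> is invariant because the group is commutative, so ergodicity leaves
the measures \<open>0\<close> and \<open>1\<close>. The latter is impossible since the entries at \<open>\<one>\<close> and \<open>h\<close> differ with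
positive probability.
\<close>

lemma free_shift:
  assumes moved: "\<And>g. \<lbrakk>g \<in> carrier G; g \<noteq> \<one>\<rbrakk> \<Longrightarrow> p {\<one>, g} \<noteq> p {\<one>}"
  shows "free_action G M shift"
  unfolding free_action_def
proof (intro ballI)
  fix h assume h: "h \<in> carrier G - {\<one>}"
  let ?F = "{x. shift h x = x}"
  have "?F = (\<Inter>n. {x \<in> space borel. x (idx (en n \<otimes> h)) = x n})" by (auto simp: shift_def fun_eq_iff)
  also have "\<dots> \<in> sets borel"
    by (intro sets.countable_INT'' borel_measurable_eq measurable_product_coordinates) auto
  finally have F: "?F \<in> sets M" by simp
  have inv: "shift (z n) -` ?F = ?F" for n
  proof -
    have c: "shift h (shift (z n) x) = shift (z n) (shift h x)" for x
      using z h shift_mult[of h "z n" x] shift_mult[of "z n" h x] by (simp add: m_comm)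
    have "shift (z n) y = shift (z n) x \<longleftrightarrow> y = x" for x y
      using shift_inv(1)[OF z] by metis
    then show ?thesis by (auto simp: c)
  qed
  have "M.prob (sym_diff ?F (shift (z n) -` ?F \<inter> space M)) = 0" for n
    unfolding inv by simp
  then have "M.prob ?F \<in> {0, 1}"
    by (intro invariant_trivial mixes_shift F)
  moreover have "M.prob ?F \<noteq> 1"
  proof
    assume F1: "M.prob ?F = 1"
    let ?A = "ones_at {\<one>} - ones_at {\<one>, h}"
    have "?F \<inter> ?A = {}"
    proof -
      have eq: "x (idx h) = x (idx \<one>)" if "shift h x = x" for x
        using fun_cong[OF that, of "idx \<one>"] h by (simp add: shift_def)
      have "x \<notin> ?A" if "shift h x = x" for x
        using eq[OF that] by (simp add: ones_at_def)
      then show ?thesis by blast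
    qed
    then have "M.prob ?F + M.prob ?A = M.prob (?F \<union> ?A)"
      using F by (intro M.finite_measure_Union[symmetric]) auto
    also have "\<dots> \<le> 1" by (rule M.prob_le_1)
    finally have "M.prob ?A = 0" using F1 measure_nonneg[of M ?A] by linarith
    moreover have "M.prob ?A = p {\<one>} - p {\<one>, h}"
    proof -
      have "ones_at {\<one>, h} \<subseteq> ones_at {\<one>}" by (auto simp: ones_at_def)
      then show ?thesis using h by (simp add: M.finite_measure_Diff prob_ones_at)
    qed
    ultimately show False using moved[of h] h by simp
  qed
  ultimately show "{x \<in> space M. shift h x = x} \<in> sets M \<and> M.prob {x \<in> space M. shift h x = x} = 0"
    using F by simp
qed

end

text \<open>
The system is translation of the random set of positions of the ones. The hypothesis \<open>mixing\<close> makes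
it mixing along \<open>z\<close>, hence weak mixing; with \<open>moved\<close> ergodicity gives freeness.
\<close>

theorem (in comm_group) rigid_for_free_weak_mixingI:
  fixes p :: "'a set \<Rightarrow> real"
  assumes "countable (carrier G)" and "infinite (carrier G)"
    and real: "realizable (\<lambda>U. p (from_nat_into (carrier G) ` U))"
    and stationary: "\<And>g A. \<lbrakk>g \<in> carrier G; finite A; A \<subseteq> carrier G\<rbrakk> \<Longrightarrow> p ((\<lambda>u. u \<otimes> g) ` A) = p A"
    and z: "\<And>n. z n \<in> carrier G"
    and mixing: "\<And>A B. \<lbrakk>finite A; A \<subseteq> carrier G; finite B; B \<subseteq> carrier G\<rbrakk> \<Longrightarrow>
      (\<lambda>n. p (A \<union> (\<lambda>u. u \<otimes> z n) ` B)) \<longlonglongrightarrow> p A * p B"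
    and moved: "\<And>g. \<lbrakk>g \<in> carrier G; g \<noteq> \<one>\<rbrakk> \<Longrightarrow> p {\<one>, g} \<noteq> p {\<one>}"
    and s: "\<And>n. s n \<in> carrier G" and rigid: "(\<lambda>n. p {\<one>, s n}) \<longlonglongrightarrow> p {\<one>}"
  shows "rigid_for_free_weak_mixing G s"
proof -
  obtain M where M: "binary_law M (\<lambda>U. p (from_nat_into (carrier G) ` U))"
    using real by (auto simp: realizable_def)
  interpret mixing_law G M p z
    by unfold_locales (use assms M in auto)
  show ?thesis
    unfolding rigid_for_free_weak_mixing_def
    using sets_M G_system_shift free_shift[OF moved] weak_mixing_shift rigid_shift[OF s rigid]
    by blast
qed

section \<open>Concentration of measure for the Hamming distance\<close>

definition hamming :: "'i set \<Rightarrow> ('i \<Rightarrow> 'c) \<Rightarrow> ('i \<Rightarrow> 'c) \<Rightarrow> nat" where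
  "hamming I x y = card {i \<in> I. x i \<noteq> y i}"

lemma sum_PiE_insert:
  assumes "finite I" "i \<notin> I"
  shows "(\<Sum>x\<in>insert i I \<rightarrow>\<^sub>E C. f x) = (\<Sum>g\<in>I \<rightarrow>\<^sub>E C. \<Sum>c\<in>C. f (g(i := c)))"
proof -
  have "(\<Sum>x\<in>insert i I \<rightarrow>\<^sub>E C. f x) = (\<Sum>(c, g)\<in>C \<times> (I \<rightarrow>\<^sub>E C). f (g(i := c)))"
    unfolding PiE_insert_eq using assms
    by (subst sum.reindex) (auto intro!: inj_combinator sum.cong)
  also have "\<dots> = (\<Sum>g\<in>I \<rightarrow>\<^sub>E C. \<Sum>c\<in>C. f (g(i := c)))"
    by (subst sum.cartesian_product[symmetric]) (rule sum.swap)
  finally show ?thesis .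
qed

text \<open>
The Efron-Stein inequality for functions with differences bounded by \<open>1\<close>: the variance grows by at most
\<open>1\<close> with each coordinate. In the induction step \<open>h\<close> averages \<open>f\<close> over the new coordinate, and the mixed
terms vanish because \<open>\<alpha>\<close> has mean zero in that coordinate.
\<close>

lemma sum_square_differences_le:
  fixes f :: "('i \<Rightarrow> 'c) \<Rightarrow> real"
  assumes I: "finite I" and C: "finite C"
    and lip: "\<And>x i c. \<lbrakk>x \<in> I \<rightarrow>\<^sub>E C; i \<in> I; c \<in> C\<rbrakk> \<Longrightarrow> \<bar>f (x(i := c)) - f x\<bar> \<le> 1"
  shows "(\<Sum>x\<in>I \<rightarrow>\<^sub>E C. \<Sum>y\<in>I \<rightarrow>\<^sub>E C. (f x - f y)\<^sup>2) \<le> 2 * card I * (card (I \<rightarrow>\<^sub>E C))\<^sup>2"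
  using I lip
proof (induction I arbitrary: f)
  case empty
  then show ?case by simp
next
  case (insert i I)
  show ?case
  proof (cases "C = {}")
    case True
    then have "(insert i I \<rightarrow>\<^sub>E C) = {}" unfolding PiE_eq_empty_iff by blast
    then show ?thesis by simp
  next
    case False
    let ?P = "I \<rightarrow>\<^sub>E C"
    define n where "n = real (card C)"
    have n: "n > 0" using C False by (simp add: n_def card_gt_0_iff)
    have finP: "finite ?P" using insert.hyps C by (simp add: finite_PiE)
    define h where "h g = (\<Sum>c\<in>C. f (g(i := c))) / n" for g
    define \<alpha> where "\<alpha> g c = f (g(i := c)) - h g" for g c
    have ext: "g(i := c) \<in> insert i I \<rightarrow>\<^sub>E C" if "g \<in> ?P" "c \<in> C" for g c
      using that by (auto simp: PiE_iff extensional_def)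
    have \<alpha>0: "(\<Sum>c\<in>C. \<alpha> g c) = 0" for g
      using n by (simp add: \<alpha>_def h_def sum_subtractf n_def)
    have \<alpha>1: "(\<alpha> g c)\<^sup>2 \<le> 1" if g: "g \<in> ?P" and c: "c \<in> C" for g c
    proof -
      have "\<alpha> g c = (\<Sum>c'\<in>C. f (g(i := c)) - f (g(i := c'))) / n"
        using n by (simp add: \<alpha>_def h_def sum_subtractf n_def divide_simps)
      also have "\<bar>\<dots>\<bar> \<le> (\<Sum>c'\<in>C. 1) / n"
      proof -
        have "\<bar>f (g(i := c)) - f (g(i := c'))\<bar> \<le> 1" if "c' \<in> C" for c'
          using insert.prems[OF ext[OF g that] insertI1 c] unfolding fun_upd_upd .
        then have "\<bar>\<Sum>c'\<in>C. f (g(i := c)) - f (g(i := c'))\<bar> \<le> (\<Sum>c'\<in>C. 1)"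
          by (intro order_trans[OF sum_abs] sum_mono)
        then show ?thesis using n by (simp add: divide_right_mono)
      qed
      also have "\<dots> = 1" using n by (simp add: n_def)
      finally show ?thesis by (simp add: abs_square_le_1)
    qed
    have lip_h: "\<bar>h (g(j := d)) - h g\<bar> \<le> 1" if g: "g \<in> ?P" and j: "j \<in> I" and d: "d \<in> C" for g j d
    proof -
      have ji: "j \<noteq> i" using j insert.hyps by auto
      have "\<bar>f (g(j := d, i := c)) - f (g(i := c))\<bar> \<le> 1" if "c \<in> C" for c
        unfolding fun_upd_twist[OF ji] by (rule insert.prems[OF ext[OF g that] insertI2[OF j] d])
      then have "\<bar>\<Sum>c\<in>C. f (g(j := d, i := c)) - f (g(i := c))\<bar> \<le> (\<Sum>c\<in>C. 1)"
        by (intro order_trans[OF sum_abs] sum_mono)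
      then show ?thesis
        using n by (simp add: h_def n_def sum_subtractf flip: diff_divide_distrib)
    qed
    have inner: "(\<Sum>c\<in>C. \<Sum>d\<in>C. (f (g(i := c)) - f (g'(i := d)))\<^sup>2)
        \<le> n\<^sup>2 * (h g - h g')\<^sup>2 + 2 * n\<^sup>2" if g: "g \<in> ?P" "g' \<in> ?P" for g g'
    proof -
      let ?b = "h g - h g'"
      have "(\<Sum>c\<in>C. \<Sum>d\<in>C. (f (g(i := c)) - f (g'(i := d)))\<^sup>2)
          = (\<Sum>c\<in>C. \<Sum>d\<in>C. (\<alpha> g c)\<^sup>2 + (\<alpha> g' d)\<^sup>2 + ?b\<^sup>2 + 2 * ?b * \<alpha> g c - 2 * ?b * \<alpha> g' d - 2 * \<alpha> g c * \<alpha> g' d)"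
        by (intro sum.cong refl) (simp add: \<alpha>_def power2_eq_square algebra_simps)
      also have "\<dots> = n * (\<Sum>c\<in>C. (\<alpha> g c)\<^sup>2) + n * (\<Sum>d\<in>C. (\<alpha> g' d)\<^sup>2) + n\<^sup>2 * ?b\<^sup>2
          + 2 * ?b * n * (\<Sum>c\<in>C. \<alpha> g c) - 2 * ?b * n * (\<Sum>d\<in>C. \<alpha> g' d)
          - 2 * (\<Sum>c\<in>C. \<alpha> g c) * (\<Sum>d\<in>C. \<alpha> g' d)"
        by (simp add: sum.distrib sum_subtractf n_def sum_distrib_left sum_distrib_right
            power2_eq_square mult_ac)
      also have "\<dots> = n * (\<Sum>c\<in>C. (\<alpha> g c)\<^sup>2) + n * (\<Sum>d\<in>C. (\<alpha> g' d)\<^sup>2) + n\<^sup>2 * ?b\<^sup>2"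
        by (simp add: \<alpha>0)
      also have "\<dots> \<le> n * n + n * n + n\<^sup>2 * ?b\<^sup>2"
      proof -
        have "(\<Sum>c\<in>C. (\<alpha> g c)\<^sup>2) \<le> n" if "g \<in> ?P" for g
          using sum_mono[of C "\<lambda>c. (\<alpha> g c)\<^sup>2" "\<lambda>_. 1"] \<alpha>1 that by (simp add: n_def)
        then show ?thesis using g n by (intro add_mono mult_left_mono) auto
      qed
      finally show ?thesis by (simp add: power2_eq_square)
    qed
    have card: "real (card (insert i I \<rightarrow>\<^sub>E C)) = n * real (card ?P)"
      using insert.hyps by (simp add: card_PiE n_def)
    have "(\<Sum>x\<in>insert i I \<rightarrow>\<^sub>E C. \<Sum>y\<in>insert i I \<rightarrow>\<^sub>E C. (f x - f y)\<^sup>2)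
        = (\<Sum>g\<in>?P. \<Sum>g'\<in>?P. \<Sum>c\<in>C. \<Sum>d\<in>C. (f (g(i := c)) - f (g'(i := d)))\<^sup>2)"
      using insert.hyps by (simp add: sum_PiE_insert sum.swap[of _ C ?P])
    also have "\<dots> \<le> (\<Sum>g\<in>?P. \<Sum>g'\<in>?P. n\<^sup>2 * (h g - h g')\<^sup>2 + 2 * n\<^sup>2)"
      by (intro sum_mono inner)
    also have "\<dots> = n\<^sup>2 * (\<Sum>g\<in>?P. \<Sum>g'\<in>?P. (h g - h g')\<^sup>2) + 2 * n\<^sup>2 * (card ?P)\<^sup>2"
      by (simp add: sum.distrib sum_distrib_left power2_eq_square mult_ac)
    also have "\<dots> \<le> n\<^sup>2 * (2 * card I * (card ?P)\<^sup>2) + 2 * n\<^sup>2 * (card ?P)\<^sup>2"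
      using insert.IH[OF lip_h] by (intro add_mono mult_left_mono) auto
    also have "\<dots> = 2 * card (insert i I) * (card (insert i I \<rightarrow>\<^sub>E C))\<^sup>2"
      using insert.hyps by (simp add: card power_mult_distrib algebra_simps)
    finally show ?thesis .
  qed
qed

text \<open>
The distance to \<open>A\<close> vanishes on \<open>A\<close> and would exceed \<open>t\<close> on all of \<open>B\<close>, so the pairs in \<open>A \<times> B\<close> alone
would contribute at least \<open>\<delta>\<^sup>2 * t\<^sup>2\<close> to the mean square difference, against the variance bound.
\<close>

theorem dense_sets_hamming_close:
  fixes C :: "'c set" and t \<delta> :: real
  assumes I: "finite I" and C: "finite C" "C \<noteq> {}"
    and A: "A \<subseteq> I \<rightarrow>\<^sub>E C" "\<delta> * card (I \<rightarrow>\<^sub>E C) \<le> card A"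
    and B: "B \<subseteq> I \<rightarrow>\<^sub>E C" "\<delta> * card (I \<rightarrow>\<^sub>E C) \<le> card B"
    and \<delta>: "0 < \<delta>" and t: "0 \<le> t" "2 * card I < \<delta>\<^sup>2 * t\<^sup>2"
  shows "\<exists>a\<in>A. \<exists>b\<in>B. hamming I a b \<le> t"
proof (rule ccontr)
  assume far: "\<not> (\<exists>a\<in>A. \<exists>b\<in>B. hamming I a b \<le> t)"
  let ?P = "I \<rightarrow>\<^sub>E C"
  have finP: "finite ?P" using I C by (simp add: finite_PiE)
  have N: "card ?P > 0" using finP C by (simp add: card_gt_0_iff PiE_eq_empty_iff)
  have finA: "finite A" and finB: "finite B" using A(1) B(1) finP finite_subset by blast+
  have "0 < \<delta> * card ?P" using \<delta> N by simp
  then have Ane: "A \<noteq> {}" using A(2) by auto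
  define f where "f x = Min (hamming I x ` A)" for x
  have f_le: "f x \<le> hamming I x a" if "a \<in> A" for x a
    using that finA by (simp add: f_def)
  have f_ex: "\<exists>a\<in>A. f x = hamming I x a" for x
    using Min_in[of "hamming I x ` A"] finA Ane unfolding f_def by blast
  have ham_upd: "hamming I x y \<le> hamming I x' y + 1" if "\<And>j. j \<noteq> i \<Longrightarrow> x j = x' j" for x x' y :: "'a \<Rightarrow> 'c" and i
  proof -
    have "{j \<in> I. x j \<noteq> y j} \<subseteq> insert i {j \<in> I. x' j \<noteq> y j}" using that by auto
    then have "hamming I x y \<le> card (insert i {j \<in> I. x' j \<noteq> y j})"
      unfolding hamming_def using I by (intro card_mono) auto
    also have "\<dots> \<le> hamming I x' y + 1"
      unfolding hamming_def using I by (simp add: card_insert_if)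
    finally show ?thesis .
  qed
  have f_upd: "f x \<le> f x' + 1" if "\<And>j. j \<noteq> i \<Longrightarrow> x j = x' j" for x x' i
  proof -
    obtain a where a: "a \<in> A" "f x' = hamming I x' a" using f_ex by blast
    have "f x \<le> hamming I x a" using a(1) by (rule f_le)
    also have "\<dots> \<le> hamming I x' a + 1" using that by (rule ham_upd)
    finally show ?thesis using a by simp
  qed
  have lip: "\<bar>real (f (x(i := c))) - real (f x)\<bar> \<le> 1" for x i c
    using f_upd[of i "x(i := c)" x] f_upd[of i x "x(i := c)"] by simp
  have fA: "f a = 0" if "a \<in> A" for a
    using f_le[OF that, of a] by (simp add: hamming_def)
  have fB: "t < f b" if b: "b \<in> B" for b
  proof -
    obtain a where a: "a \<in> A" "f b = hamming I b a" using f_ex by blast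
    have "hamming I b a = hamming I a b" unfolding hamming_def by (rule arg_cong[of _ _ card]) auto
    then show ?thesis using a b far by force
  qed
  have "(\<delta> * card ?P) * (\<delta> * card ?P) \<le> real (card A) * real (card B)"
    using A(2) B(2) \<delta> by (intro mult_mono) auto
  then have "(\<delta> * card ?P)\<^sup>2 * t\<^sup>2 \<le> (card A * card B) * t\<^sup>2"
    by (intro mult_right_mono) (simp_all add: power2_eq_square)
  also have "\<dots> = (\<Sum>x\<in>A. \<Sum>y\<in>B. t\<^sup>2)" by simp
  also have "\<dots> \<le> (\<Sum>x\<in>A. \<Sum>y\<in>B. (real (f x) - real (f y))\<^sup>2)"
    using fA fB t(1) by (intro sum_mono) (simp add: power_mono less_imp_le)
  also have "\<dots> \<le> (\<Sum>x\<in>A. \<Sum>y\<in>?P. (real (f x) - real (f y))\<^sup>2)"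
    using B(1) finP by (intro sum_mono sum_mono2) auto
  also have "\<dots> \<le> (\<Sum>x\<in>?P. \<Sum>y\<in>?P. (real (f x) - real (f y))\<^sup>2)"
    using A(1) finP by (intro sum_mono2) (auto intro: sum_nonneg)
  also have "\<dots> \<le> 2 * card I * (card ?P)\<^sup>2"
    using sum_square_differences_le[OF I C(1), of "\<lambda>x. real (f x)"] lip by simp
  finally have "(\<delta>\<^sup>2 * t\<^sup>2) * (card ?P)\<^sup>2 \<le> (2 * card I) * (card ?P)\<^sup>2"
    by (simp add: power_mult_distrib mult_ac)
  then show False using N t(2) by simp
qed

section \<open>Recurrence in locally finite groups\<close>

locale locally_finite_group = comm_group G for G (structure) +
  fixes L :: "nat \<Rightarrow> 'a set"
  assumes L_subgroup: "subgroup (L m) G" and L_finite: "finite (L m)" and L_mono: "incseq L"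
    and L_cover: "(\<Union>m. L m) = carrier G" and L_infinite: "infinite (carrier G)"
begin

lemma L_closed: "x \<in> L m \<Longrightarrow> x \<in> carrier G"
  using L_cover by blast

lemma card_L_pos: "card (L m) > 0"
  using L_finite subgroup.one_closed[OF L_subgroup] by (auto simp: card_gt_0_iff)

lemma eventually_in_L: "g \<in> carrier G \<Longrightarrow> eventually (\<lambda>m. g \<in> L m) sequentially"
proof -
  assume "g \<in> carrier G"
  then obtain m where "g \<in> L m" using L_cover by blast
  then show ?thesis
    using incseqD[OF L_mono] unfolding eventually_sequentially by blast
qed

lemma countable_carrier: "countable (carrier G)"
  unfolding L_cover[symmetric] using L_finite by (intro countable_UN) (auto intro: countable_finite)

text \<open>
The finite counterpart of recurrence for sets of measure at least \<open>\<delta>\<close>: the group \<open>L m\<close> acts on itself,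
and returns are differences of elements of \<open>A\<close>.
\<close>

definition recurrent_in :: "nat \<Rightarrow> real \<Rightarrow> 'a set \<Rightarrow> bool" where
  "recurrent_in m \<delta> R \<longleftrightarrow>
     (\<forall>A\<subseteq>L m. \<delta> * card (L m) \<le> card A \<longrightarrow> (\<exists>a\<in>A. \<exists>b\<in>A. \<exists>g\<in>R. a = b \<otimes> g))"

text \<open>
Sets \<open>A k\<close> violating the claim in infinitely many of the groups yield processes \<open>P k\<close>, the random
translates of \<open>A k\<close>. A limit of their laws along a subsequence is stationary under the whole group,
since each \<open>g\<close> lies in almost all of the finite groups. The set of sequences with a \<open>1\<close> at \<open>\<one>\<close> then has
measure at least \<open>\<delta>\<close> but never returns to itself along \<open>R\<close>. This is the correspondence principle of
Furstenberg.
\<close>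

theorem eventually_recurrent_in:
  assumes R: "set_of_recurrence G R" "R \<subseteq> carrier G" and \<delta>: "0 < \<delta>"
  shows "eventually (\<lambda>m. recurrent_in m \<delta> R) sequentially"
proof (rule ccontr)
  assume "\<not> ?thesis"
  then have "\<exists>m\<ge>k. \<not> recurrent_in m \<delta> R" for k
    by (auto simp: eventually_sequentially)
  then obtain m where m: "\<And>k. m k \<ge> k" "\<And>k. \<not> recurrent_in (m k) \<delta> R" by metis
  then obtain A where A: "\<And>k. A k \<subseteq> L (m k)" "\<And>k. \<delta> * card (L (m k)) \<le> card (A k)"
    and noR: "\<And>k a b g. \<lbrakk>a \<in> A k; b \<in> A k; g \<in> R\<rbrakk> \<Longrightarrow> a \<noteq> b \<otimes> g"
    unfolding recurrent_in_def by metis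
  have ev: "eventually (\<lambda>k. g \<in> L (m k)) sequentially" if "g \<in> carrier G" for g
    using eventually_in_L[OF that] m(1) incseqD[OF L_mono]
    unfolding eventually_sequentially by (meson order_trans subsetD)
  define W where "W k U = {t \<in> L (m k). \<forall>u\<in>U. u \<otimes> t \<in> A k}" for k U
  define P where "P k U = real (card (W k U)) / real (card (L (m k)))" for k U
  let ?en = "from_nat_into (carrier G)"
  have "realizable (\<lambda>U. P k (?en ` U))" for k
  proof (rule realizableI[where N = "measure_pmf (pmf_of_set (L (m k)))" and E = "\<lambda>n. {t. ?en n \<otimes> t \<in> A k}"])
    have "L (m k) \<noteq> {}" using card_L_pos[of "m k"] by auto
    moreover have "L (m k) \<inter> {y. \<forall>n\<in>U. ?en n \<otimes> y \<in> A k} = W k (?en ` U)" for U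
      by (auto simp: W_def)
    ultimately show "measure_pmf.prob (pmf_of_set (L (m k)))
        {y \<in> space (measure_pmf (pmf_of_set (L (m k)))). \<forall>n\<in>U. y \<in> {t. ?en n \<otimes> t \<in> A k}} = P k (?en ` U)" for U
      by (simp add: measure_pmf_of_set L_finite P_def)
  qed (simp_all add: measure_pmf.prob_space_axioms)
  then obtain r p where r: "strict_mono (r :: nat \<Rightarrow> nat)" and p: "realizable (\<lambda>U. p (?en ` U))"
    and limp: "\<And>B. \<lbrakk>finite B; B \<subseteq> carrier G\<rbrakk> \<Longrightarrow> (\<lambda>k. P (r k) B) \<longlonglongrightarrow> p B"
    by (rule realizable_subsequence_on[OF countable_carrier L_infinite, of P]) blast
  have evr: "eventually (\<lambda>k. g \<in> L (m (r k))) sequentially" if "g \<in> carrier G" for g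
    using eventually_subseq[OF r ev[OF that]] .
  obtain M where M: "binary_law M (\<lambda>U. p (?en ` U))"
    using p unfolding realizable_def by blast
  have stat: "p ((\<lambda>u. u \<otimes> g) ` B) = p B" if g: "g \<in> carrier G" and B: "finite B" "B \<subseteq> carrier G" for g B
  proof (rule LIMSEQ_unique)
    have P_shift: "P k ((\<lambda>u. u \<otimes> g) ` B) = P k B" if gL: "g \<in> L (m k)" for k
    proof -
      interpret S: subgroup "L (m k)" G by (rule L_subgroup)
      have "bij_betw (\<lambda>t. g \<otimes> t) (W k ((\<lambda>u. u \<otimes> g) ` B)) (W k B)"
        using gL B(2) L_closed[of _ "m k"] S.m_closed S.m_inv_closed
        by (intro bij_betw_byWitness[where f' = "\<lambda>t. inv g \<otimes> t"])
          (auto simp: W_def m_assoc[symmetric] subset_iff, (simp add: m_assoc)+)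
      then show ?thesis by (simp add: P_def bij_betw_same_card)
    qed
    have "eventually (\<lambda>k. P (r k) B = P (r k) ((\<lambda>u. u \<otimes> g) ` B)) sequentially"
      using evr[OF g] by eventually_elim (simp add: P_shift)
    then show "(\<lambda>k. P (r k) B) \<longlonglongrightarrow> p ((\<lambda>u. u \<otimes> g) ` B)"
      using B g by (subst tendsto_cong) (auto intro!: limp)
  qed (rule limp[OF B])
  interpret stationary_law G M p
    by unfold_locales (use countable_carrier L_infinite M stat in auto)
  have "\<delta> \<le> p {\<one>}"
  proof (rule LIMSEQ_le_const[OF limp])
    have "\<delta> \<le> P k {\<one>}" for k
    proof -
      have "W k {\<one>} = A k" using A(1)[of k] L_closed by (force simp: W_def)
      then show ?thesis using A(2)[of k] card_L_pos[of "m k"] by (simp add: P_def divide_simps)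
    qed
    then show "\<exists>N. \<forall>n\<ge>N. \<delta> \<le> P (r n) {\<one>}" by blast
  qed auto
  then have "M.prob (ones_at {\<one>}) > 0" using \<delta> by (simp add: prob_ones_at)
  then obtain g where g: "g \<in> R" "M.prob (ones_at {\<one>} \<inter> shift g ` ones_at {\<one>}) > 0"
    using R(1) G_system_shift ones_at_sets unfolding set_of_recurrence_def by blast
  have gG: "g \<in> carrier G" using g R by blast
  have "ones_at {\<one>} \<inter> shift g ` ones_at {\<one>} = ones_at {\<one>, inv g}"
    using gG by (simp add: shift_image shift_vimage_ones_at) (simp add: ones_at_def Int_def conj_commute)
  then have "p {\<one>, inv g} > 0" using g gG by (simp add: prob_ones_at)
  moreover have "p {\<one>, inv g} = 0"
  proof (rule LIMSEQ_unique[OF limp])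
    have "W k {\<one>, inv g} = {}" for k
    proof -
      have False if "t \<in> W k {\<one>, inv g}" for t
      proof -
        have t: "t \<in> carrier G" "t \<in> A k" "inv g \<otimes> t \<in> A k"
          using that L_closed by (auto simp: W_def)
        then have "t = (inv g \<otimes> t) \<otimes> g" using gG by (simp add: m_comm m_assoc[symmetric])
        then show False using noR[OF t(2,3) g(1)] by simp
      qed
      then show ?thesis by blast
    qed
    then show "(\<lambda>k. P (r k) {\<one>, inv g}) \<longlonglongrightarrow> 0" by (simp add: P_def)
  qed (use gG in auto)
  ultimately show False by simp
qed

text \<open>
If no return along \<open>R\<close> had positive measure, then almost every point would visit \<open>D\<close> only along a set of
times in \<open>L m\<close> without differences in \<open>R\<close>, hence fewer than \<open>\<delta> * card (L m)\<close> times. But the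
mean number of visits is \<open>card (L m) * measure M D\<close>.
\<close>

theorem recurrent_in_imp_recurrence:
  fixes M :: "'x measure"
  assumes R: "recurrent_in m \<delta> R" "R \<subseteq> carrier G"
    and sys: "G_system G M T" and D: "D \<in> sets M" "\<delta> \<le> measure M D"
  shows "\<exists>g\<in>R. measure M (D \<inter> T g ` D) > 0"
proof (rule ccontr)
  assume none: "\<not> ?thesis"
  have zero: "measure M (D \<inter> T g ` D) = 0" if "g \<in> R" for g
  proof -
    have "\<not> 0 < measure M (D \<inter> T g ` D)" using none that by blast
    then show ?thesis using measure_nonneg[of M "D \<inter> T g ` D"] by linarith
  qed
  interpret G_system G M T by fact
  have bij: "bij_betw (T g) (space M) (space M)" if "g \<in> carrier G" for g
    using bij_prop0[OF that] by (simp add: Bij_def)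
  have Tin: "T g x \<in> space M" if "g \<in> carrier G" "x \<in> space M" for g x
    using bij[OF that(1)] that(2) by (auto simp: bij_betw_def)
  have Tmult: "T (g \<otimes> h) x = T g (T h x)"
    if "g \<in> carrier G" "h \<in> carrier G" "x \<in> space M" for g h x
    using composition_rule[OF that(3,1,2)] by simp
  have Tone: "T \<one> x = x" if "x \<in> space M" for x
    using that id_eq_one by (metis restrict_apply')
  have Tinv: "T (inv g) (T g x) = x" if "g \<in> carrier G" "x \<in> space M" for g x
    using that Tmult[of "inv g" g x] Tone by auto
  have Dsp: "D \<subseteq> space M" using D(1) sets.sets_into_space by blast
  have meas: "{x \<in> space M. T g x \<in> D} \<in> sets M" if "g \<in> carrier G" for g
    using measurable_sets[OF measurable_T[OF that] D(1)] by (simp add: vimage_def Int_def conj_commute)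
  have img: "T (inv g) ` E = {x \<in> space M. T g x \<in> E}" if "g \<in> carrier G" "E \<subseteq> space M" for g E
    using that Tinv[of g] Tinv[of "inv g"] Tin[of "inv g"] by (force simp: image_iff subset_iff)
  have prob_visit: "prob {x \<in> space M. T g x \<in> D} = prob D" if "g \<in> carrier G" for g
    using preserves_T[of "inv g" D] that D img[of g D] Dsp by simp
  interpret S: subgroup "L m" G by (rule L_subgroup)
  have null: "AE x in M. \<not> (T (b \<otimes> g) x \<in> D \<and> T b x \<in> D)"
    if b: "b \<in> L m" and g: "g \<in> R" for b g
  proof -
    have bG: "b \<in> carrier G" and gG: "g \<in> carrier G" using b g R L_closed by auto
    let ?E = "D \<inter> T g ` D"
    have "T g ` D = {x \<in> space M. T (inv g) x \<in> D}"
      using img[of "inv g" D] gG Dsp by simp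
    then have E: "?E \<in> sets M" using meas[of "inv g"] gG D by auto
    have "{x \<in> space M. T (b \<otimes> g) x \<in> D \<and> T b x \<in> D} = T (inv (b \<otimes> g)) ` ?E"
    proof -
      have "T b x \<in> D \<longleftrightarrow> T (b \<otimes> g) x \<in> T g ` D" if x: "x \<in> space M" for x
      proof -
        have "T (b \<otimes> g) x = T g (T b x)" using Tmult[of g b x] bG gG x by (simp add: m_comm)
        moreover have "inj_on (T g) (space M)" using bij[OF gG] by (simp add: bij_betw_def)
        ultimately show ?thesis using Dsp Tin[OF bG x] by (auto simp: inj_on_def)
      qed
      moreover have "T (inv (b \<otimes> g)) ` ?E = {x \<in> space M. T (b \<otimes> g) x \<in> ?E}"
        using Dsp bG gG by (intro img) auto
      ultimately show ?thesis by blast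
    qed
    moreover have "prob (T (inv (b \<otimes> g)) ` ?E) = prob ?E"
      using bG gG E by (intro preserves_T) auto
    ultimately have "prob {x \<in> space M. T (b \<otimes> g) x \<in> D \<and> T b x \<in> D} = 0"
      using zero[OF g] by simp
    moreover have "{x \<in> space M. T (b \<otimes> g) x \<in> D \<and> T b x \<in> D} \<in> sets M"
    proof -
      have "{x \<in> space M. T (b \<otimes> g) x \<in> D \<and> T b x \<in> D} = {x \<in> space M. T (b \<otimes> g) x \<in> D} \<inter> {x \<in> space M. T b x \<in> D}"
        by blast
      then show ?thesis using meas[of "b \<otimes> g"] meas[of b] bG gG by auto
    qed
    ultimately show ?thesis
      by (intro AE_I[of _ _ "{x \<in> space M. T (b \<otimes> g) x \<in> D \<and> T b x \<in> D}"]) (auto simp: emeasure_eq_measure)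
  qed
  have "AE x in M. \<forall>(b, a)\<in>L m \<times> L m. \<forall>g\<in>R. a = b \<otimes> g \<longrightarrow> \<not> (T a x \<in> D \<and> T b x \<in> D)"
  proof (rule AE_finite_allI)
    show "finite (L m \<times> L m)" using L_finite by simp
    fix ba assume "ba \<in> L m \<times> L m"
    then obtain b a where ba: "ba = (b, a)" "b \<in> L m" "a \<in> L m" by blast
    show "AE x in M. case ba of (b, a) \<Rightarrow> \<forall>g\<in>R. a = b \<otimes> g \<longrightarrow> \<not> (T a x \<in> D \<and> T b x \<in> D)"
    proof (cases "\<exists>g\<in>R. a = b \<otimes> g")
      case True
      then obtain g where "g \<in> R" "a = b \<otimes> g" by blast
      with null[OF ba(2), of g] show ?thesis unfolding ba by (auto elim: eventually_mono)
    qed (auto simp: ba)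
  qed
  then have few: "AE x in M. (\<Sum>t\<in>L m. indicator {x \<in> space M. T t x \<in> D} x) < \<delta> * card (L m)"
  proof (rule AE_mp, intro AE_I2 impI)
    fix x assume x: "x \<in> space M"
      and *: "\<forall>(b, a)\<in>L m \<times> L m. \<forall>g\<in>R. a = b \<otimes> g \<longrightarrow> \<not> (T a x \<in> D \<and> T b x \<in> D)"
    let ?A = "{t \<in> L m. T t x \<in> D}"
    have "\<not> \<delta> * card (L m) \<le> card ?A"
    proof
      assume "\<delta> * card (L m) \<le> card ?A"
      moreover have "?A \<subseteq> L m" by blast
      ultimately have "\<exists>a\<in>?A. \<exists>b\<in>?A. \<exists>g\<in>R. a = b \<otimes> g"
        using R(1)[unfolded recurrent_in_def, THEN spec, of ?A] by simp
      then obtain a b g where ab: "a \<in> ?A" "b \<in> ?A" "g \<in> R" "a = b \<otimes> g" by blast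
      with bspec[OF *, of "(b, a)"] show False by auto
    qed
    moreover have "(\<Sum>t\<in>L m. indicator {x \<in> space M. T t x \<in> D} x) = real (card ?A)"
      using x L_finite by (simp add: indicator_def of_bool_def flip: sum.inter_filter)
    ultimately show "(\<Sum>t\<in>L m. indicator {x \<in> space M. T t x \<in> D} x) < \<delta> * card (L m)" by simp
  qed
  have int: "integrable M (\<lambda>x. \<Sum>t\<in>L m. indicat_real {x \<in> space M. T t x \<in> D} x)"
    using meas L_closed by (intro Bochner_Integration.integrable_sum integrable_real_indicator)
      (auto simp: emeasure_eq_measure)
  have lt: "(\<integral>x. (\<Sum>t\<in>L m. indicat_real {x \<in> space M. T t x \<in> D} x) \<partial>M) < (\<integral>x. \<delta> * card (L m) \<partial>M)"
    using int few by (intro integral_less_AE_space) (auto simp: emeasure_space_1)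
  have e1: "(\<integral>x. (\<Sum>t\<in>L m. indicat_real {x \<in> space M. T t x \<in> D} x) \<partial>M) = (\<Sum>t\<in>L m. prob D)"
    using meas L_closed
    by (subst Bochner_Integration.integral_sum)
      (auto simp: emeasure_eq_measure prob_visit intro!: sum.cong integrable_real_indicator)
  have e2: "(\<integral>x. \<delta> * card (L m) \<partial>M) = \<delta> * card (L m)"
    by (simp add: prob_space)
  have "card (L m) * prob D < \<delta> * card (L m)"
    using lt unfolding e1 e2 by simp
  then show False using D(2) card_L_pos[of m] by (simp add: mult.commute)
qed

end

section \<open>Coordinates in the group\<close>

locale bounded_torsion_group =
  fixes F :: "('f, 'm) monoid_scheme" and r :: nat and q :: "nat \<Rightarrow> nat"
  assumes F: "comm_group F" "finite (carrier F)" and r: "r \<ge> 1"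
    and q: "i \<in> {1..r} \<Longrightarrow> q i \<ge> 2"
begin

abbreviation "G \<equiv> ambient_group F r q"
definition "I = {1..r}"

lemma finite_I [simp]: "finite I" and one_in_I: "1 \<in> I" and q_ge_2: "i \<in> I \<Longrightarrow> int (q i) \<ge> 2"
  using r q by (force simp: I_def)+

text \<open>
The entry in summand \<open>i\<close> at coordinate \<open>j\<close>; it is meaningful for \<open>i \<in> I\<close> only, as elements of the direct
sum are undefined at other summands.
\<close>

definition coord :: "'f \<times> (nat \<Rightarrow> nat \<Rightarrow> int) \<Rightarrow> nat \<Rightarrow> nat \<Rightarrow> int" where
  "coord g = snd g"

definition L :: "nat \<Rightarrow> ('f \<times> (nat \<Rightarrow> nat \<Rightarrow> int)) set" where
  "L m = {g \<in> carrier G. \<forall>i\<in>I. \<forall>j\<ge>m. coord g i j = 0}"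

definition element :: "'f \<Rightarrow> (nat \<Rightarrow> nat \<Rightarrow> int) \<Rightarrow> 'f \<times> (nat \<Rightarrow> nat \<Rightarrow> int)" where
  "element f x = (f, \<lambda>i\<in>I. x i)"

lemma fst_element [simp]: "fst (element f x) = f"
  and coord_element [simp]: "i \<in> I \<Longrightarrow> coord (element f x) i j = x i j"
  by (simp_all add: element_def coord_def)

lemma carrier_Sigma_group:
  assumes "n \<ge> 2"
  shows "carrier (Sigma_group n) = {x. (\<forall>j. x j \<in> {0..<int n}) \<and> finite {j. x j \<noteq> 0}}"
  using assms by (auto simp: Sigma_group_def carrier_sum_group carrier_integer_mod_group PiE_iff)

text \<open>
The direct sums bound the support in each summand separately; there being finitely many summands, one
bound serves all of them.
\<close>

lemma finite_support_iff:
  fixes x :: "nat \<Rightarrow> nat \<Rightarrow> int"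
  shows "(\<forall>i\<in>I. finite {j. x i j \<noteq> 0}) \<longleftrightarrow> (\<exists>m. \<forall>i\<in>I. \<forall>j\<ge>m. x i j = 0)"
proof
  assume "\<forall>i\<in>I. finite {j. x i j \<noteq> 0}"
  then have "finite (\<Union>i\<in>I. {j. x i j \<noteq> 0})" by auto
  then obtain m where "(\<Union>i\<in>I. {j. x i j \<noteq> 0}) \<subseteq> {..<m}" by (meson finite_nat_bounded)
  then have "\<forall>i\<in>I. \<forall>j\<ge>m. x i j = 0" by (force simp: subset_iff)
  then show "\<exists>m. \<forall>i\<in>I. \<forall>j\<ge>m. x i j = 0" by blast
next
  assume "\<exists>m. \<forall>i\<in>I. \<forall>j\<ge>m. x i j = 0"
  then obtain m where m: "\<forall>i\<in>I. \<forall>j\<ge>m. x i j = 0" by blast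
  then have "{j. x i j \<noteq> 0} \<subseteq> {..<m}" if "i \<in> I" for i
    using that by (force simp: not_le[symmetric])
  then show "\<forall>i\<in>I. finite {j. x i j \<noteq> 0}" by (meson finite_lessThan finite_subset)
qed

lemma carrier_Sigma_sum:
  "carrier (Sigma_sum r q) = {x \<in> extensional I. (\<forall>i\<in>I. \<forall>j. x i j \<in> {0..<int (q i)}) \<and>
     (\<exists>m. \<forall>i\<in>I. \<forall>j\<ge>m. x i j = 0)}"
proof -
  have "carrier (Sigma_sum r q) = (\<Pi>\<^sub>E i\<in>I. carrier (Sigma_group (q i)))"
    unfolding Sigma_sum_def I_def
    by (subst carrier_sum_group) (auto intro: comm_group.axioms(2)[OF Sigma_group_props(1)])
  also have "\<dots> = {x \<in> extensional I. (\<forall>i\<in>I. \<forall>j. x i j \<in> {0..<int (q i)}) \<and> (\<forall>i\<in>I. finite {j. x i j \<noteq> 0})}"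
    using q_ge_2 by (auto simp: PiE_def Pi_def carrier_Sigma_group)
  finally show ?thesis by (simp only: finite_support_iff)
qed

lemma carrier_G: "g \<in> carrier G \<longleftrightarrow> fst g \<in> carrier F \<and> snd g \<in> extensional I \<and>
    (\<forall>i\<in>I. \<forall>j. coord g i j \<in> {0..<int (q i)}) \<and> (\<exists>m. \<forall>i\<in>I. \<forall>j\<ge>m. coord g i j = 0)"
  by (cases g) (auto simp: ambient_group_def carrier_Sigma_sum coord_def)

lemma fst_mult [simp]: "fst (g \<otimes>\<^bsub>G\<^esub> h) = fst g \<otimes>\<^bsub>F\<^esub> fst h"
  by (cases g; cases h) (simp add: ambient_group_def)

lemma coord_mult: "i \<in> I \<Longrightarrow> coord (g \<otimes>\<^bsub>G\<^esub> h) i j = (coord g i j + coord h i j) mod int (q i)"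
  by (cases g; cases h) (simp add: ambient_group_def Sigma_sum_def Sigma_group_def coord_def I_def)

lemma fst_one [simp]: "fst \<one>\<^bsub>G\<^esub> = \<one>\<^bsub>F\<^esub>"
  by (simp add: ambient_group_def)

lemma coord_one [simp]: "i \<in> I \<Longrightarrow> coord \<one>\<^bsub>G\<^esub> i j = 0"
  by (simp add: ambient_group_def Sigma_sum_def Sigma_group_def coord_def I_def)

lemma coord_bounds: "g \<in> carrier G \<Longrightarrow> i \<in> I \<Longrightarrow> 0 \<le> coord g i j \<and> coord g i j < int (q i)"
  by (simp add: carrier_G)

lemma coord_mod [simp]: "g \<in> carrier G \<Longrightarrow> i \<in> I \<Longrightarrow> coord g i j mod int (q i) = coord g i j"
  by (simp add: carrier_G)

lemma G_eqI:
  assumes "g \<in> carrier G" "h \<in> carrier G" "fst g = fst h" "\<And>i j. i \<in> I \<Longrightarrow> coord g i j = coord h i j"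
  shows "g = h"
proof (rule prod_eqI)
  show "snd g = snd h"
    by (rule extensionalityI[of _ I]) (use assms in \<open>auto simp: carrier_G coord_def\<close>)
qed fact

sublocale G: comm_group G
  using F by (rule ambient_group_props)

interpretation FF: comm_group F by (rule F)

lemma coord_diff:
  assumes "x = y \<otimes>\<^bsub>G\<^esub> w" "y \<in> carrier G" "w \<in> carrier G" "i \<in> I"
  shows "coord w i j = (coord x i j - coord y i j) mod int (q i)"
  using assms by (simp add: coord_mult mod_diff_left_eq)

lemma coord_inv:
  assumes "g \<in> carrier G" "i \<in> I"
  shows "coord (inv\<^bsub>G\<^esub> g) i j = (- coord g i j) mod int (q i)"
  using assms coord_diff[of "\<one>\<^bsub>G\<^esub>" g "inv\<^bsub>G\<^esub> g" i j] by simp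

lemma element_closed:
  assumes "f \<in> carrier F" "\<And>i j. i \<in> I \<Longrightarrow> x i j \<in> {0..<int (q i)}"
    "\<And>i j. i \<in> I \<Longrightarrow> j \<ge> m \<Longrightarrow> x i j = 0"
  shows "element f x \<in> L m" "element f x \<in> carrier G"
proof -
  show "element f x \<in> carrier G"
    unfolding carrier_G using assms(1,2) assms(3)
    by (intro conjI exI[of _ m]) (auto simp: element_def coord_def)
  then show "element f x \<in> L m" using assms by (simp add: L_def)
qed

lemma L_carrier: "g \<in> L m \<Longrightarrow> g \<in> carrier G"
  by (simp add: L_def)

lemma finite_L: "finite (L m)"
proof -
  let ?c = "\<lambda>g. (fst g, \<lambda>i\<in>I. \<lambda>j\<in>{..<m}. coord g i j)"
  have "inj_on ?c (L m)"
  proof (rule inj_onI)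
    fix g h assume gh: "g \<in> L m" "h \<in> L m" and eq: "?c g = ?c h"
    have "coord g i j = coord h i j" if i: "i \<in> I" for i j
    proof (cases "j < m")
      case True
      have "(\<lambda>i\<in>I. \<lambda>j\<in>{..<m}. coord g i j) i j = (\<lambda>i\<in>I. \<lambda>j\<in>{..<m}. coord h i j) i j"
        using eq by simp
      then show ?thesis using i True by simp
    qed (use gh i in \<open>simp add: L_def\<close>)
    then show "g = h" using gh eq L_carrier by (intro G_eqI) auto
  qed
  moreover have "?c ` L m \<subseteq> carrier F \<times> (\<Pi>\<^sub>E i\<in>I. \<Pi>\<^sub>E j\<in>{..<m}. {0..<int (q i)})"
  proof (rule image_subsetI)
    fix g assume "g \<in> L m"
    then have "fst g \<in> carrier F" "\<And>i j. i \<in> I \<Longrightarrow> coord g i j \<in> {0..<int (q i)}"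
      using L_carrier[of g m] by (auto simp: carrier_G)
    then show "?c g \<in> carrier F \<times> (\<Pi>\<^sub>E i\<in>I. \<Pi>\<^sub>E j\<in>{..<m}. {0..<int (q i)})"
      by (simp add: restrict_PiE_iff)
  qed
  moreover have "finite (carrier F \<times> (\<Pi>\<^sub>E i\<in>I. \<Pi>\<^sub>E j\<in>{..<m}. {0..<int (q i)}))"
    using F(2) by (intro finite_cartesian_product finite_PiE) auto
  ultimately show ?thesis by (meson finite_imageD finite_subset)
qed

definition basis :: "nat \<Rightarrow> 'f \<times> (nat \<Rightarrow> nat \<Rightarrow> int)" where
  "basis k = element \<one>\<^bsub>F\<^esub> (\<lambda>i j. if j = k then 1 else 0)"

lemma basis_closed: "basis k \<in> L (Suc k)" "basis k \<in> carrier G"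
  unfolding basis_def using q_ge_2 by (intro element_closed[where m = "Suc k"]; force)+

lemma coord_basis [simp]: "i \<in> I \<Longrightarrow> coord (basis k) i j = (if j = k then 1 else 0)"
  by (simp add: basis_def)

lemma L_subgroup: "subgroup (L m) G"
proof
  show "x \<otimes>\<^bsub>G\<^esub> y \<in> L m" if "x \<in> L m" "y \<in> L m" for x y
    using that by (auto simp: L_def coord_mult)
  show "inv\<^bsub>G\<^esub> x \<in> L m" if "x \<in> L m" for x
    using that by (auto simp: L_def coord_inv)
qed (auto simp: L_def)

lemma infinite_carrier: "infinite (carrier G)"
proof -
  have "inj basis"
  proof (rule injI)
    fix k l assume "basis k = basis l"
    then have "coord (basis k) 1 k = coord (basis l) 1 k" by simp
    then show "k = l" using one_in_I by (simp split: if_splits)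
  qed
  then have inf: "infinite (range basis)" by (rule range_inj_infinite)
  have "range basis \<subseteq> carrier G" using basis_closed(2) by (rule image_subsetI)
  then show ?thesis using inf by (rule infinite_super)
qed

sublocale G: locally_finite_group G L
proof (intro locally_finite_group.intro locally_finite_group_axioms.intro)
  show "comm_group G" by (rule G.comm_group_axioms)
  show "subgroup (L m) G" "finite (L m)" for m by (rule L_subgroup, rule finite_L)
  show "incseq L" by (auto simp: incseq_def L_def)
  have "\<exists>m. g \<in> L m" if "g \<in> carrier G" for g
  proof -
    obtain m where "\<forall>i\<in>I. \<forall>j\<ge>m. coord g i j = 0" using \<open>g \<in> carrier G\<close> carrier_G by blast
    then show ?thesis using that by (auto simp: L_def)
  qed
  then show "(\<Union>m. L m) = carrier G" using L_carrier by blast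
  show "infinite (carrier G)" by (rule infinite_carrier)
qed

abbreviation "H \<equiv> Sigma_part F r q"

lemma H_iff: "h \<in> H \<longleftrightarrow> h \<in> carrier G \<and> fst h = \<one>\<^bsub>F\<^esub>"
  by (cases h) (auto simp: Sigma_part_def ambient_group_def FF.one_closed)

lemma H_closed: "x \<in> H \<Longrightarrow> y \<in> H \<Longrightarrow> x \<otimes>\<^bsub>G\<^esub> y \<in> H" "x \<in> H \<Longrightarrow> inv\<^bsub>G\<^esub> x \<in> H"
proof -
  show "x \<in> H \<Longrightarrow> y \<in> H \<Longrightarrow> x \<otimes>\<^bsub>G\<^esub> y \<in> H" by (auto simp: H_iff)
  assume x: "x \<in> H"
  have "fst x \<otimes>\<^bsub>F\<^esub> fst (inv\<^bsub>G\<^esub> x) = fst (x \<otimes>\<^bsub>G\<^esub> inv\<^bsub>G\<^esub> x)" by (rule fst_mult[symmetric])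
  also have "\<dots> = \<one>\<^bsub>F\<^esub>" using x by (simp add: H_iff del: fst_mult)
  finally have "fst x \<otimes>\<^bsub>F\<^esub> fst (inv\<^bsub>G\<^esub> x) = \<one>\<^bsub>F\<^esub>" .
  moreover have "fst (inv\<^bsub>G\<^esub> x) \<in> carrier F" "inv\<^bsub>G\<^esub> x \<in> carrier G"
    using x G.inv_closed[of x] by (auto simp: H_iff carrier_G)
  ultimately show "inv\<^bsub>G\<^esub> x \<in> H"
    using x FF.l_one[of "fst (inv\<^bsub>G\<^esub> x)"] by (simp add: H_iff)
qed

end

section \<open>Finite stages with prescribed blocks\<close>

context bounded_torsion_group
begin

interpretation FF: comm_group F by (rule F)

definition recurrent_translates :: "('f \<times> (nat \<Rightarrow> nat \<Rightarrow> int)) set \<Rightarrow> bool" where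
  "recurrent_translates S \<longleftrightarrow> S \<subseteq> carrier G \<and> (\<forall>h\<in>H. set_of_recurrence G ((\<lambda>s. s \<otimes>\<^bsub>G\<^esub> h) ` S))"

definition near_ones :: "nat \<Rightarrow> nat \<Rightarrow> real \<Rightarrow> ('f \<times> (nat \<Rightarrow> nat \<Rightarrow> int)) set" where
  "near_ones N d \<epsilon> = {g \<in> H. (\<forall>i\<in>I. \<forall>j\<le>N. coord g i j = 0) \<and>
     card {k \<in> {1..d}. \<exists>i\<in>I. coord g i (N + k) \<noteq> 1} \<le> \<epsilon> * real d}"

text \<open>
The block of coordinates \<open>N + 1, \<dots>, N + d\<close> is overwritten by \<open>c\<close>. An entry \<open>c k\<close> of the block lists the
values in all summands at coordinate \<open>N + k\<close>, so that blocks are words over one finite alphabet.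
\<close>

definition fill :: "nat \<Rightarrow> nat \<Rightarrow> (nat \<Rightarrow> nat \<Rightarrow> int) \<Rightarrow> 'f \<times> (nat \<Rightarrow> nat \<Rightarrow> int) \<Rightarrow> 'f \<times> (nat \<Rightarrow> nat \<Rightarrow> int)" where
  "fill N d c g = element (fst g) (\<lambda>i j. if j \<in> {N<..N + d} then c (j - N) i else coord g i j)"

abbreviation "residues \<equiv> \<Pi>\<^sub>E i\<in>I. {0..<int (q i)}"
abbreviation blocks :: "nat \<Rightarrow> (nat \<Rightarrow> nat \<Rightarrow> int) set" where
  "blocks d \<equiv> {1..d} \<rightarrow>\<^sub>E residues"

lemma fst_fill [simp]: "fst (fill N d c g) = fst g"
  by (simp add: fill_def)

lemma coord_fill: "i \<in> I \<Longrightarrow>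
  coord (fill N d c g) i j = (if j \<in> {N<..N + d} then c (j - N) i else coord g i j)"
  by (simp add: fill_def)

lemma block_entry:
  assumes "c \<in> blocks d" "i \<in> I" "j \<in> {N<..N + d}"
  shows "c (j - N) i \<in> {0..<int (q i)}"
proof -
  have "j - N \<in> {1..d}"
    using assms(3) unfolding greaterThanAtMost_iff atLeastAtMost_iff by arith
  then have "c (j - N) \<in> residues" by (rule PiE_mem[OF assms(1)])
  then show ?thesis using assms(2) by (rule PiE_mem)
qed

lemma fill_closed:
  assumes "c \<in> blocks d" "g \<in> L m" "N + d < m"
  shows "fill N d c g \<in> L m"
  unfolding fill_def
proof (rule element_closed(1))
  show "fst g \<in> carrier F" using assms(2) L_carrier carrier_G by blast
  show "(if j \<in> {N<..N + d} then c (j - N) i else coord g i j) \<in> {0..<int (q i)}" if "i \<in> I" for i j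
    using block_entry[OF assms(1) that] coord_bounds[OF L_carrier[OF assms(2)] that] by auto
  show "(if j \<in> {N<..N + d} then c (j - N) i else coord g i j) = 0" if "i \<in> I" "m \<le> j" for i j
    using that assms by (auto simp: L_def)
qed

definition frames :: "nat \<Rightarrow> nat \<Rightarrow> nat \<Rightarrow> ('f \<times> (nat \<Rightarrow> nat \<Rightarrow> int)) set" where
  "frames N d m = {g \<in> L m. \<forall>i\<in>I. \<forall>j\<in>{N<..N + d}. coord g i j = 0}"

lemma bij_betw_fill:
  assumes "N + d < m"
  shows "bij_betw (\<lambda>(g, c). fill N d c g) (frames N d m \<times> blocks d) (L m)"
proof (rule bij_betwI[where g = "\<lambda>g. (fill N d (\<lambda>k i. 0) g, \<lambda>k\<in>{1..d}. \<lambda>i\<in>I. coord g i (N + k))"])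
  show "(\<lambda>(g, c). fill N d c g) \<in> frames N d m \<times> blocks d \<rightarrow> L m"
    using fill_closed assms by (auto simp: frames_def)
  have fill0: "fill N d (\<lambda>k i. 0) g \<in> frames N d m" if g: "g \<in> L m" for g
  proof -
    have "fill N d (\<lambda>k i. 0) g \<in> L m"
      unfolding fill_def
    proof (rule element_closed(1))
      show "fst g \<in> carrier F" using g L_carrier carrier_G by blast
      show "(if j \<in> {N<..N + d} then 0 else coord g i j) \<in> {0..<int (q i)}" if "i \<in> I" for i j
        using coord_bounds[OF L_carrier[OF g] that, of j] q_ge_2[OF that] by auto
      show "(if j \<in> {N<..N + d} then 0 else coord g i j) = 0" if "i \<in> I" "m \<le> j" for i j
        using that g by (auto simp: L_def)
    qed
    then show ?thesis by (simp add: frames_def coord_fill)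
  qed
  have block: "(\<lambda>k\<in>{1..d}. \<lambda>i\<in>I. coord g i (N + k)) \<in> blocks d" if "g \<in> L m" for g
    using coord_bounds[OF L_carrier[OF that]] by (simp add: restrict_PiE_iff)
  show "(\<lambda>g. (fill N d (\<lambda>k i. 0) g, \<lambda>k\<in>{1..d}. \<lambda>i\<in>I. coord g i (N + k))) \<in> L m \<rightarrow> frames N d m \<times> blocks d"
    using fill0 block by auto
  show "(\<lambda>g. (fill N d (\<lambda>k i. 0) g, \<lambda>k\<in>{1..d}. \<lambda>i\<in>I. coord g i (N + k))) ((\<lambda>(g, c). fill N d c g) x) = x"
    if x: "x \<in> frames N d m \<times> blocks d" for x
  proof -
    obtain g c where gc: "x = (g, c)" "g \<in> frames N d m" "c \<in> blocks d" using x by blast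
    have g: "g \<in> L m" using gc by (simp add: frames_def)
    have "fill N d (\<lambda>k i. 0) (fill N d c g) = g"
    proof (rule G_eqI)
      show "fill N d (\<lambda>k i. 0) (fill N d c g) \<in> carrier G"
        using fill0[OF fill_closed[OF gc(3) g assms]] by (auto simp: frames_def intro: L_carrier)
      show "coord (fill N d (\<lambda>k i. 0) (fill N d c g)) i j = coord g i j" if "i \<in> I" for i j
        using that gc(2) by (simp add: coord_fill frames_def)
    qed (use g L_carrier in auto)
    moreover have "(\<lambda>k\<in>{1..d}. \<lambda>i\<in>I. coord (fill N d c g) i (N + k)) = c"
    proof (rule PiE_ext[OF block[OF fill_closed[OF gc(3) g assms]] gc(3)])
      fix k assume k: "k \<in> {1..d}"
      show "(\<lambda>k\<in>{1..d}. \<lambda>i\<in>I. coord (fill N d c g) i (N + k)) k = c k"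
      proof (rule extensionalityI[of _ I])
        show "c k \<in> extensional I" using PiE_mem[OF gc(3) k] by (auto simp: PiE_def)
      qed (use k in \<open>auto simp: coord_fill\<close>)
    qed
    ultimately show ?thesis by (simp add: gc)
  qed
  show "(\<lambda>(g, c). fill N d c g) ((\<lambda>g. (fill N d (\<lambda>k i. 0) g, \<lambda>k\<in>{1..d}. \<lambda>i\<in>I. coord g i (N + k))) y) = y"
    if y: "y \<in> L m" for y
  proof -
    have "fill N d (\<lambda>k\<in>{1..d}. \<lambda>i\<in>I. coord y i (N + k)) (fill N d (\<lambda>k i. 0) y) = y"
    proof (rule G_eqI)
      have "fill N d (\<lambda>k i. 0) y \<in> L m" using fill0[OF y] by (simp add: frames_def)
      then show "fill N d (\<lambda>k\<in>{1..d}. \<lambda>i\<in>I. coord y i (N + k)) (fill N d (\<lambda>k i. 0) y) \<in> carrier G"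
        by (intro L_carrier[OF fill_closed[OF block[OF y] _ assms]])
      show "coord (fill N d (\<lambda>k\<in>{1..d}. \<lambda>i\<in>I. coord y i (N + k)) (fill N d (\<lambda>k i. 0) y)) i j = coord y i j"
        if "i \<in> I" for i j
        using that by (auto simp: coord_fill)
    qed (use y L_carrier in auto)
    then show ?thesis by simp
  qed
qed

lemma fill_difference:
  assumes "x = fill N d a g" "y = fill N d b g'" "x = y \<otimes>\<^bsub>G\<^esub> w"
    and "x \<in> carrier G" "y \<in> carrier G" "w \<in> carrier G" "i \<in> I"
  shows "coord w i j = (if j \<in> {N<..N + d} then (a (j - N) i - b (j - N) i) mod int (q i)
      else (coord g i j - coord g' i j) mod int (q i))"
  using coord_diff[OF assms(3,5,6,7)] assms(1,2,7) by (simp add: coord_fill)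

lemma successor_block:
  fixes d :: nat
  defines "\<tau> \<equiv> \<lambda>c. \<lambda>k\<in>{1..d}. \<lambda>i\<in>I. (c k i + 1) mod int (q i)"
  shows "\<tau> ` blocks d \<subseteq> blocks d" "inj_on \<tau> (blocks d)"
proof -
  have qpos: "int (q i) > 0" if "i \<in> I" for i using q_ge_2[OF that] by simp
  show "\<tau> ` blocks d \<subseteq> blocks d"
    unfolding \<tau>_def using qpos by (intro image_subsetI) (simp add: restrict_PiE_iff)
  show "inj_on \<tau> (blocks d)"
  proof (rule inj_onI)
    fix a b assume a: "a \<in> blocks d" and b: "b \<in> blocks d" and eq: "\<tau> a = \<tau> b"
    show "a = b"
    proof (rule PiE_ext[OF a b])
      fix k assume k: "k \<in> {1..d}"
      show "a k = b k"
      proof (rule PiE_ext[OF PiE_mem[OF a k] PiE_mem[OF b k]])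
        fix i assume i: "i \<in> I"
        have "(a k i + 1) mod int (q i) = (b k i + 1) mod int (q i)"
          using fun_cong[OF fun_cong[OF eq, of k], of i] k i by (simp add: \<tau>_def)
        then have "(a k i + 1 - 1) mod int (q i) = (b k i + 1 - 1) mod int (q i)"
          by (rule mod_diff_cong) simp
        moreover have "a k i \<in> {0..<int (q i)}" "b k i \<in> {0..<int (q i)}"
          using PiE_mem[OF PiE_mem[OF a k] i] PiE_mem[OF PiE_mem[OF b k] i] by auto
        ultimately show "a k i = b k i" by simp
      qed
    qed
  qed
qed

text \<open>
Apply concentration to \<open>A\<close> and its image under adding \<open>1\<close> to every entry, which has the same density.
\<close>

lemma dense_blocks_successor:
  fixes \<delta> t :: real
  assumes A: "A \<subseteq> blocks d" "\<delta> * card (blocks d) \<le> card A" and \<delta>: "0 < \<delta>"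
    and t: "0 \<le> t" "2 * real d < \<delta>\<^sup>2 * t\<^sup>2"
  shows "\<exists>a\<in>A. \<exists>b\<in>A. card {k \<in> {1..d}. \<exists>i\<in>I. (a k i - b k i) mod int (q i) \<noteq> 1} \<le> t"
proof -
  define \<tau> where "\<tau> = (\<lambda>c. \<lambda>k\<in>{1..d}. \<lambda>i\<in>I. (c k i + 1) mod int (q i))"
  note \<tau> = successor_block[of d, folded \<tau>_def]
  have fin: "finite residues" by (intro finite_PiE) auto
  have ne: "residues \<noteq> {}" using q_ge_2 by (force simp: PiE_eq_empty_iff)
  have "card (\<tau> ` A) = card A" using inj_on_subset[OF \<tau>(2) A(1)] by (rule card_image)
  then have \<tau>A: "\<tau> ` A \<subseteq> blocks d" "\<delta> * card (blocks d) \<le> card (\<tau> ` A)"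
    using \<tau>(1) A by (blast, simp)
  have "\<exists>a\<in>A. \<exists>c\<in>\<tau> ` A. hamming {1..d} a c \<le> t"
    by (rule dense_sets_hamming_close[OF _ fin ne A \<tau>A \<delta> t(1)]) (use t(2) in simp_all)
  then obtain a c where ac: "a \<in> A" "c \<in> \<tau> ` A" "hamming {1..d} a c \<le> t" by blast
  then obtain b where b: "b \<in> A" "c = \<tau> b" by blast
  have "{k \<in> {1..d}. \<exists>i\<in>I. (a k i - b k i) mod int (q i) \<noteq> 1} \<subseteq> {k \<in> {1..d}. a k \<noteq> c k}"
  proof -
    have "(a k i - b k i) mod int (q i) = 1" if "k \<in> {1..d}" "i \<in> I" "a k = c k" for k i
    proof -
      have "a k i = (b k i + 1) mod int (q i)" using that b by (simp add: \<tau>_def)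
      then show ?thesis using q_ge_2[OF that(2)] by (simp add: mod_diff_left_eq)
    qed
    then show ?thesis by blast
  qed
  then have "card {k \<in> {1..d}. \<exists>i\<in>I. (a k i - b k i) mod int (q i) \<noteq> 1} \<le> hamming {1..d} a c"
    unfolding hamming_def by (intro card_mono) auto
  then show ?thesis using ac b by (meson of_nat_mono order_trans)
qed

lemma fill_eq_mult:
  assumes "g \<in> frames N d m" "c \<in> blocks d" "N + d < m"
  shows "fill N d c g = g \<otimes>\<^bsub>G\<^esub> fill N d c \<one>\<^bsub>G\<^esub>"
proof (rule G_eqI)
  have g: "g \<in> L m" using assms by (simp add: frames_def)
  have one: "\<one>\<^bsub>G\<^esub> \<in> L m" using L_subgroup by (rule subgroup.one_closed)
  have gG: "g \<in> carrier G" using g by (rule L_carrier)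
  show "fill N d c g \<in> carrier G" "g \<otimes>\<^bsub>G\<^esub> fill N d c \<one>\<^bsub>G\<^esub> \<in> carrier G"
    using fill_closed[OF assms(2) g assms(3)] fill_closed[OF assms(2) one assms(3)] gG L_carrier by auto
  show "fst (fill N d c g) = fst (g \<otimes>\<^bsub>G\<^esub> fill N d c \<one>\<^bsub>G\<^esub>)"
    using gG FF.r_one by (simp add: carrier_G)
  show "coord (fill N d c g) i j = coord (g \<otimes>\<^bsub>G\<^esub> fill N d c \<one>\<^bsub>G\<^esub>) i j" if i: "i \<in> I" for i j
    using i gG assms(1) block_entry[OF assms(2) i, of j N]
    by (simp add: coord_mult coord_fill frames_def)
qed

text \<open>
Let \<open>A\<close> be dense in \<open>L m\<close>. For many remainders \<open>g\<close>, the blocks that complete \<open>g\<close> to an element of \<open>A\<close>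
are dense, so two of them, \<open>a g\<close> and \<open>b g\<close>, differ by ones almost everywhere. Passing to a positive
proportion of the remainders makes \<open>a\<close>, \<open>b\<close>, the component in \<open>F\<close> and the coordinates up to \<open>N\<close>
constant. The translate of \<open>S\<close> by \<open>u (a, b) = h - a + b\<close> is recurrent, hence contains a difference
\<open>g - g' = s + h - a + b\<close> of such remainders. Then \<open>(g + a) - (g' + b) = s + h\<close> is a difference of two
elements of \<open>A\<close>, it vanishes where \<open>g\<close> and \<open>g'\<close> agree, and on the block it equals \<open>a - b\<close>.
\<close>

lemma eventually_recurrent_near_ones:
  assumes S: "recurrent_translates S" and h: "h \<in> H" and \<epsilon>: "0 < \<epsilon>"
    and d: "2 * real d < (\<epsilon> / 2)\<^sup>2 * (\<epsilon> * real d)\<^sup>2"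
  shows "eventually (\<lambda>m. G.recurrent_in m \<epsilon> ((\<lambda>s. s \<otimes>\<^bsub>G\<^esub> h) ` S \<inter> near_ones N d \<epsilon>)) sequentially"
proof -
  let ?P = "blocks d"
  let ?low = "\<Pi>\<^sub>E i\<in>I. \<Pi>\<^sub>E j\<in>{..N}. {0..<int (q i)}"
  let ?T = "?P \<times> ?P \<times> carrier F \<times> ?low"
  have SG: "S \<subseteq> carrier G" using S by (simp add: recurrent_translates_def)
  have hG: "h \<in> carrier G" using h by (simp add: H_iff)
  have finP: "finite ?P" by (intro finite_PiE) auto
  have neP: "?P \<noteq> {}" using q_ge_2 by (force simp: PiE_eq_empty_iff)
  have cardP: "card ?P > 0" using finP neP by (simp add: card_gt_0_iff)
  have finT: "finite ?T" using finP F(2) by (intro finite_cartesian_product finite_PiE) auto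
  have neT: "?T \<noteq> {}"
  proof -
    have "?low \<noteq> {}" using q_ge_2 by (force simp: PiE_eq_empty_iff)
    then show ?thesis using neP FF.one_closed by blast
  qed
  define \<kappa> where "\<kappa> = real (card ?T)"
  have \<kappa>: "\<kappa> > 0" using finT neT by (simp add: \<kappa>_def card_gt_0_iff)
  \<comment> \<open>the density left after halving, fixing one of \<open>\<kappa>\<close> patterns and dropping the block\<close>
  define \<delta> where "\<delta> = \<epsilon> / (2 * \<kappa> * card ?P)"
  have \<delta>: "\<delta> > 0" using \<epsilon> \<kappa> cardP by (simp add: \<delta>_def)
  define v where "v c = fill N d c \<one>\<^bsub>G\<^esub>" for c
  have vH: "v c \<in> H" if "c \<in> ?P" for c
    using fill_closed[OF that subgroup.one_closed[OF L_subgroup], of N "Suc (N + d)"]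
    by (simp add: v_def H_iff L_carrier)
  define u where "u ab = h \<otimes>\<^bsub>G\<^esub> (inv\<^bsub>G\<^esub> v (fst ab) \<otimes>\<^bsub>G\<^esub> v (snd ab))" for ab
  have uH: "u ab \<in> H" if "ab \<in> ?P \<times> ?P" for ab
    using that h vH by (auto simp: u_def intro!: H_closed)
  have "eventually (\<lambda>m. \<forall>ab\<in>?P \<times> ?P. G.recurrent_in m \<delta> ((\<lambda>s. s \<otimes>\<^bsub>G\<^esub> u ab) ` S)) sequentially"
  proof (rule eventually_ball_finite)
    show "finite (?P \<times> ?P)" using finP by simp
    show "\<forall>ab\<in>?P \<times> ?P. eventually (\<lambda>m. G.recurrent_in m \<delta> ((\<lambda>s. s \<otimes>\<^bsub>G\<^esub> u ab) ` S)) sequentially"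
    proof
      fix ab assume "ab \<in> ?P \<times> ?P"
      then have "u ab \<in> H" by (rule uH)
      then show "eventually (\<lambda>m. G.recurrent_in m \<delta> ((\<lambda>s. s \<otimes>\<^bsub>G\<^esub> u ab) ` S)) sequentially"
        using S SG \<delta> by (intro G.eventually_recurrent_in) (auto simp: recurrent_translates_def H_iff)
    qed
  qed
  moreover have "eventually (\<lambda>m. N + d < m) sequentially" by (rule eventually_gt_at_top)
  ultimately show ?thesis
  proof eventually_elim
    case (elim m)
    show ?case
      unfolding G.recurrent_in_def
    proof (intro allI impI)
      fix A assume A: "A \<subseteq> L m" and dense: "\<epsilon> * card (L m) \<le> card A"
      let ?Q = "frames N d m"
      have QL: "?Q \<subseteq> L m" by (auto simp: frames_def)
      have finQ: "finite ?Q" using QL finite_L by (rule finite_subset)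
      define fib where "fib g = {c \<in> ?P. fill N d c g \<in> A}" for g
      have fib_le: "card (fib g) \<le> card ?P" for g
        using finP by (intro card_mono) (auto simp: fib_def)
      note bij = bij_betw_fill[OF elim(2)]
      have cardL: "card (L m) = card ?Q * card ?P"
        using bij_betw_same_card[OF bij] by (simp add: card_cartesian_product)
      have "bij_betw (\<lambda>(g, c). fill N d c g) (Sigma ?Q fib) A"
      proof -
        have "(\<lambda>(g, c). fill N d c g) ` Sigma ?Q fib = A"
        proof (intro equalityI subsetI)
          fix x assume x: "x \<in> A"
          then have "x \<in> (\<lambda>(g, c). fill N d c g) ` (?Q \<times> ?P)"
            using A bij by (auto simp: bij_betw_def)
          then show "x \<in> (\<lambda>(g, c). fill N d c g) ` Sigma ?Q fib" using x by (force simp: fib_def)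
        qed (auto simp: fib_def)
        moreover have "inj_on (\<lambda>(g, c). fill N d c g) (Sigma ?Q fib)"
          by (rule inj_on_subset[OF bij_betw_imp_inj_on[OF bij]]) (unfold fib_def, blast)
        ultimately show ?thesis by (simp add: bij_betw_def)
      qed
      then have "card A = card (Sigma ?Q fib)" by (simp add: bij_betw_same_card)
      also have "\<dots> = (\<Sum>g\<in>?Q. card (fib g))"
        using finQ finP by (intro card_SigmaI) (auto simp: fib_def)
      finally have cardA: "real (card A) = (\<Sum>g\<in>?Q. real (card (fib g)))" by simp
      define Q' where "Q' = {g \<in> ?Q. \<epsilon> / 2 * card ?P \<le> card (fib g)}"
      have Q'Q: "Q' \<subseteq> ?Q" by (auto simp: Q'_def)
      have finQ': "finite Q'" using Q'Q finQ by (rule finite_subset)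
      have "real (card A) \<le> (\<Sum>g\<in>?Q. (if g \<in> Q' then real (card ?P) else 0) + \<epsilon> / 2 * card ?P)"
        unfolding cardA using fib_le \<epsilon> by (intro sum_mono) (auto simp: Q'_def intro: add_increasing2)
      also have "\<dots> = real (card Q') * card ?P + card ?Q * (\<epsilon> / 2 * card ?P)"
        using finQ Q'Q by (simp add: sum.distrib flip: sum.inter_restrict) (simp add: Int_absorb1)
      finally have "\<epsilon> * (card ?Q * card ?P) \<le> real (card Q') * card ?P + card ?Q * (\<epsilon> / 2 * card ?P)"
        using dense by (simp add: cardL)
      then have "(\<epsilon> / 2 * card ?Q) * card ?P \<le> real (card Q') * card ?P" by (simp add: algebra_simps)
      then have cardQ': "\<epsilon> / 2 * card ?Q \<le> card Q'" using cardP by simp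
      define near where "near a b \<longleftrightarrow> card {k \<in> {1..d}. \<exists>i\<in>I. (a k i - b k i) mod int (q i) \<noteq> 1} \<le> \<epsilon> * real d"
        for a b :: "nat \<Rightarrow> nat \<Rightarrow> int"
      have "\<exists>a\<in>fib g. \<exists>b\<in>fib g. near a b" if "g \<in> Q'" for g
        using that \<epsilon> d unfolding near_def
        by (intro dense_blocks_successor[of _ _ "\<epsilon> / 2"]) (auto simp: Q'_def fib_def)
      then obtain a b where ab: "\<And>g. g \<in> Q' \<Longrightarrow> a g \<in> fib g" "\<And>g. g \<in> Q' \<Longrightarrow> b g \<in> fib g"
        "\<And>g. g \<in> Q' \<Longrightarrow> near (a g) (b g)"
        by metis
      define \<Phi> where "\<Phi> g = (a g, b g, fst g, \<lambda>i\<in>I. \<lambda>j\<in>{..N}. coord g i j)" for g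
      have "\<Phi> g \<in> ?T" if "g \<in> Q'" for g
      proof -
        have gG: "g \<in> carrier G" using that Q'Q QL L_carrier by blast
        then have "fst g \<in> carrier F" using carrier_G by blast
        moreover have "(\<lambda>i\<in>I. \<lambda>j\<in>{..N}. coord g i j) \<in> ?low"
          using coord_bounds[OF gG] by (simp add: restrict_PiE_iff)
        moreover have "a g \<in> ?P" "b g \<in> ?P" using ab(1,2)[OF that] unfolding fib_def by blast+
        ultimately show ?thesis unfolding \<Phi>_def by blast
      qed
      then have "\<Phi> \<in> Q' \<rightarrow> ?T" by (rule Pi_I)
      from pigeonhole_card[OF this finQ' finT neT]
      obtain y where y: "card Q' \<le> card (\<Phi> -` {y} \<inter> Q') * card ?T" by blast
      let ?B = "\<Phi> -` {y} \<inter> Q'"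
      have "\<delta> * card (L m) \<le> card ?B"
      proof -
        have "real (card Q') \<le> real (card ?B) * \<kappa>"
          using y by (simp only: \<kappa>_def of_nat_mult[symmetric] of_nat_le_iff)
        then have "\<epsilon> / 2 * card ?Q \<le> real (card ?B) * \<kappa>" using cardQ' by linarith
        then show ?thesis using \<kappa> cardP by (simp add: \<delta>_def cardL field_simps)
      qed
      moreover have "?B \<subseteq> L m" using Q'Q QL by blast
      moreover obtain a0 b0 where ab0: "a0 = fst y" "b0 = fst (snd y)" by blast
      have B: "a g = a0" "b g = b0" "fst g = fst (snd (snd y))" "(\<lambda>i\<in>I. \<lambda>j\<in>{..N}. coord g i j) = snd (snd (snd y))"
        if "g \<in> ?B" for g
        using that by (auto simp: \<Phi>_def ab0)
      have "?B \<noteq> {}"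
      proof -
        have "0 < \<delta> * card (L m)" using \<delta> G.card_L_pos by simp
        then show ?thesis using \<open>\<delta> * card (L m) \<le> card ?B\<close> by force
      qed
      then obtain g0 where g0: "g0 \<in> ?B" by blast
      then have abP: "a0 \<in> ?P" "b0 \<in> ?P" using ab[of g0] B[OF g0] by (auto simp: fib_def)
      have close: "card {k \<in> {1..d}. \<exists>i\<in>I. (a0 k i - b0 k i) mod int (q i) \<noteq> 1} \<le> \<epsilon> * real d"
        using ab(3)[of g0] B(1,2)[OF g0] g0 by (simp add: near_def)
      have "G.recurrent_in m \<delta> ((\<lambda>s. s \<otimes>\<^bsub>G\<^esub> u (a0, b0)) ` S)" using elim(1) abP by blast
      ultimately obtain g g' s where gs: "g \<in> ?B" "g' \<in> ?B" "s \<in> S" "g = g' \<otimes>\<^bsub>G\<^esub> (s \<otimes>\<^bsub>G\<^esub> u (a0, b0))"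
        unfolding G.recurrent_in_def by blast
      let ?x = "fill N d a0 g" and ?y = "fill N d b0 g'" and ?w = "s \<otimes>\<^bsub>G\<^esub> h"
      have gQ: "g \<in> ?Q" "g' \<in> ?Q" using gs Q'Q by auto
      have cl: "g \<in> carrier G" "g' \<in> carrier G" "s \<in> carrier G" "v a0 \<in> carrier G" "v b0 \<in> carrier G" "?w \<in> carrier G"
      proof -
        show "g \<in> carrier G" "g' \<in> carrier G" using gQ QL L_carrier by blast+
        show "s \<in> carrier G" "?w \<in> carrier G" using gs(3) SG hG by auto
        show "v a0 \<in> carrier G" "v b0 \<in> carrier G" using vH abP by (auto simp: H_iff)
      qed
      have xA: "?x \<in> A" "?y \<in> A"
        using ab(1)[of g] ab(2)[of g'] B[OF gs(1)] B[OF gs(2)] gs by (auto simp: fib_def)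
      have xy: "?x = ?y \<otimes>\<^bsub>G\<^esub> ?w"
      proof -
        have "?x = g' \<otimes>\<^bsub>G\<^esub> (s \<otimes>\<^bsub>G\<^esub> (h \<otimes>\<^bsub>G\<^esub> (inv\<^bsub>G\<^esub> v a0 \<otimes>\<^bsub>G\<^esub> v b0))) \<otimes>\<^bsub>G\<^esub> v a0"
          using fill_eq_mult[OF gQ(1) abP(1) elim(2)] gs(4) by (simp add: v_def u_def)
        also have "\<dots> = (g' \<otimes>\<^bsub>G\<^esub> v b0) \<otimes>\<^bsub>G\<^esub> ?w \<otimes>\<^bsub>G\<^esub> (inv\<^bsub>G\<^esub> v a0 \<otimes>\<^bsub>G\<^esub> v a0)"
        proof -
          have "g' \<otimes>\<^bsub>G\<^esub> (s \<otimes>\<^bsub>G\<^esub> (h \<otimes>\<^bsub>G\<^esub> (c \<otimes>\<^bsub>G\<^esub> v b0))) \<otimes>\<^bsub>G\<^esub> v a0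
              = (g' \<otimes>\<^bsub>G\<^esub> v b0) \<otimes>\<^bsub>G\<^esub> ?w \<otimes>\<^bsub>G\<^esub> (c \<otimes>\<^bsub>G\<^esub> v a0)" if "c \<in> carrier G" for c
            using that cl hG by (simp add: G.m_ac)
          then show ?thesis using cl(4) by blast
        qed
        also have "\<dots> = (g' \<otimes>\<^bsub>G\<^esub> v b0) \<otimes>\<^bsub>G\<^esub> ?w"
          using cl by simp
        finally show ?thesis using fill_eq_mult[OF gQ(2) abP(2) elim(2)] by (simp add: v_def)
      qed
      have w: "coord ?w i j = (if j \<in> {N<..N + d} then (a0 (j - N) i - b0 (j - N) i) mod int (q i)
          else (coord g i j - coord g' i j) mod int (q i))" if "i \<in> I" for i j
      proof (rule fill_difference[OF refl refl xy _ _ cl(6) that])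
        show "?x \<in> carrier G" "?y \<in> carrier G" using xA A L_carrier by blast+
      qed
      have "?w \<in> near_ones N d \<epsilon>"
      proof -
        have "fst ?w = \<one>\<^bsub>F\<^esub>"
        proof -
          have "fst ?x = fst (?y \<otimes>\<^bsub>G\<^esub> ?w)" using xy by (rule arg_cong)
          also have "\<dots> = fst ?y \<otimes>\<^bsub>F\<^esub> fst ?w" by (rule fst_mult)
          finally have "fst g' \<otimes>\<^bsub>F\<^esub> fst ?w = fst g'"
            unfolding fst_fill B(3)[OF gs(1)] B(3)[OF gs(2)] by (rule sym)
          moreover have "fst g' \<in> carrier F" "fst ?w \<in> carrier F" using cl carrier_G by blast+
          ultimately show ?thesis by (rule FF.l_cancel_one[THEN iffD1, rotated 2])
        qed
        moreover have "coord ?w i j = 0" if "i \<in> I" "j \<le> N" for i j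
        proof -
          have "(\<lambda>i\<in>I. \<lambda>j\<in>{..N}. coord g i j) i j = (\<lambda>i\<in>I. \<lambda>j\<in>{..N}. coord g' i j) i j"
            using B(4)[OF gs(1)] B(4)[OF gs(2)] by simp
          then show ?thesis using that by (simp add: w)
        qed
        moreover have "{k \<in> {1..d}. \<exists>i\<in>I. coord ?w i (N + k) \<noteq> 1}
            = {k \<in> {1..d}. \<exists>i\<in>I. (a0 k i - b0 k i) mod int (q i) \<noteq> 1}"
          by (intro Collect_cong conj_cong refl bex_cong) (auto simp: w)
        ultimately show ?thesis using close cl by (simp add: near_ones_def H_iff)
      qed
      then show "\<exists>x\<in>A. \<exists>y\<in>A. \<exists>w\<in>(\<lambda>s. s \<otimes>\<^bsub>G\<^esub> h) ` S \<inter> near_ones N d \<epsilon>. x = y \<otimes>\<^bsub>G\<^esub> w"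
        using xA xy gs(3) by blast
    qed
  qed
qed

text \<open>
The part of \<open>S\<close> that \<open>eventually_recurrent_near_ones\<close> uses inside one group \<open>L m\<close> is finite, as \<open>L m\<close>
contains all differences of its elements.
\<close>

lemma exists_stage:
  assumes S: "recurrent_translates S" and h: "h \<in> H" and \<epsilon>: "0 < \<epsilon>"
  obtains d m S0 where "1 / real (d + 1) \<le> \<epsilon>" "finite S0" "S0 \<subseteq> S"
    "(\<lambda>s. s \<otimes>\<^bsub>G\<^esub> h) ` S0 \<subseteq> near_ones N d \<epsilon>"
    "(\<lambda>s. s \<otimes>\<^bsub>G\<^esub> h) ` S0 \<subseteq> L m" "G.recurrent_in m \<epsilon> ((\<lambda>s. s \<otimes>\<^bsub>G\<^esub> h) ` S0)"
proof -
  \<comment> \<open>the first term serves concentration at density \<open>\<epsilon> / 2\<close> and distance \<open>\<epsilon> * d\<close>, the second makes \<open>1 / (d + 1) \<le> \<epsilon>\<close>\<close>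
  obtain d :: nat where d: "8 / \<epsilon> ^ 4 + 1 / \<epsilon> < real d" using reals_Archimedean2 by blast
  have pos: "0 < 8 / \<epsilon> ^ 4" "0 < 1 / \<epsilon>" using \<epsilon> by simp_all
  have d0: "real d > 0" using d pos by linarith
  have "8 / \<epsilon> ^ 4 < real d" using d pos by linarith
  then have "8 * real d < \<epsilon> ^ 4 * real d * real d" using \<epsilon> d0 by (simp add: divide_simps mult.commute)
  then have d1: "2 * real d < (\<epsilon> / 2)\<^sup>2 * (\<epsilon> * real d)\<^sup>2"
    by (simp add: power2_eq_square power4_eq_xxxx algebra_simps)
  have "1 / \<epsilon> < real d" using d pos by linarith
  then have "1 / \<epsilon> < real (d + 1)" by simp
  then have d2: "1 / real (d + 1) \<le> \<epsilon>" using \<epsilon> by (simp add: divide_simps mult.commute)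
  obtain m where m: "h \<in> L m" "G.recurrent_in m \<epsilon> ((\<lambda>s. s \<otimes>\<^bsub>G\<^esub> h) ` S \<inter> near_ones N d \<epsilon>)"
    using eventually_happens'[OF sequentially_bot
        eventually_conj[OF G.eventually_in_L eventually_recurrent_near_ones[OF S h \<epsilon> d1]], of h] h
    by (auto simp: H_iff)
  define S0 where "S0 = {s \<in> S. s \<otimes>\<^bsub>G\<^esub> h \<in> L m \<inter> near_ones N d \<epsilon>}"
  have SG: "S \<subseteq> carrier G" using S by (simp add: recurrent_translates_def)
  have hG: "h \<in> carrier G" using h by (simp add: H_iff)
  have fin: "finite S0"
  proof (rule inj_on_finite[of "\<lambda>s. s \<otimes>\<^bsub>G\<^esub> h" _ "L m"])
    show "inj_on (\<lambda>s. s \<otimes>\<^bsub>G\<^esub> h) S0"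
      by (rule inj_on_subset[OF G.inj_on_multc[OF hG]]) (use SG in \<open>auto simp: S0_def\<close>)
  qed (auto simp: S0_def finite_L)
  have "G.recurrent_in m \<epsilon> ((\<lambda>s. s \<otimes>\<^bsub>G\<^esub> h) ` S0)"
    unfolding G.recurrent_in_def
  proof (intro allI impI)
    fix A assume A: "A \<subseteq> L m" "\<epsilon> * card (L m) \<le> card A"
    then obtain x y w where xy: "x \<in> A" "y \<in> A" "x = y \<otimes>\<^bsub>G\<^esub> w"
      and w: "w \<in> (\<lambda>s. s \<otimes>\<^bsub>G\<^esub> h) ` S" "w \<in> near_ones N d \<epsilon>"
      using m(2) unfolding G.recurrent_in_def by blast
    have xL: "x \<in> L m" "y \<in> L m" using xy(1,2) A(1) by blast+
    have cl: "x \<in> carrier G" "y \<in> carrier G" "w \<in> carrier G"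
      using L_carrier[OF xL(1)] L_carrier[OF xL(2)] w(2) by (simp_all add: near_ones_def H_iff)
    have "w = inv\<^bsub>G\<^esub> y \<otimes>\<^bsub>G\<^esub> x" using cl(2,3) by (simp add: xy(3) G.m_assoc[symmetric])
    moreover have "inv\<^bsub>G\<^esub> y \<otimes>\<^bsub>G\<^esub> x \<in> L m"
      by (intro subgroup.m_closed subgroup.m_inv_closed L_subgroup xL)
    ultimately have "w \<in> (\<lambda>s. s \<otimes>\<^bsub>G\<^esub> h) ` S0" using w by (auto simp: S0_def)
    then show "\<exists>a\<in>A. \<exists>b\<in>A. \<exists>g\<in>(\<lambda>s. s \<otimes>\<^bsub>G\<^esub> h) ` S0. a = b \<otimes>\<^bsub>G\<^esub> g" using xy by blast
  qed
  then show thesis using d2 fin by (intro that[of d S0 m]) (auto simp: S0_def)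
qed

end

section \<open>Random homomorphisms\<close>

lemma card_image_same_kernel:
  assumes "finite A" "\<And>u v. \<lbrakk>u \<in> A; v \<in> A\<rbrakk> \<Longrightarrow> f u = f v \<longleftrightarrow> g u = g v"
  shows "card (f ` A) = card (g ` A)"
proof -
  have "bij_betw (\<lambda>y. g (inv_into A f y)) (f ` A) (g ` A)"
  proof (rule bij_betwI[where g = "\<lambda>y. f (inv_into A g y)"])
    fix y assume "y \<in> f ` A"
    then have "inv_into A f y \<in> A" "f (inv_into A f y) = y" by (auto intro: inv_into_into f_inv_into_f)
    then show "f (inv_into A g (g (inv_into A f y))) = y"
      using assms(2)[of "inv_into A g (g (inv_into A f y))" "inv_into A f y"]
      by (metis f_inv_into_f imageI inv_into_into)
  next
    fix y assume "y \<in> g ` A"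
    then have "inv_into A g y \<in> A" "g (inv_into A g y) = y" by (auto intro: inv_into_into f_inv_into_f)
    then show "g (inv_into A f (f (inv_into A g y))) = y"
      using assms(2)[of "inv_into A f (f (inv_into A g y))" "inv_into A g y"]
      by (metis f_inv_into_f imageI inv_into_into)
  qed (auto intro: inv_into_into)
  then show ?thesis by (rule bij_betw_same_card)
qed

text \<open>
What the stages provide. Everything that stage \<open>n\<close> handles lives on coordinates below \<open>N (Suc n)\<close>, and
the translation \<open>h n\<close> lives below \<open>N n\<close>.
\<close>

locale staged_set = bounded_torsion_group +
  fixes h :: "nat \<Rightarrow> 'a \<times> (nat \<Rightarrow> nat \<Rightarrow> int)" and N d :: "nat \<Rightarrow> nat"
    and \<epsilon> :: "nat \<Rightarrow> real" and S :: "nat \<Rightarrow> ('a \<times> (nat \<Rightarrow> nat \<Rightarrow> int)) set"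
  assumes h: "h n \<in> H" "h n \<in> L (N n)" and N_Suc: "N n + d n < N (Suc n)"
    and S: "s \<in> S n \<Longrightarrow> s \<in> carrier G"
      "s \<in> S n \<Longrightarrow> s \<otimes>\<^bsub>G\<^esub> h n \<in> near_ones (N n) (d n) (\<epsilon> n)"
      "s \<in> S n \<Longrightarrow> s \<otimes>\<^bsub>G\<^esub> h n \<in> L (N (Suc n))"
    and d_large: "1 / real (d n + 1) \<le> \<epsilon> n" and \<epsilon>_null: "\<epsilon> \<longlonglongrightarrow> 0"

locale staged_set_translate = staged_set +
  fixes t :: "'a \<times> (nat \<Rightarrow> nat \<Rightarrow> int)"
  assumes t: "t \<in> H"
begin

lemma N_mono: "m \<le> n \<Longrightarrow> N m \<le> N n"
proof (induction n rule: dec_induct)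
  case (step n)
  then show ?case using N_Suc[of n] by simp
qed simp

lemma N_ge: "n \<le> N n"
proof (induction n)
  case (Suc n)
  then show ?case using N_Suc[of n] by simp
qed simp

definition discrepancy :: "nat \<Rightarrow> 'a \<times> (nat \<Rightarrow> nat \<Rightarrow> int)" where
  "discrepancy n = h n \<otimes>\<^bsub>G\<^esub> inv\<^bsub>G\<^esub> t"

text \<open>
The matrix of the random homomorphism after \<open>n\<close> stages: \<open>weight a n i j k\<close> is the entry at coordinate
\<open>k\<close> of the image of the unit at coordinate \<open>j\<close> of summand \<open>i\<close>. The matrix starts as the identity.
Stage \<open>n\<close> changes the images of the coordinates strictly between \<open>N n\<close> and \<open>N (Suc n)\<close>: the coordinate
\<open>N n + a n\<close> chosen from the block is sent to the image of \<open>discrepancy n\<close> and the others to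
zero. The choice \<open>a n = 0\<close> stands for changing nothing.
\<close>

primrec weight :: "(nat \<Rightarrow> nat) \<Rightarrow> nat \<Rightarrow> nat \<Rightarrow> nat \<Rightarrow> nat \<Rightarrow> int" where
  "weight a 0 i j k = (if j = k then 1 else 0)"
| "weight a (Suc n) i j k =
    (if a n = 0 \<or> j \<le> N n \<or> N (Suc n) \<le> j then weight a n i j k
     else if j = N n + a n then \<Sum>l<N n. coord (discrepancy n) i l * weight a n i l k
     else 0)"

definition wsum :: "(nat \<Rightarrow> nat) \<Rightarrow> nat \<Rightarrow> 'a \<times> (nat \<Rightarrow> nat \<Rightarrow> int) \<Rightarrow> nat \<Rightarrow> nat \<Rightarrow> int" where
  "wsum a n g i k = (\<Sum>j | coord g i j \<noteq> 0. coord g i j * weight a n i j k)"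

definition \<phi> :: "(nat \<Rightarrow> nat) \<Rightarrow> nat \<Rightarrow> 'a \<times> (nat \<Rightarrow> nat \<Rightarrow> int) \<Rightarrow> 'a \<times> (nat \<Rightarrow> nat \<Rightarrow> int)" where
  "\<phi> a n g = (fst g, \<lambda>i k. if i \<in> I then wsum a n g i k mod int (q i) else 0)"

lemma wsum_eq:
  assumes "g \<in> L m" "i \<in> I"
  shows "wsum a n g i k = (\<Sum>j<m. coord g i j * weight a n i j k)"
  unfolding wsum_def
proof (rule sum.mono_neutral_left)
  show "{j. coord g i j \<noteq> 0} \<subseteq> {..<m}"
    using assms by (force simp: L_def not_le[symmetric])
qed auto

lemma in_some_L: "g \<in> carrier G \<Longrightarrow> g' \<in> carrier G \<Longrightarrow> \<exists>m. g \<in> L m \<and> g' \<in> L m"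
  using eventually_happens'[OF sequentially_bot eventually_conj[OF G.eventually_in_L G.eventually_in_L]] by blast

lemma wsum_mult:
  assumes g: "g \<in> carrier G" "g' \<in> carrier G" and i: "i \<in> I"
  shows "wsum a n (g \<otimes>\<^bsub>G\<^esub> g') i k mod int (q i) = (wsum a n g i k + wsum a n g' i k) mod int (q i)"
proof -
  obtain m where m: "g \<in> L m" "g' \<in> L m" using in_some_L[OF g] by blast
  have "g \<otimes>\<^bsub>G\<^esub> g' \<in> L m" using L_subgroup m by (rule subgroup.m_closed)
  then have "wsum a n (g \<otimes>\<^bsub>G\<^esub> g') i k mod int (q i)
      = (\<Sum>j<m. ((coord g i j + coord g' i j) mod int (q i)) * weight a n i j k) mod int (q i)"
    using i by (simp add: wsum_eq coord_mult)
  also have "\<dots> = (\<Sum>j<m. (coord g i j + coord g' i j) * weight a n i j k) mod int (q i)"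
    by (subst (1 2) mod_sum_eq[symmetric]) (simp add: mod_mult_left_eq)
  also have "\<dots> = (wsum a n g i k + wsum a n g' i k) mod int (q i)"
    using m i by (simp add: wsum_eq distrib_right sum.distrib)
  finally show ?thesis .
qed

lemma \<phi>_eq_iff:
  "\<phi> a n u = \<phi> a n v \<longleftrightarrow> fst u = fst v \<and>
     (\<forall>i\<in>I. \<forall>k. wsum a n u i k mod int (q i) = wsum a n v i k mod int (q i))"
  by (auto simp: \<phi>_def fun_eq_iff)

lemma \<phi>_mult_right:
  assumes "u \<in> carrier G" "v \<in> carrier G" "g \<in> carrier G"
  shows "\<phi> a n (u \<otimes>\<^bsub>G\<^esub> g) = \<phi> a n (v \<otimes>\<^bsub>G\<^esub> g) \<longleftrightarrow> \<phi> a n u = \<phi> a n v"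
proof -
  have dir: "\<phi> a n (u \<otimes>\<^bsub>G\<^esub> g) = \<phi> a n (v \<otimes>\<^bsub>G\<^esub> g)"
    if "u \<in> carrier G" "v \<in> carrier G" "g \<in> carrier G" "\<phi> a n u = \<phi> a n v" for u v g
    using that unfolding \<phi>_eq_iff by (auto simp: wsum_mult) (metis mod_add_cong)
  show ?thesis
    using dir[of u v g] dir[of "u \<otimes>\<^bsub>G\<^esub> g" "v \<otimes>\<^bsub>G\<^esub> g" "inv\<^bsub>G\<^esub> g"] assms by (auto simp: G.m_assoc)
qed

lemma weight_late: "m \<le> n \<Longrightarrow> j < N m \<Longrightarrow> weight a n i j k = weight a m i j k"
proof (induction n rule: dec_induct)
  case (step n)
  then have "j \<le> N n" using N_mono[of m n] by simp
  then show ?case using step by simp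
qed simp

lemma weight_at_N: "weight a n i (N m) k = (if N m = k then 1 else 0)"
proof (induction n)
  case (Suc n)
  have "N m \<le> N n \<or> N (Suc n) \<le> N m" using N_mono[of m n] N_mono[of "Suc n" m] by linarith
  then show ?case using Suc by auto
qed simp

lemma weight_support: "j < N m \<Longrightarrow> N m \<le> k \<Longrightarrow> weight a n i j k = 0"
proof (induction n arbitrary: j)
  case (Suc n)
  have "weight a n i l k = 0" if "N n < j" "j < N (Suc n)" "l < N n" for l
    using Suc that by auto
  then show ?case using Suc by (auto intro: sum.neutral)
qed auto

lemma weight_identity:
  assumes "\<And>l. l < m \<Longrightarrow> a l = 0" "j < N m"
  shows "weight a n i j k = (if j = k then 1 else 0)"
proof (induction n)
  case (Suc n)
  have "a n = 0 \<or> j \<le> N n" using assms(1)[of n] assms(2) N_mono[of m n] by fastforce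
  then show ?case using Suc by auto
qed simp

text \<open>
Coordinate \<open>N m\<close> is fixed by every stage, and lower coordinates never acquire an image there.
\<close>

lemma \<phi>_fresh:
  assumes u: "u \<in> L (N m)" and v: "v \<in> L (N m)"
  shows "\<phi> a n u \<noteq> \<phi> a n (v \<otimes>\<^bsub>G\<^esub> basis (N m))"
proof
  assume eq: "\<phi> a n u = \<phi> a n (v \<otimes>\<^bsub>G\<^esub> basis (N m))"
  have zero: "wsum a n g 1 (N m) = 0" if "g \<in> L (N m)" for g
    using that one_in_I by (simp add: wsum_eq weight_support)
  have "wsum a n (basis (N m)) 1 (N m) = 1"
    using one_in_I by (simp add: wsum_def weight_at_N)
  then have "wsum a n (v \<otimes>\<^bsub>G\<^esub> basis (N m)) 1 (N m) mod int (q 1) = 1"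
    using wsum_mult[of v "basis (N m)" 1] zero[OF v] v L_carrier basis_closed(2) one_in_I q_ge_2[of 1] by simp
  moreover have "wsum a n u 1 (N m) mod int (q 1) = wsum a n (v \<otimes>\<^bsub>G\<^esub> basis (N m)) 1 (N m) mod int (q 1)"
    using eq one_in_I by (simp add: \<phi>_eq_iff)
  ultimately show False using zero[OF u] by simp
qed

lemma \<phi>_faithful:
  assumes "\<And>l. l < m \<Longrightarrow> a l = 0" and g: "g \<in> L (N m)" "g \<noteq> \<one>\<^bsub>G\<^esub>"
  shows "\<phi> a n g \<noteq> \<phi> a n \<one>\<^bsub>G\<^esub>"
proof
  assume eq: "\<phi> a n g = \<phi> a n \<one>\<^bsub>G\<^esub>"
  have w: "wsum a n x i k = coord x i k" if "x \<in> L (N m)" "i \<in> I" for x i k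
  proof -
    have "wsum a n x i k = (\<Sum>j<N m. coord x i j * (if j = k then 1 else 0))"
      using that by (simp add: wsum_eq weight_identity[OF assms(1)])
    also have "\<dots> = (if k < N m then coord x i k else 0)"
      by (simp add: if_distrib cong: if_cong)
    also have "\<dots> = coord x i k" using that by (auto simp: L_def)
    finally show ?thesis .
  qed
  have one: "\<one>\<^bsub>G\<^esub> \<in> L (N m)" using L_subgroup by (rule subgroup.one_closed)
  have "g = \<one>\<^bsub>G\<^esub>"
  proof (rule G_eqI)
    show "fst g = fst \<one>\<^bsub>G\<^esub>" using eq by (simp only: \<phi>_eq_iff)
    show "coord g i j = coord \<one>\<^bsub>G\<^esub> i j" if "i \<in> I" for i j
    proof -
      have "wsum a n g i j mod int (q i) = wsum a n \<one>\<^bsub>G\<^esub> i j mod int (q i)"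
        using eq that by (simp only: \<phi>_eq_iff)
      then show ?thesis using w[OF g(1) that] w[OF one that] that L_carrier[OF g(1)] by simp
    qed
  qed (use g L_carrier in auto)
  then show False using g by simp
qed

text \<open>
With \<open>w = s + h m\<close>, only the chosen coordinate contributes to \<open>\<phi> w\<close>: earlier entries of \<open>w\<close> vanish and
the later ones are killed. As that entry is \<open>1\<close>, \<open>\<phi> w\<close> is the image of the discrepancy \<open>h m - t\<close>, and
\<open>s + t\<close> is the difference of the two.
\<close>

lemma \<phi>_stage:
  assumes n: "m < n" and tL: "t \<in> L (N m)" and s: "s \<in> S m"
    and am: "a m \<in> {1..d m}" and ones: "\<And>i. i \<in> I \<Longrightarrow> coord (s \<otimes>\<^bsub>G\<^esub> h m) i (N m + a m) = 1"
  shows "\<phi> a n (s \<otimes>\<^bsub>G\<^esub> t) = \<phi> a n \<one>\<^bsub>G\<^esub>"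
proof -
  let ?w = "s \<otimes>\<^bsub>G\<^esub> h m" and ?e = "discrepancy m"
  have hG: "h m \<in> carrier G" "t \<in> carrier G" using h t by (auto simp: H_iff)
  have sG: "s \<in> carrier G" using S(1) s .
  have e: "?e \<in> H" "?e \<in> L (N m)"
    using h[of m] t tL by (auto simp: discrepancy_def intro!: H_closed subgroup.m_closed subgroup.m_inv_closed L_subgroup)
  have w: "?w \<in> H" "?w \<in> L (N (Suc m))" "\<And>i j. i \<in> I \<Longrightarrow> j \<le> N m \<Longrightarrow> coord ?w i j = 0"
    using S(2,3)[OF s] by (auto simp: near_ones_def)
  have "\<phi> a n ?w = \<phi> a n ?e"
    unfolding \<phi>_eq_iff
  proof (intro conjI ballI allI)
    show "fst ?w = fst ?e" using w(1) e(1) by (simp add: H_iff del: fst_mult)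
    fix i k assume i: "i \<in> I"
    have "wsum a n ?w i k = (\<Sum>j<N (Suc m). coord ?w i j * weight a (Suc m) i j k)"
      using w(2) i n by (simp add: wsum_eq weight_late[of "Suc m" n] del: weight.simps)
    also have "\<dots> = (\<Sum>j\<in>{N m + a m}. coord ?w i j * weight a (Suc m) i j k)"
    proof (rule sum.mono_neutral_right)
      show "{N m + a m} \<subseteq> {..<N (Suc m)}" using am N_Suc[of m] by auto
      show "\<forall>j\<in>{..<N (Suc m)} - {N m + a m}. coord ?w i j * weight a (Suc m) i j k = 0"
        using am w(3)[OF i] by auto
    qed simp
    also have "\<dots> = (\<Sum>l<N m. coord ?e i l * weight a m i l k)"
      using am N_Suc[of m] ones[OF i] by auto
    also have "\<dots> = wsum a n ?e i k"
      using e(2) i n by (simp add: wsum_eq weight_late[of m n])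
    finally show "wsum a n ?w i k mod int (q i) = wsum a n ?e i k mod int (q i)" by simp
  qed
  then have "\<phi> a n (?w \<otimes>\<^bsub>G\<^esub> inv\<^bsub>G\<^esub> ?e) = \<phi> a n (?e \<otimes>\<^bsub>G\<^esub> inv\<^bsub>G\<^esub> ?e)"
    using w(1) e(1) by (subst \<phi>_mult_right) (auto simp: H_iff)
  moreover have "?w \<otimes>\<^bsub>G\<^esub> inv\<^bsub>G\<^esub> ?e = s \<otimes>\<^bsub>G\<^esub> t"
  proof -
    have "h m \<otimes>\<^bsub>G\<^esub> (inv\<^bsub>G\<^esub> h m \<otimes>\<^bsub>G\<^esub> t) = t" using hG by (simp flip: G.m_assoc)
    then show ?thesis using hG sG by (simp add: discrepancy_def G.inv_mult G.m_assoc)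
  qed
  moreover have "?e \<otimes>\<^bsub>G\<^esub> inv\<^bsub>G\<^esub> ?e = \<one>\<^bsub>G\<^esub>" using e(1) by (simp add: H_iff)
  ultimately show ?thesis by simp
qed

definition choices :: "nat \<Rightarrow> (nat \<Rightarrow> nat) pmf" where
  "choices n = Pi_pmf {..<n} 0 (\<lambda>l. pmf_of_set {..d l})"

lemma finite_choices: "finite (set_pmf (choices n))"
proof -
  have "set_pmf (choices n) \<subseteq> PiE_dflt {..<n} 0 (\<lambda>l. {..d l})"
    unfolding choices_def using set_Pi_pmf_subset'[of "{..<n}" 0 "\<lambda>l. pmf_of_set {..d l}"]
    by (auto simp: PiE_dflt_def)
  moreover have "finite (PiE_dflt {..<n} 0 (\<lambda>l. {..d l}))" by (intro finite_PiE_dflt) auto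
  ultimately show ?thesis by (rule finite_subset)
qed

lemma prob_choice:
  assumes "m < n" "V \<subseteq> {..d m}"
  shows "measure_pmf.prob (choices n) {a. a m \<in> V} = card V / real (d m + 1)"
proof -
  have "{a. a m \<in> V} = Pi {..<n} (\<lambda>l. if l = m then V else UNIV)"
    using assms by (auto simp: Pi_def)
  then have "measure_pmf.prob (choices n) {a. a m \<in> V}
      = (\<Prod>l<n. measure_pmf.prob (pmf_of_set {..d l}) (if l = m then V else UNIV))"
    by (simp only: choices_def) (rule measure_Pi_pmf_Pi, simp)
  also have "\<dots> = (\<Prod>l<n. if l = m then measure_pmf.prob (pmf_of_set {..d m}) V else 1)"
    by (intro prod.cong refl) auto
  also have "\<dots> = card V / real (d m + 1)"
    using assms by (simp add: measure_pmf_of_set Int_absorb1)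
  finally show ?thesis .
qed

lemma prob_initial_zeros:
  assumes "m \<le> n"
  shows "measure_pmf.prob (choices n) {a. \<forall>l<m. a l = 0} = (\<Prod>l<m. 1 / real (d l + 1))"
proof -
  have eq: "{a. \<forall>l<m. a l = 0} = Pi {..<n} (\<lambda>l. if l < m then {0} else UNIV)"
    using assms by (auto simp: Pi_def)
  have "measure_pmf.prob (choices n) {a. \<forall>l<m. a l = 0}
      = (\<Prod>l<n. measure_pmf.prob (pmf_of_set {..d l}) (if l < m then {0} else UNIV))"
    unfolding choices_def eq by (rule measure_Pi_pmf_Pi) simp
  also have "\<dots> = (\<Prod>l<n. if l < m then 1 / real (d l + 1) else 1)"
    by (intro prod.cong refl) (auto simp: measure_pmf_of_set)
  also have "\<dots> = (\<Prod>l<m. 1 / real (d l + 1))"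
    using assms by (intro prod.mono_neutral_cong_right) auto
  finally show ?thesis .
qed

definition mean_card :: "nat \<Rightarrow> ('a \<times> (nat \<Rightarrow> nat \<Rightarrow> int)) set \<Rightarrow> real" where
  "mean_card n A = measure_pmf.expectation (choices n) (\<lambda>a. real (card (\<phi> a n ` A)))"

lemma integrable_choices [simp]: "integrable (measure_pmf (choices n)) (f :: _ \<Rightarrow> real)"
  using finite_choices by (rule integrable_measure_pmf_finite)

lemma mean_card_singleton: "mean_card n {u} = 1"
  by (simp add: mean_card_def)

lemma mean_card_pair:
  "mean_card n {u, v} = 1 + measure_pmf.prob (choices n) {a. \<phi> a n v \<noteq> \<phi> a n u}"
proof -
  have "real (card (\<phi> a n ` {u, v})) = 1 + indicator {a. \<phi> a n v \<noteq> \<phi> a n u} a" for a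
    by (auto simp: indicator_def card_insert_if)
  then show ?thesis by (simp add: mean_card_def)
qed

lemma mean_card_shift:
  assumes "g \<in> carrier G" "finite A" "A \<subseteq> carrier G"
  shows "mean_card n ((\<lambda>u. u \<otimes>\<^bsub>G\<^esub> g) ` A) = mean_card n A"
proof -
  have "card (\<phi> a n ` (\<lambda>u. u \<otimes>\<^bsub>G\<^esub> g) ` A) = card (\<phi> a n ` A)" for a
    unfolding image_image using assms
    by (intro card_image_same_kernel \<phi>_mult_right) blast+
  then show ?thesis by (simp add: mean_card_def)
qed

lemma mean_card_disjoint:
  assumes "finite A" "finite B" "A \<subseteq> L (N m)" "B \<subseteq> L (N m)"
  shows "mean_card n (A \<union> (\<lambda>u. u \<otimes>\<^bsub>G\<^esub> basis (N m)) ` B) = mean_card n A + mean_card n B"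
proof -
  have "real (card (\<phi> a n ` (A \<union> (\<lambda>u. u \<otimes>\<^bsub>G\<^esub> basis (N m)) ` B)))
      = real (card (\<phi> a n ` A)) + real (card (\<phi> a n ` (\<lambda>u. u \<otimes>\<^bsub>G\<^esub> basis (N m)) ` B))" for a
  proof -
    have "\<phi> a n ` A \<inter> \<phi> a n ` (\<lambda>u. u \<otimes>\<^bsub>G\<^esub> basis (N m)) ` B = {}"
      using \<phi>_fresh[of _ m _ a n] assms(3,4) by blast
    then show ?thesis using assms(1,2) by (simp add: image_Un card_Un_disjoint)
  qed
  then have "mean_card n (A \<union> (\<lambda>u. u \<otimes>\<^bsub>G\<^esub> basis (N m)) ` B)
      = mean_card n A + mean_card n ((\<lambda>u. u \<otimes>\<^bsub>G\<^esub> basis (N m)) ` B)"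
    by (simp add: mean_card_def)
  also have "mean_card n ((\<lambda>u. u \<otimes>\<^bsub>G\<^esub> basis (N m)) ` B) = mean_card n B"
    using assms L_carrier basis_closed(2) by (intro mean_card_shift) auto
  finally show ?thesis .
qed

text \<open>
The homomorphism can fail to kill \<open>s + t\<close> only if stage \<open>m\<close> makes no change or picks one of
the few coordinates where \<open>s + h m\<close> has an entry other than \<open>1\<close>.
\<close>

lemma mean_card_rigid:
  assumes n: "m < n" and tL: "t \<in> L (N m)" and s: "s \<in> S m"
  shows "mean_card n {\<one>\<^bsub>G\<^esub>, s \<otimes>\<^bsub>G\<^esub> t} \<le> 1 + 2 * \<epsilon> m"
proof -
  let ?bad = "{k \<in> {1..d m}. \<exists>i\<in>I. coord (s \<otimes>\<^bsub>G\<^esub> h m) i (N m + k) \<noteq> 1}"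
  have bad: "real (card ?bad) \<le> \<epsilon> m * d m" using S(2)[OF s] by (simp add: near_ones_def)
  have \<epsilon>0: "0 \<le> \<epsilon> m" using d_large[of m] by (rule order_trans[rotated]) simp
  have sub: "insert 0 ?bad \<subseteq> {..d m}" by auto
  have "{a. \<phi> a n (s \<otimes>\<^bsub>G\<^esub> t) \<noteq> \<phi> a n \<one>\<^bsub>G\<^esub>} \<inter> set_pmf (choices n) \<subseteq> {a. a m \<in> insert 0 ?bad}"
  proof (intro subsetI CollectI)
    fix a assume a: "a \<in> {a. \<phi> a n (s \<otimes>\<^bsub>G\<^esub> t) \<noteq> \<phi> a n \<one>\<^bsub>G\<^esub>} \<inter> set_pmf (choices n)"
    then have "a \<in> PiE_dflt {..<n} 0 (set_pmf \<circ> (\<lambda>l. pmf_of_set {..d l}))"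
      unfolding choices_def using set_Pi_pmf_subset'[of "{..<n}" 0 "\<lambda>l. pmf_of_set {..d l}"] by auto
    then have "a m \<le> d m" using n by (auto simp: PiE_dflt_def)
    then show "a m \<in> insert 0 ?bad"
      using \<phi>_stage[OF n tL s, of a] a by (cases "a m = 0") auto
  qed
  then have "measure_pmf.prob (choices n) ({a. \<phi> a n (s \<otimes>\<^bsub>G\<^esub> t) \<noteq> \<phi> a n \<one>\<^bsub>G\<^esub>} \<inter> set_pmf (choices n))
      \<le> measure_pmf.prob (choices n) {a. a m \<in> insert 0 ?bad}"
    by (intro measure_pmf.finite_measure_mono) auto
  also have "\<dots> = card (insert 0 ?bad) / real (d m + 1)"
    using n sub by (rule prob_choice)
  also have "\<dots> \<le> (1 + \<epsilon> m * d m) / real (d m + 1)"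
    using bad by (intro divide_right_mono) (auto simp: card_insert_if)
  also have "\<dots> \<le> 1 / real (d m + 1) + \<epsilon> m"
    using \<epsilon>0 by (simp add: divide_simps algebra_simps)
  also have "\<dots> \<le> 2 * \<epsilon> m" using d_large[of m] by simp
  finally show ?thesis by (simp add: mean_card_pair measure_Int_set_pmf)
qed

text \<open>
If the first \<open>m\<close> stages change nothing, then \<open>\<phi>\<close> is the identity on \<open>L (N m)\<close>.
\<close>

lemma mean_card_moved:
  assumes "g \<in> L (N m)" "g \<noteq> \<one>\<^bsub>G\<^esub>" "m \<le> n"
  shows "1 + (\<Prod>l<m. 1 / real (d l + 1)) \<le> mean_card n {\<one>\<^bsub>G\<^esub>, g}"
proof -
  have "{a. \<forall>l<m. a l = 0} \<subseteq> {a. \<phi> a n g \<noteq> \<phi> a n \<one>\<^bsub>G\<^esub>}"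
    using \<phi>_faithful[OF _ assms(1,2)] by blast
  then have "measure_pmf.prob (choices n) {a. \<forall>l<m. a l = 0}
      \<le> measure_pmf.prob (choices n) {a. \<phi> a n g \<noteq> \<phi> a n \<one>\<^bsub>G\<^esub>}"
    by (intro measure_pmf.finite_measure_mono) auto
  then show ?thesis using assms(3) by (simp add: mean_card_pair prob_initial_zeros)
qed

text \<open>
The bounds on the mean image sizes hold uniformly in the number \<open>n\<close> of stages performed, so they
survive in a limit \<open>p\<close> of the laws with exponents \<open>mean_card n\<close>.
\<close>

theorem rigid_translate:
  assumes s: "\<And>l. s l \<in> S (b l)" and b: "filterlim b at_top sequentially"
  shows "rigid_for_free_weak_mixing G (\<lambda>l. s l \<otimes>\<^bsub>G\<^esub> t)"
proof -
  let ?en = "from_nat_into (carrier G)"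
  have tG: "t \<in> carrier G" using t by (simp add: H_iff)
  have in_LN: "eventually (\<lambda>m. g \<in> L (N m)) sequentially" if g: "g \<in> carrier G" for g
  proof -
    have "eventually (\<lambda>m. g \<in> L m) sequentially" using g by (rule G.eventually_in_L)
    then show ?thesis
      by eventually_elim (use N_ge in \<open>auto simp: L_def intro: order_trans\<close>)
  qed
  have "realizable (\<lambda>U. exp (- mean_card n (?en ` U)))" for n
    using realizable_exp_image_card[OF finite_choices, of n "\<lambda>a k. \<phi> a n (?en k)"]
    by (simp add: mean_card_def image_image)
  then obtain r p where r: "strict_mono (r :: nat \<Rightarrow> nat)" and p: "realizable (\<lambda>U. p (?en ` U))"
    and lim: "\<And>A. \<lbrakk>finite A; A \<subseteq> carrier G\<rbrakk> \<Longrightarrow> (\<lambda>k. exp (- mean_card (r k) A)) \<longlonglongrightarrow> p A"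
    by (rule realizable_subsequence_on[OF G.countable_carrier infinite_carrier, of "\<lambda>n A. exp (- mean_card n A)"]) blast
  have p_eqI: "p A = x"
    if "finite A" "A \<subseteq> carrier G" "(\<lambda>k. exp (- mean_card (r k) A)) \<longlonglongrightarrow> x" for A x
    using lim[OF that(1,2)] that(3) by (rule LIMSEQ_unique)
  have p1: "p {\<one>\<^bsub>G\<^esub>} = exp (- 1)"
    by (rule p_eqI) (simp_all add: mean_card_singleton)
  have r_ge: "k \<le> r k" for k using r by (rule seq_suble)
  show ?thesis
  proof (rule G.rigid_for_free_weak_mixingI[where p = p and z = "\<lambda>m. basis (N m)"])
    show "countable (carrier G)" by (rule G.countable_carrier)
    show "infinite (carrier G)" by (rule infinite_carrier)
    show "realizable (\<lambda>U. p (?en ` U))" by (rule p)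
    show "basis (N m) \<in> carrier G" for m by (rule basis_closed)
    show "s l \<otimes>\<^bsub>G\<^esub> t \<in> carrier G" for l using S(1)[OF s] tG by simp
  next
    fix g A assume "g \<in> carrier G" "finite A" "A \<subseteq> carrier G"
    then show "p ((\<lambda>u. u \<otimes>\<^bsub>G\<^esub> g) ` A) = p A"
      by (intro p_eqI) (auto simp: mean_card_shift lim)
  next
    fix A B assume AB: "finite A" "A \<subseteq> carrier G" "finite B" "B \<subseteq> carrier G"
    have "eventually (\<lambda>m. \<forall>g\<in>A \<union> B. g \<in> L (N m)) sequentially"
      using AB in_LN by (intro eventually_ball_finite) auto
    then have "eventually (\<lambda>m. p (A \<union> (\<lambda>u. u \<otimes>\<^bsub>G\<^esub> basis (N m)) ` B) = p A * p B) sequentially"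
    proof eventually_elim
      case (elim m)
      have "(\<lambda>k. exp (- mean_card (r k) A) * exp (- mean_card (r k) B)) \<longlonglongrightarrow> p A * p B"
        by (intro tendsto_mult lim AB)
      moreover have "exp (- mean_card n (A \<union> (\<lambda>u. u \<otimes>\<^bsub>G\<^esub> basis (N m)) ` B))
          = exp (- mean_card n A) * exp (- mean_card n B)" for n
        using mean_card_disjoint[of A B m n] AB elim by (simp add: subset_iff flip: exp_add)
      ultimately show ?case
        using AB basis_closed(2) by (intro p_eqI) auto
    qed
    then show "(\<lambda>m. p (A \<union> (\<lambda>u. u \<otimes>\<^bsub>G\<^esub> basis (N m)) ` B)) \<longlonglongrightarrow> p A * p B"
      by (rule tendsto_eventually)
  next
    fix g assume g: "g \<in> carrier G" "g \<noteq> \<one>\<^bsub>G\<^esub>"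
    obtain m where m: "g \<in> L (N m)"
      using eventually_happens'[OF sequentially_bot in_LN[OF g(1)]] by blast
    let ?c = "\<Prod>l<m. 1 / real (d l + 1)"
    have "p {\<one>\<^bsub>G\<^esub>, g} \<le> exp (- (1 + ?c))"
    proof (rule LIMSEQ_le_const2[OF lim])
      have "exp (- mean_card (r k) {\<one>\<^bsub>G\<^esub>, g}) \<le> exp (- (1 + ?c))" if "k \<ge> m" for k
        using mean_card_moved[OF m g(2), of "r k"] r_ge[of k] that by simp
      then show "\<exists>K. \<forall>k\<ge>K. exp (- mean_card (r k) {\<one>\<^bsub>G\<^esub>, g}) \<le> exp (- (1 + ?c))" by blast
    qed (use g in auto)
    also have "\<dots> < exp (- 1)"
    proof -
      have "?c > 0" by (intro prod_pos) auto
      then show ?thesis by simp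
    qed
    finally show "p {\<one>\<^bsub>G\<^esub>, g} \<noteq> p {\<one>\<^bsub>G\<^esub>}" by (simp add: p1)
  next
    have lower: "exp (- (1 + 2 * \<epsilon> (b l))) \<le> p {\<one>\<^bsub>G\<^esub>, s l \<otimes>\<^bsub>G\<^esub> t}" if "t \<in> L (N (b l))" for l
    proof (rule LIMSEQ_le_const[OF lim])
      have "exp (- (1 + 2 * \<epsilon> (b l))) \<le> exp (- mean_card (r k) {\<one>\<^bsub>G\<^esub>, s l \<otimes>\<^bsub>G\<^esub> t})" if "k \<ge> Suc (b l)" for k
        using mean_card_rigid[OF _ \<open>t \<in> L (N (b l))\<close> s, of "r k"] r_ge[of k] that by simp
      then show "\<exists>K. \<forall>k\<ge>K. exp (- (1 + 2 * \<epsilon> (b l))) \<le> exp (- mean_card (r k) {\<one>\<^bsub>G\<^esub>, s l \<otimes>\<^bsub>G\<^esub> t})" by blast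
    qed (use S(1)[OF s] tG in auto)
    have upper: "p {\<one>\<^bsub>G\<^esub>, s l \<otimes>\<^bsub>G\<^esub> t} \<le> exp (- 1)" for l
    proof (rule LIMSEQ_le_const2[OF lim])
      show "\<exists>K. \<forall>k\<ge>K. exp (- mean_card (r k) {\<one>\<^bsub>G\<^esub>, s l \<otimes>\<^bsub>G\<^esub> t}) \<le> exp (- 1)"
        by (simp add: mean_card_pair)
    qed (use S(1)[OF s] tG in auto)
    have "eventually (\<lambda>l. t \<in> L (N (b l))) sequentially"
      using in_LN[OF tG] b by (rule eventually_compose_filterlim)
    then have ev: "eventually (\<lambda>l. exp (- (1 + 2 * \<epsilon> (b l))) \<le> p {\<one>\<^bsub>G\<^esub>, s l \<otimes>\<^bsub>G\<^esub> t}) sequentially"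
      by eventually_elim (rule lower)
    have "(\<lambda>l. \<epsilon> (b l)) \<longlonglongrightarrow> 0" using \<epsilon>_null b by (rule filterlim_compose)
    then have "(\<lambda>l. exp (- (1 + 2 * \<epsilon> (b l)))) \<longlonglongrightarrow> exp (- (1 + 2 * 0))" by (intro tendsto_intros)
    then show "(\<lambda>l. p {\<one>\<^bsub>G\<^esub>, s l \<otimes>\<^bsub>G\<^esub> t}) \<longlonglongrightarrow> p {\<one>\<^bsub>G\<^esub>}"
      unfolding p1 using ev upper by (intro tendsto_sandwich[OF ev _ _ tendsto_const]) auto
  qed
qed

end

section \<open>The sequence\<close>

context bounded_torsion_group
begin

lemma recurrent_in_imp_nonempty:
  assumes "G.recurrent_in m \<epsilon> R" "\<epsilon> \<le> 1"
  shows "R \<noteq> {}"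
proof -
  have "\<epsilon> * real (card (L m)) \<le> 1 * real (card (L m))" using assms(2) by (intro mult_right_mono) auto
  then show ?thesis using assms(1) unfolding G.recurrent_in_def by fastforce
qed

text \<open>
The sequence runs through the disjoint union of the stages. Each stage is finite, so the stage \<open>b l\<close> of
the \<open>l\<close>-th term tends to infinity, which gives rigidity. For recurrence of the translate by \<open>t\<close>, a set
of positive measure is handled by one late stage \<open>n\<close> with \<open>h n = t\<close>.
\<close>

theorem rigid_recurrent_sequence:
  assumes S: "recurrent_translates S"
  shows "\<exists>s :: nat \<Rightarrow> _. range s \<subseteq> S \<and> (\<forall>t\<in>H. rigid_for_free_weak_mixing G (\<lambda>n. s n \<otimes>\<^bsub>G\<^esub> t) \<and>
    set_of_recurrence G (range (\<lambda>n. s n \<otimes>\<^bsub>G\<^esub> t)))"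
proof -
  have SG: "S \<subseteq> carrier G" using S by (simp add: recurrent_translates_def)
  have countH: "countable H" by (rule countable_subset[OF _ G.countable_carrier]) (auto simp: H_iff)
  have "\<one>\<^bsub>G\<^esub> \<in> H" by (simp add: H_iff)
  then have neH: "H \<noteq> {}" by blast
  \<comment> \<open>the second component of the decoded pair makes each element of \<open>H\<close> appear infinitely often\<close>
  define h where "h n = from_nat_into H (fst (prod_decode n))" for n
  have hH: "h n \<in> H" for n unfolding h_def using neH by (rule from_nat_into)
  have h_often: "\<exists>n\<ge>k. h n = t" if t: "t \<in> H" for t k
  proof -
    let ?n = "prod_encode (to_nat_on H t, k)"
    have "h ?n = t" using countH t by (simp add: h_def)
    moreover have "k \<le> ?n" by (rule le_prod_encode_2)
    ultimately show ?thesis by blast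
  qed
  define \<epsilon> where "\<epsilon> n = 1 / real (Suc n)" for n
  have \<epsilon>: "\<epsilon> n > 0" "\<epsilon> n \<le> 1" for n by (simp_all add: \<epsilon>_def)
  have "\<exists>d m S0. 1 / real (d + 1) \<le> \<epsilon> n \<and> finite S0 \<and> S0 \<subseteq> S \<and>
      (\<lambda>s. s \<otimes>\<^bsub>G\<^esub> h n) ` S0 \<subseteq> near_ones N d (\<epsilon> n) \<and>
      (\<lambda>s. s \<otimes>\<^bsub>G\<^esub> h n) ` S0 \<subseteq> L m \<and> G.recurrent_in m (\<epsilon> n) ((\<lambda>s. s \<otimes>\<^bsub>G\<^esub> h n) ` S0)" for n N
    using exists_stage[OF S hH \<epsilon>(1), of n n N] by metis
  then obtain D M S0 where stage: "\<And>n N. 1 / real (D n N + 1) \<le> \<epsilon> n" "\<And>n N. finite (S0 n N)" "\<And>n N. S0 n N \<subseteq> S"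
      "\<And>n N. (\<lambda>s. s \<otimes>\<^bsub>G\<^esub> h n) ` S0 n N \<subseteq> near_ones N (D n N) (\<epsilon> n)"
      "\<And>n N. (\<lambda>s. s \<otimes>\<^bsub>G\<^esub> h n) ` S0 n N \<subseteq> L (M n N)"
      "\<And>n N. G.recurrent_in (M n N) (\<epsilon> n) ((\<lambda>s. s \<otimes>\<^bsub>G\<^esub> h n) ` S0 n N)"
    by metis
  have "\<exists>k. h n \<in> L k" for n
    using hH[of n] G.L_cover by (auto simp: H_iff)
  then obtain K where K: "\<And>n. h n \<in> L (K n)" by metis
  define N where "N = rec_nat (K 0) (\<lambda>n Nn. max (max (M n Nn) (K (Suc n))) (Suc (Nn + D n Nn)))"
  have N_Suc: "N (Suc n) = max (max (M n (N n)) (K (Suc n))) (Suc (N n + D n (N n)))" for n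
    by (simp add: N_def)
  define d where "d n = D n (N n)" for n
  define B where "B n = S0 n (N n)" for n
  have LN: "L m \<subseteq> L m'" if "m \<le> m'" for m m' using incseqD[OF G.L_mono that] .
  have staged: "staged_set F r q h N d \<epsilon> B"
  proof (intro staged_set.intro staged_set_axioms.intro)
    show "bounded_torsion_group F r q" by (rule bounded_torsion_group_axioms)
    show "h n \<in> H" for n by (rule hH)
    show "h n \<in> L (N n)" for n
    proof (cases n)
      case 0
      then show ?thesis using K[of 0] by (simp add: N_def)
    next
      case (Suc k)
      have "K (Suc k) \<le> N (Suc k)" by (simp add: N_Suc)
      then show ?thesis using K[of n] LN Suc by blast
    qed
    show "N n + d n < N (Suc n)" for n by (simp add: N_Suc d_def less_max_iff_disj)
    fix s n assume s: "s \<in> B n"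
    show "s \<in> carrier G" using s stage(3)[of n "N n"] SG by (auto simp: B_def)
    show "s \<otimes>\<^bsub>G\<^esub> h n \<in> near_ones (N n) (d n) (\<epsilon> n)"
      using s stage(4)[of n "N n"] by (auto simp: B_def d_def)
    have "M n (N n) \<le> N (Suc n)" by (simp add: N_Suc)
    then show "s \<otimes>\<^bsub>G\<^esub> h n \<in> L (N (Suc n))"
      using s stage(5)[of n "N n"] LN unfolding B_def by blast
  next
    show "1 / real (d n + 1) \<le> \<epsilon> n" for n using stage(1)[of n "N n"] by (simp add: d_def)
    show "\<epsilon> \<longlonglongrightarrow> 0" unfolding \<epsilon>_def by (rule LIMSEQ_Suc[OF lim_1_over_n])
  qed
  have finB: "finite (B n)" and BS: "B n \<subseteq> S" for n using stage(2,3) by (simp_all add: B_def)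
  have recB: "G.recurrent_in (M n (N n)) (\<epsilon> n) ((\<lambda>s. s \<otimes>\<^bsub>G\<^esub> h n) ` B n)" for n
    using stage(6) by (simp add: B_def)
  have neB: "B n \<noteq> {}" for n using recurrent_in_imp_nonempty[OF recB \<epsilon>(2)] by blast
  let ?P = "SIGMA n:UNIV. B n"
  have countP: "countable ?P" using finB by (intro countable_SIGMA) (auto intro: countable_finite)
  have infP: "infinite ?P"
  proof
    assume "finite ?P"
    then have "finite (fst ` ?P)" by simp
    moreover have "fst ` ?P = UNIV" using neB by (force simp: image_iff)
    ultimately show False by simp
  qed
  define e where "e = from_nat_into ?P"
  have e: "bij_betw e UNIV ?P" unfolding e_def using countP infP by (rule bij_betw_from_nat_into)
  define s where "s l = snd (e l)" for l
  define b where "b l = fst (e l)" for l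
  have sb: "s l \<in> B (b l)" for l
  proof -
    have "e l \<in> ?P" using bij_betwE[OF e] by blast
    then show ?thesis unfolding s_def b_def by (cases "e l") simp
  qed
  have range_s: "range s = (\<Union>n. B n)"
  proof (intro equalityI subsetI)
    fix x assume "x \<in> (\<Union>n. B n)"
    then obtain n where "(n, x) \<in> ?P" by blast
    then obtain l where "e l = (n, x)" using bij_betw_imp_surj_on[OF e] by (metis imageE)
    then have "s l = x" by (simp add: s_def)
    then show "x \<in> range s" by blast
  qed (use sb in blast)
  have b: "filterlim b at_top sequentially"
    unfolding filterlim_at_top
  proof
    fix m
    have "finite {l. b l < m}"
    proof (rule inj_on_finite[of e])
      show "inj_on e {l. b l < m}" using e by (auto simp: bij_betw_def intro: inj_on_subset)
      show "e ` {l. b l < m} \<subseteq> (SIGMA n:{..<m}. B n)"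
      proof (rule image_subsetI)
        fix l assume "l \<in> {l. b l < m}"
        then show "e l \<in> (SIGMA n:{..<m}. B n)"
          using sb[of l] unfolding b_def s_def by (cases "e l") simp
      qed
      show "finite (SIGMA n:{..<m}. B n)" using finB by (intro finite_SigmaI) auto
    qed
    then show "eventually (\<lambda>l. m \<le> b l) sequentially"
      by (simp add: cofinite_eq_sequentially[symmetric] eventually_cofinite not_le)
  qed
  have rigid: "rigid_for_free_weak_mixing G (\<lambda>n. s n \<otimes>\<^bsub>G\<^esub> t)" if "t \<in> H" for t
  proof -
    interpret staged_set_translate F r q h N d \<epsilon> B t
      by (intro staged_set_translate.intro staged_set_translate_axioms.intro staged that)
    show ?thesis using sb b by (rule rigid_translate)
  qed
  have rec: "set_of_recurrence G (range (\<lambda>n. s n \<otimes>\<^bsub>G\<^esub> t))" if t: "t \<in> H" for t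
    unfolding set_of_recurrence_def
  proof (intro allI impI)
    fix M' :: "(nat \<Rightarrow> real) measure" and T D'
    assume sys: "G_system G M' T" and D': "D' \<in> sets M'" "0 < measure M' D'"
    obtain k where k: "inverse (real (Suc k)) < measure M' D'" using reals_Archimedean[OF D'(2)] by blast
    obtain n where n: "n \<ge> k" "h n = t" using h_often[OF t] by blast
    have "\<epsilon> n \<le> \<epsilon> k" using n(1) by (simp add: \<epsilon>_def frac_le)
    then have "\<epsilon> n \<le> measure M' D'" using k by (simp add: \<epsilon>_def inverse_eq_divide)
    moreover have "(\<lambda>s. s \<otimes>\<^bsub>G\<^esub> h n) ` B n \<subseteq> carrier G"
    proof (rule image_subsetI)
      fix x assume "x \<in> B n"
      then have "x \<in> carrier G" using BS SG by blast
      then show "x \<otimes>\<^bsub>G\<^esub> h n \<in> carrier G" using hH[of n] by (simp add: H_iff)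
    qed
    ultimately obtain g where g: "g \<in> (\<lambda>s. s \<otimes>\<^bsub>G\<^esub> h n) ` B n" "measure M' (D' \<inter> T g ` D') > 0"
      using G.recurrent_in_imp_recurrence[OF recB _ sys D'(1), of n] by blast
    then obtain b' where b': "b' \<in> B n" "g = b' \<otimes>\<^bsub>G\<^esub> t" using n(2) by blast
    then have "b' \<in> range s" unfolding range_s by blast
    then have "g \<in> range (\<lambda>n. s n \<otimes>\<^bsub>G\<^esub> t)" using b' by blast
    then show "\<exists>g\<in>range (\<lambda>n. s n \<otimes>\<^bsub>G\<^esub> t). 0 < measure M' (D' \<inter> T g ` D')" using g(2) by blast
  qed
  have "range s \<subseteq> S" unfolding range_s using BS by blast
  then show ?thesis using rigid rec by blast
qed

end

theorem theorem1p6: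
  fixes F :: "('f, 'm) monoid_scheme" and r :: nat and q :: "nat \<Rightarrow> nat"
    and S :: "('f \<times> (nat \<Rightarrow> nat \<Rightarrow> int)) set"
  assumes "comm_group F" and "finite (carrier F)"
    and "r \<ge> 1" and "\<And>i. i \<in> {1..r} \<Longrightarrow> q i \<ge> 2"
    and "S \<subseteq> carrier (ambient_group F r q)"
    and "\<And>h. h \<in> Sigma_part F r q \<Longrightarrow>
           set_of_recurrence (ambient_group F r q) (S #>\<^bsub>ambient_group F r q\<^esub> h)"
  shows "\<exists>s :: nat \<Rightarrow> 'f \<times> (nat \<Rightarrow> nat \<Rightarrow> int).
           range s \<subseteq> S \<and>
           (\<forall>h \<in> Sigma_part F r q.
              rigid_for_free_weak_mixing (ambient_group F r q)
                (\<lambda>n. s n \<otimes>\<^bsub>ambient_group F r q\<^esub> h) \<and>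
              set_of_recurrence (ambient_group F r q)
                (range (\<lambda>n. s n \<otimes>\<^bsub>ambient_group F r q\<^esub> h)))"
proof -
  interpret bounded_torsion_group F r q
    by (rule bounded_torsion_group.intro) (use assms(1-4) in auto)
  have "recurrent_translates S"
    using assms(5,6) unfolding recurrent_translates_def r_coset_def UNION_singleton_eq_range by blast
  then show ?thesis by (rule rigid_recurrent_sequence)
qed

end
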